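(* Let $\Omega=[0,1)$ with Lebesgue measure $\mathbb P$ and let $p(\cdot):[0,1)\to(0,\infty)$ be measurable with $p_-=\operatorname{ess\,inf}p$, $p_+=\operatorname{ess\,sup}p$, $0<p_-\le p_+<\infty$. Assume that there is a constant $K\ge 1$ such that $\mathbb P(A)^{p_-(A)-p_+(A)}\le K$ for every dyadic interval $A\subset[0,1)$, that $\frac1{p_-}-\frac1{p_+}<1$, and that $1/2<p_-<\infty$. Let $f\in H_{p(\cdot)}$. If there exists a dyadic interval $I$ such that the restriction $f\chi_I\in L_1(I)$, then $$\lim_{n\to\infty}\sigma_nf=f\qquad\text{in the } L_{p(\cdot)}(I)\text{-norm, i.e. } \|(\sigma_nf-f)\chi_I\|_{p(\cdot)}\to0.$$
   Context: For measurable $A\subset[0,1)$, $p_-(A)=\operatorname{ess\,inf}_{x\in A}p(x)$ and $p_+(A)=\operatorname{ess\,sup}_{x\in A}p(x)$. $\|f\|_{p(\cdot)}=\inf\{\lambda>0:\int_0^1(|f(x)|/\lambda)^{p(x)}dx\le1\}$. Dyadic intervals are $[k2^{-n},(k+1)2^{-n})$, $n\in\mathbb N=\{0,1,2,\dots\}$, $0\le k<2^n$; $\mathcal F_n$ is the $\sigma$-algebra generated by the dyadic intervals of length $2^{-n}$. Martingales $f=(f_n)_{n\ge0}$ are taken with respect to $(\mathcal F_n)$. $M(f)=\sup_{n\ge0}|f_n|$. $H_{p(\cdot)}$ is the space of martingales with $\|f\|_{H_{p(\cdot)}}=\|M(f)\|_{p(\cdot)}<\infty$ (the paper uses this notation for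 any of five martingale Hardy spaces, which coincide with equivalent quasi-norms in the dyadic setting; this is one of them). For a dyadic interval $I$ of length $2^{-k}$, the restriction of the martingale $f$ to $I$ is the sequence $f\chi_I=(f_n\chi_I)_{n\ge k}$. The condition $f\chi_I\in L_1(I)$ means that this martingale is generated by an integrable function on $I$, again denoted $f$: there is $f\in L_1(I)$ with $f_n\chi_I=\mathbb E(f\chi_I|\mathcal F_n)$ for all $n\ge k$; this function is the $f$ in the conclusion. Walsh system: $r(x)=1$ on $[0,1/2)$, $r(x)=-1$ on $[1/2,1)$, extended with period 1; $r_n(x)=r(2^nx)$; for $n=\sum_{k\ge0}n_k2^k$ with $n_k\in\{0,1\}$, $w_n=\prod_{k\ge0}r_k^{n_k}$. For a martingale $f$, $\widehat f(n)=\lim_{k\to\infty}\mathbb E(f_kw_n)$ (the sequence is eventually constant). Partial sums: $s_nf=\sum_{k=0}^{n-1}\widehat f(k)w_k$. Fejér means: $\sigma_nf=\frac1n\sum_{k=1}^ns_kf$, $n\ge1$. *)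

theory Defs
  imports "HOL-Probability.Probability"
begin

definition Omega :: "real measure" where
  "Omega = lebesgue_on {0..<1}"

text \<open>Real exponents for extended nonnegative reals; only used with positive exponents,
  so that \<open>\<infinity>\<close> is mapped to \<open>\<infinity>\<close> and \<open>0\<close> to \<open>0\<close>.\<close>

definition ennreal_powr :: "ennreal \<Rightarrow> real \<Rightarrow> ennreal" where
  "ennreal_powr a q = (if a = \<infinity> then \<infinity> else ennreal (enn2real a powr q))"

definition p_minus :: "(real \<Rightarrow> real) \<Rightarrow> real set \<Rightarrow> ereal" where
  "p_minus p A = - esssup (lebesgue_on A) (\<lambda>x. - ereal (p x))"

definition p_plus :: "(real \<Rightarrow> real) \<Rightarrow> real set \<Rightarrow> ereal" where
  "p_plus p A = esssup (lebesgue_on A) (\<lambda>x. ereal (p x))"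

text \<open>The variable Lebesgue quasi-norm of a \<open>[0, \<infinity>]\<close>-valued function (maximal functions may take
  the value \<open>\<infinity>\<close>); it is \<open>\<infinity>\<close> when no admissible \<open>\<lambda>\<close> exists. A real-valued function
  \<open>g\<close> enters through \<open>\<lambda>x. ennreal \<bar>g x\<bar>\<close>.\<close>

definition Lp_norm :: "(real \<Rightarrow> real) \<Rightarrow> (real \<Rightarrow> ennreal) \<Rightarrow> ennreal" where
  "Lp_norm p h = Inf {ennreal l | l :: real. 0 < l \<and>
     (\<integral>\<^sup>+ x. ennreal_powr (h x / ennreal l) (p x) \<partial>Omega) \<le> 1}"

definition dyadic_intervals :: "nat \<Rightarrow> real set set" where
  "dyadic_intervals n = {{real k / 2 ^ n ..< (real k + 1) / 2 ^ n} | k :: nat. k < 2 ^ n}"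

definition dyadic_sigma :: "nat \<Rightarrow> real measure" where
  "dyadic_sigma n = sigma {0..<1} (dyadic_intervals n)"

definition dyadic_martingale :: "(nat \<Rightarrow> real \<Rightarrow> real) \<Rightarrow> bool" where
  "dyadic_martingale f \<longleftrightarrow>
     (\<forall>n. f n \<in> borel_measurable (dyadic_sigma n)) \<and>
     (\<forall>n. integrable Omega (f n)) \<and>
     (\<forall>m n. m \<le> n \<longrightarrow> (AE x in Omega. real_cond_exp Omega (dyadic_sigma m) (f n) x = f m x))"

definition maximal_function :: "(nat \<Rightarrow> real \<Rightarrow> real) \<Rightarrow> real \<Rightarrow> ennreal" where
  "maximal_function f x = (SUP n. ennreal \<bar>f n x\<bar>)"

definition Hardy_norm :: "(real \<Rightarrow> real) \<Rightarrow> (nat \<Rightarrow> real \<Rightarrow> real) \<Rightarrow> ennreal" where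
  "Hardy_norm p f = Lp_norm p (maximal_function f)"

definition Hardy_space :: "(real \<Rightarrow> real) \<Rightarrow> (nat \<Rightarrow> real \<Rightarrow> real) set" where
  "Hardy_space p = {f. dyadic_martingale f \<and> Hardy_norm p f < \<infinity>}"

text \<open>The restriction \<open>(f n \<chi>\<^sub>I)\<close>, \<open>n \<ge> k\<close>, of the martingale \<open>f\<close> to an interval \<open>I\<close>
  of length \<open>2\<close> to the power \<open>-k\<close> is generated by the function \<open>g \<in> L\<^sub>1(I)\<close>.\<close>

definition restriction_generated_by ::
  "(nat \<Rightarrow> real \<Rightarrow> real) \<Rightarrow> nat \<Rightarrow> real set \<Rightarrow> (real \<Rightarrow> real) \<Rightarrow> bool" where
  "restriction_generated_by f k I g \<longleftrightarrow>
     integrable (lebesgue_on I) g \<and>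
     (\<forall>n\<ge>k. AE x in Omega. f n x * indicator I x =
        real_cond_exp Omega (dyadic_sigma n) (\<lambda>y. g y * indicator I y) x)"

definition rademacher :: "nat \<Rightarrow> real \<Rightarrow> real" where
  "rademacher n x = (if frac (2 ^ n * x) < 1 / 2 then 1 else - 1)"

text \<open>\<open>bit n k\<close> says that the \<open>k\<close>-th binary digit of \<open>n\<close> is \<open>1\<close>. For \<open>n\<close> a natural number
  there are only finitely many such \<open>k\<close>, so the product below is a genuine one.\<close>

definition walsh :: "nat \<Rightarrow> real \<Rightarrow> real" where
  "walsh n x = (\<Prod>k | bit n k. rademacher k x)"

lemma finite_bits: "finite {k. bit (n :: nat) k}"
proof (rule finite_subset)
  show "{k. bit n k} \<subseteq> {..<n}"
  proof
    fix k assume "k \<in> {k. bit n k}"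
    then have "odd (n div 2 ^ k)" by (simp add: bit_iff_odd)
    then have "n div 2 ^ k \<noteq> 0" by (auto intro: ccontr)
    then have "2 ^ k \<le> n" by (simp add: div_eq_0_iff not_less)
    then show "k \<in> {..<n}" by (metis lessThan_iff less_exp less_le_trans)
  qed
qed simp

definition walsh_coeff :: "(nat \<Rightarrow> real \<Rightarrow> real) \<Rightarrow> nat \<Rightarrow> real" where
  "walsh_coeff f n = lim (\<lambda>k. \<integral>x. f k x * walsh n x \<partial>Omega)"

definition walsh_sum :: "(nat \<Rightarrow> real \<Rightarrow> real) \<Rightarrow> nat \<Rightarrow> real \<Rightarrow> real" where
  "walsh_sum f n x = (\<Sum>k<n. walsh_coeff f k * walsh k x)"

definition fejer_mean :: "(nat \<Rightarrow> real \<Rightarrow> real) \<Rightarrow> nat \<Rightarrow> real \<Rightarrow> real" where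
  "fejer_mean f n x = (\<Sum>k=1..n. walsh_sum f k x) / real n"

end

theory Submission
  imports Defs
begin

text \<open>
  Let \<open>2 ^ m \<le> n < 2 ^ Suc m\<close>. The proof dominates the difference of the Fejer mean and \<open>f m\<close> by a
  positive operator applied to a nonnegative step function of level \<open>m\<close>, and estimates that
  operator in the variable Lebesgue space.

  The domination rests on two observations. Flipping the \<open>j\<close>-th binary digit of the argument
  multiplies the Walsh function of index \<open>l\<close> by \<open>1\<close> or \<open>-1\<close> according to the \<open>j\<close>-th binary
  digit of \<open>l\<close>. Multiplication of the \<open>l\<close>-th Walsh coefficient by \<open>l\<close> is therefore the dyadic
  derivative \<open>\<Sum>j. 2 ^ j / 2 * (F x - F (flip j x))\<close>, and the contribution of the frequencies
  below \<open>2 ^ m\<close> to the Fejer mean differs from \<open>f m\<close> by the dyadic derivative of \<open>f m\<close> divided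
  by \<open>n\<close>. Secondly, the frequencies between \<open>2 ^ m\<close> and \<open>n\<close> form, up to the sign
  \<open>rademacher m\<close>, a Fejer sum of lower order of the function
  \<open>rademacher m * (f (Suc m) - f m)\<close>, which is constant on the cells of level \<open>m\<close>; to this sum
  the same splitting applies recursively (\<open>fejer_sum_bound\<close>). Since step functions of a level
  \<open>N \<le> m\<close> are changed only by flips of the first \<open>N\<close> digits, the result
  (\<open>fejer_mean_bound\<close>) is, with \<open>h = \<bar>f m - f N\<bar> + \<bar>f (Suc m) - f m\<bar>\<close> and \<open>E\<^sub>i\<close> for the
  average over cells of level \<open>i\<close>, a bound by
  \<open>\<Sum>j\<le>m. \<Sum>i=j..m. 2 ^ j / 2 ^ m * (E\<^sub>i h) (flip j x)\<close> up to a constant factor and an error of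
  order \<open>2 ^ N / 2 ^ m\<close>.

  In the modular \<open>\<integral> \<bar>h x\<bar> powr p x\<close>, the terms of this sum decay geometrically in \<open>m - j\<close>,
  uniformly over the step functions \<open>h\<close> of level \<open>m\<close> with modular at most \<open>1\<close>
  (\<open>shifted_average_pointwise\<close>, \<open>modular_shift_op\<close>). Let \<open>r\<close> be the essential infimum of \<open>p\<close> on
  the cell of level \<open>j\<close> around \<open>x\<close>. Comparing the average of \<open>h\<close> with its power mean of order
  \<open>r\<close> costs \<open>2 powr ((m - i) * (1 / r - 1))\<close> if \<open>r < 1\<close>, which the part \<open>2 powr (i - m)\<close> of the
  weight absorbs since \<open>p\<^sub>- > 1 / 2\<close>. Passing from the exponent \<open>r\<close> to \<open>p x\<close> costs
  \<open>2 powr (i * (p x - r) / r)\<close>: the condition on \<open>\<bar>A\<bar> powr (p\<^sub>-(A) - p\<^sub>+(A))\<close> bounds the share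
  of \<open>j\<close> in \<open>i\<close>, and the part \<open>2 powr (j - i)\<close> of the weight absorbs the share of \<open>i - j\<close>
  since \<open>1 / p\<^sub>- - 1 / p\<^sub>+ < 1\<close>.

  Let \<open>k\<close> be the level of \<open>I\<close>. For \<open>x \<in> I\<close> the terms with \<open>j \<ge> k\<close> involve only the values of
  \<open>h\<close> on \<open>I\<close>. There \<open>f n\<close> tends to \<open>g\<close> in \<open>L\<^sub>1\<close> and, being dominated by the maximal function,
  also in the modular, so that \<open>h\<close> is small on \<open>I\<close> for large \<open>N\<close>. The terms with \<open>j < k\<close> tend
  to \<open>0\<close> as \<open>m\<close> grows, by the geometric decay, because \<open>h\<close> is dominated by the maximal function
  everywhere (\<open>fejer_modular_tendsto\<close>). For a bounded exponent, convergence to \<open>0\<close> of the modular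
  and of the quasi-norm are the same.
\<close>

section \<open>Walsh functions and digit flips\<close>

lemma rademacher_floor: "rademacher k x = (if even \<lfloor>2 ^ Suc k * x\<rfloor> then 1 else - 1)"
proof -
  define t where "t = 2 ^ k * x"
  have e: "2 ^ Suc k * x = 2 * t" by (simp add: t_def)
  show ?thesis
  proof (cases "frac t < 1/2")
    case True
    then have "\<lfloor>2 * t\<rfloor> = 2 * \<lfloor>t\<rfloor>"
      unfolding frac_def by (intro floor_unique) (auto simp: le_floor_iff)
    then show ?thesis using True unfolding e rademacher_def by (simp add: t_def)
  next
    case False
    then have "\<lfloor>2 * t\<rfloor> = 2 * \<lfloor>t\<rfloor> + 1"
      unfolding frac_def by (intro floor_unique) (auto, linarith)
    then show ?thesis using False unfolding e rademacher_def by (simp add: t_def)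
  qed
qed

lemma floor_half: "\<lfloor>2 ^ m * (x::real)\<rfloor> = \<lfloor>2 ^ Suc m * x\<rfloor> div 2"
proof -
  have "\<lfloor>(2 ^ Suc m * x) / real_of_int 2\<rfloor> = \<lfloor>2 ^ Suc m * x\<rfloor> div 2"
    by (rule floor_divide_real_eq_div) simp
  then show ?thesis by simp
qed

lemma floor_mono_level:
  fixes x y :: real
  assumes "\<lfloor>2 ^ n * x\<rfloor> = \<lfloor>2 ^ n * y\<rfloor>" and "m \<le> n"
  shows "\<lfloor>2 ^ m * x\<rfloor> = \<lfloor>2 ^ m * y\<rfloor>"
  using assms(2)
proof (induction m rule: inc_induct)
  case base
  show ?case using assms(1) .
next
  case (step m)
  then show ?case using floor_half[of m x] floor_half[of m y] by simp
qed

lemma abs_rademacher [simp]: "\<bar>rademacher k x\<bar> = 1"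
  by (auto simp: rademacher_def)

text \<open>Flipping the binary digit of \<open>x\<close> with weight \<open>2 powr -(j + 1)\<close>, that is, the dyadic
  translation of \<open>x\<close> by \<open>1 / 2 ^ Suc j\<close>. The Walsh functions are characters of dyadic
  translation, so every statement below about translations reduces to signs.\<close>

definition flip :: "nat \<Rightarrow> real \<Rightarrow> real" where
  "flip j x = x + rademacher j x / 2 ^ Suc j"

text \<open>The digit sits just below the resolution of \<open>2 ^ j\<close>: in units of \<open>1 / 2 ^ j\<close> the flip
  moves the fractional part by one half, upwards from the left half and downwards from the right
  half, and so never crosses an integer.\<close>

lemma floor_flip: "\<lfloor>2 ^ j * flip j x\<rfloor> = \<lfloor>2 ^ j * x\<rfloor>"
  and rademacher_flip_self: "rademacher j (flip j x) = - rademacher j x"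
proof -
  define t where "t = 2 ^ j * x"
  have e: "2 ^ j * flip j x = t + rademacher j x / 2"
    by (simp add: flip_def t_def field_simps)
  have a: "\<lfloor>t + rademacher j x / 2\<rfloor> = \<lfloor>t\<rfloor>"
  proof (cases "frac t < 1/2")
    case True
    then show ?thesis unfolding frac_def rademacher_def t_def[symmetric]
      by (intro floor_unique) (auto simp: le_floor_iff frac_def, linarith+)
  next
    case False
    then show ?thesis unfolding frac_def rademacher_def t_def[symmetric]
      by (intro floor_unique) (auto simp: frac_def, linarith+)
  qed
  then show "\<lfloor>2 ^ j * flip j x\<rfloor> = \<lfloor>2 ^ j * x\<rfloor>" unfolding e t_def .
  have "frac (t + rademacher j x / 2) = frac t + rademacher j x / 2"
    using a unfolding frac_def by simp
  moreover have "0 \<le> frac t" "frac t < 1" by (simp_all add: frac_lt_1)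
  ultimately show "rademacher j (flip j x) = - rademacher j x"
    unfolding rademacher_def[of j "flip j x"] e
    unfolding rademacher_def t_def[symmetric] by (auto simp: leD[OF frac_ge_0])
qed

lemma rademacher_flip:
  "rademacher k (flip j x) = (if k = j then - rademacher k x else rademacher k x)"
proof -
  consider "k < j" | "k = j" | "j < k" by linarith
  then show ?thesis
  proof cases
    case 1
    then show ?thesis
      using floor_mono_level[OF floor_flip, of "Suc k" j x]
      by (simp add: rademacher_floor del: power_Suc)
  next
    case 2
    then show ?thesis by (simp add: rademacher_flip_self)
  next
    case 3
    then obtain d where d: "k = Suc (j + d)" using less_iff_Suc_add by auto
    have "2 ^ k * flip j x = 2 ^ k * x + 2 ^ d * rademacher j x"
      unfolding flip_def d by (simp add: field_simps power_add)
    also have "\<dots> = 2 ^ k * x + of_int (if rademacher j x = 1 then 2 ^ d else - (2 ^ d))"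
      by (auto simp: rademacher_def)
    finally have "frac (2 ^ k * flip j x) = frac (2 ^ k * x)"
      unfolding frac_def by (simp only: floor_add_int) simp
    then show ?thesis using 3 by (simp add: rademacher_def)
  qed
qed

lemma flip_unit:
  assumes "x \<in> {0..<1}" shows "flip j x \<in> {0..<1}"
proof -
  have "\<lfloor>2 ^ 0 * flip j x\<rfloor> = \<lfloor>2 ^ 0 * x\<rfloor>"
    by (rule floor_mono_level[OF floor_flip]) simp
  moreover have "\<lfloor>x\<rfloor> = 0" using assms by (simp add: floor_eq_iff)
  ultimately have "\<lfloor>flip j x\<rfloor> = 0" by simp
  then show ?thesis by (simp add: floor_eq_iff)
qed

lemma walsh_flip: "walsh l (flip j x) = (if bit l j then - walsh l x else walsh l x)"
proof (cases "bit l j")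
  case True
  then have s: "{k. bit l k} = insert j ({k. bit l k} - {j})" by auto
  have "walsh l (flip j x) = rademacher j (flip j x) * (\<Prod>k\<in>{k. bit l k} - {j}. rademacher k (flip j x))"
    unfolding walsh_def by (subst s, subst prod.insert) (auto simp: finite_bits)
  also have "\<dots> = - (rademacher j x * (\<Prod>k\<in>{k. bit l k} - {j}. rademacher k x))"
    by (simp add: rademacher_flip)
  also have "rademacher j x * (\<Prod>k\<in>{k. bit l k} - {j}. rademacher k x) = walsh l x"
    unfolding walsh_def by (subst (2) s, subst prod.insert) (auto simp: finite_bits)
  finally show ?thesis using True by simp
next
  case False
  then show ?thesis unfolding walsh_def
    by (auto intro!: prod.cong simp: rademacher_flip)
qed

lemma bit_less_two_power: "bit (l::nat) k \<Longrightarrow> l < 2 ^ m \<Longrightarrow> k < m"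
  by (metis bit_take_bit_iff take_bit_nat_eq_self)

lemma bits_add_two_power:
  assumes "l < (2::nat) ^ m"
  shows "{k. bit (2 ^ m + l) k} = insert m {k. bit l k}"
proof -
  have "\<not> bit l m" using bit_less_two_power[OF _ assms] by blast
  then have "2 ^ m + l = set_bit m l" by (simp add: set_bit_eq)
  then show ?thesis by (auto simp: bit_set_bit_iff)
qed

lemma walsh_add_two_power:
  assumes "l < (2::nat) ^ m"
  shows "walsh (2 ^ m + l) x = rademacher m x * walsh l x"
proof -
  have "\<not> bit l m" using bit_less_two_power[OF _ assms] by blast
  then show ?thesis unfolding walsh_def bits_add_two_power[OF assms]
    by (subst prod.insert) (auto simp: finite_bits)
qed

lemma sum_bits:
  "l < (2::nat) ^ m \<Longrightarrow> real l = (\<Sum>j<m. 2 ^ j * of_bool (bit l j))"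
proof (induction m arbitrary: l)
  case 0
  then show ?case by simp
next
  case (Suc m)
  show ?case
  proof (cases "l < 2 ^ m")
    case True
    then have "\<not> bit l m" using bit_less_two_power by blast
    then show ?thesis using Suc.IH[OF True] by simp
  next
    case False
    define l' where "l' = l - 2 ^ m"
    have l: "l = 2 ^ m + l'" and l': "l' < 2 ^ m" using False Suc.prems by (auto simp: l'_def)
    have b: "bit l j \<longleftrightarrow> j = m \<or> bit l' j" for j
      using bits_add_two_power[OF l'] unfolding l by blast
    have "(\<Sum>j<Suc m. 2 ^ j * of_bool (bit l j)) = (\<Sum>j<m. 2 ^ j * of_bool (bit l' j)) + (2 ^ m :: real)"
      by (simp add: b)
    then show ?thesis using Suc.IH[OF l'] by (simp add: l)
  qed
qed

text \<open>Since the flip of digit \<open>j\<close> changes the sign of \<open>walsh l\<close> exactly when \<open>2 ^ j\<close> occurs in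
  the binary expansion of \<open>l\<close>, half the difference picks out that binary digit of \<open>l\<close>. The
  right-hand side is the dyadic derivative of Butzer and Wagner. It turns the Fejer weights
  \<open>n - l\<close> into an operation on function values.\<close>

lemma walsh_dyadic_derivative:
  assumes "l < (2::nat) ^ m"
  shows "real l * walsh l x = (\<Sum>j<m. 2 ^ j / 2 * (walsh l x - walsh l (flip j x)))"
  unfolding sum_bits[OF assms] sum_distrib_right
  by (rule sum.cong) (auto simp: walsh_flip)

section \<open>Fejer sums and the dyadic derivative\<close>

text \<open>Both sums are kept for an arbitrary coefficient sequence, because the recursion for Fejer sums
  passes to shifted sequences, which are not Walsh coefficients of the martingale any more.
  \<open>fejer_sum c n\<close> is \<open>n\<close> times the Fejer mean.\<close>

definition dyadic_sum :: "(nat \<Rightarrow> real) \<Rightarrow> nat \<Rightarrow> real \<Rightarrow> real" where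
  "dyadic_sum c m x = (\<Sum>l<2 ^ m. c l * walsh l x)"

definition fejer_sum :: "(nat \<Rightarrow> real) \<Rightarrow> nat \<Rightarrow> real \<Rightarrow> real" where
  "fejer_sum c n x = (\<Sum>l<n. (real n - real l) * c l * walsh l x)"

lemma sum_lessThan_add:
  fixes u :: "nat \<Rightarrow> real"
  shows "(\<Sum>l<a + b. u l) = (\<Sum>l<a. u l) + (\<Sum>l<b. u (a + l))"
  by (induction b) (auto simp: algebra_simps)

lemma dyadic_sum_Suc:
  "dyadic_sum c (Suc m) x = dyadic_sum c m x + rademacher m x * dyadic_sum (\<lambda>l. c (2 ^ m + l)) m x"
proof -
  have "(2::nat) ^ Suc m = 2 ^ m + 2 ^ m" by simp
  then show ?thesis unfolding dyadic_sum_def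
    by (simp only: sum_lessThan_add sum_distrib_left)
      (simp add: walsh_add_two_power mult.left_commute cong: sum.cong_simp)
qed

lemma dyadic_sum_flip_ge:
  assumes "m \<le> j" shows "dyadic_sum c m (flip j x) = dyadic_sum c m x"
  unfolding dyadic_sum_def
proof (rule sum.cong)
  fix l assume "l \<in> {..<(2::nat) ^ m}"
  then have "\<not> bit l j" using bit_less_two_power[of l j m] assms by auto
  then show "c l * walsh l (flip j x) = c l * walsh l x" by (simp add: walsh_flip)
qed simp

text \<open>Dyadic partial sums are conditional expectations of each other; at the level of function values
  this is averaging over a digit flip.\<close>

lemma dyadic_sum_average:
  "dyadic_sum c m x = (dyadic_sum c (Suc m) x + dyadic_sum c (Suc m) (flip m x)) / 2"
  by (simp add: dyadic_sum_Suc dyadic_sum_flip_ge rademacher_flip)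

text \<open>The frequencies below \<open>2 ^ m\<close> are summed in closed form by the dyadic derivative; those from
  \<open>2 ^ m\<close> on carry the common factor \<open>rademacher m\<close> and form a Fejer sum of order
  \<open>n' \<le> 2 ^ m\<close>, which permits recursion.\<close>

lemma fejer_sum_split:
  assumes "n' \<le> 2 ^ m"
  shows "fejer_sum c (2 ^ m + n') x =
    real (2 ^ m + n') * dyadic_sum c m x
    - (\<Sum>j<m. 2 ^ j / 2 * (dyadic_sum c m x - dyadic_sum c m (flip j x)))
    + rademacher m x * fejer_sum (\<lambda>l. c (2 ^ m + l)) n' x"
proof -
  have 1: "(\<Sum>l<2 ^ m. c l * (real l * walsh l x)) =
      (\<Sum>j<m. 2 ^ j / 2 * (dyadic_sum c m x - dyadic_sum c m (flip j x)))"
  proof -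
    have "(\<Sum>l<2 ^ m. c l * (real l * walsh l x)) =
      (\<Sum>l<2 ^ m. \<Sum>j<m. 2 ^ j / 2 * (c l * walsh l x - c l * walsh l (flip j x)))"
    proof (rule sum.cong)
      fix l assume "l \<in> {..<(2::nat) ^ m}"
      then have "l < 2 ^ m" by simp
      show "c l * (real l * walsh l x) =
          (\<Sum>j<m. 2 ^ j / 2 * (c l * walsh l x - c l * walsh l (flip j x)))"
        unfolding walsh_dyadic_derivative[OF \<open>l < 2 ^ m\<close>] sum_distrib_left
        by (rule sum.cong) (auto simp: field_simps)
    qed simp
    also have "\<dots> = (\<Sum>j<m. \<Sum>l<2 ^ m. 2 ^ j / 2 * (c l * walsh l x - c l * walsh l (flip j x)))"
      by (rule sum.swap)
    also have "\<dots> = (\<Sum>j<m. 2 ^ j / 2 * (dyadic_sum c m x - dyadic_sum c m (flip j x)))"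
      by (simp only: dyadic_sum_def sum_subtractf[symmetric] sum_distrib_left[symmetric])
    finally show ?thesis .
  qed
  have "(\<Sum>l<2 ^ m. (real (2 ^ m + n') - real l) * c l * walsh l x) =
     real (2 ^ m + n') * dyadic_sum c m x - (\<Sum>l<2 ^ m. c l * (real l * walsh l x))"
    by (simp add: dyadic_sum_def sum_subtractf[symmetric] sum_distrib_left algebra_simps)
  moreover have "(\<Sum>l<n'. (real (2 ^ m + n') - real (2 ^ m + l)) * c (2 ^ m + l) * walsh (2 ^ m + l) x)
     = rademacher m x * fejer_sum (\<lambda>l. c (2 ^ m + l)) n' x"
    unfolding fejer_sum_def sum_distrib_left
    by (rule sum.cong) (use assms in \<open>auto simp: walsh_add_two_power\<close>)
  ultimately show ?thesis unfolding fejer_sum_def[of c] sum_lessThan_add 1 by simp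
qed

text \<open>Iterating the splitting produces one closed-form contribution for each binary digit of \<open>n\<close>.
  The hypotheses only ask for a family \<open>Q\<close> that is averaged by digit flips like a martingale and
  dominates at the top level: this is inherited by the shifted coefficient sequences, whose dyadic
  sums are, up to sign, half differences of values on sibling cells.\<close>

lemma fejer_sum_bound:
  fixes Q :: "nat \<Rightarrow> real \<Rightarrow> real"
  assumes avg: "\<And>i x. i < m \<Longrightarrow> Q i x = (Q (Suc i) x + Q (Suc i) (flip i x)) / 2"
    and top: "\<And>x. x \<in> {0..<1} \<Longrightarrow> \<bar>dyadic_sum c m x\<bar> \<le> Q m x"
    and n: "n < 2 ^ m" and x: "x \<in> {0..<1}"
  shows "\<bar>fejer_sum c n x\<bar> \<le>
    (\<Sum>i<m. 2 ^ Suc i * Q i x + (\<Sum>j<i. 2 ^ j / 2 * (Q i x + Q i (flip j x))))"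
  using assms
proof (induction m arbitrary: c n x)
  case 0
  then show ?case by (simp add: fejer_sum_def)
next
  case (Suc m)
  let ?B = "\<lambda>i x. 2 ^ Suc i * Q i x + (\<Sum>j<i. 2 ^ j / 2 * (Q i x + Q i (flip j x)))"
  have avgm: "Q m x = (Q (Suc m) x + Q (Suc m) (flip m x)) / 2" for x
    by (rule Suc.prems) simp
  have topm: "\<bar>dyadic_sum c m x\<bar> \<le> Q m x" if "x \<in> {0..<1}" for x
    using Suc.prems(2)[OF that] Suc.prems(2)[OF flip_unit[OF that], of m]
    unfolding avgm[of x] dyadic_sum_average[of c m x] abs_le_iff by (simp add: field_simps)
  have posm: "0 \<le> Q m x" if "x \<in> {0..<1}" for x using topm[OF that] by linarith
  show ?case
  proof (cases "n < 2 ^ m")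
    case True
    have "\<bar>fejer_sum c n x\<bar> \<le> (\<Sum>i<m. ?B i x)"
      by (rule Suc.IH) (use Suc.prems topm True in auto)
    moreover have "0 \<le> ?B m x"
      by (intro add_nonneg_nonneg sum_nonneg mult_nonneg_nonneg posm flip_unit Suc.prems(4)) auto
    ultimately show ?thesis by simp
  next
    case False
    define n' where "n' = n - 2 ^ m"
    have n: "n = 2 ^ m + n'" and n': "n' < 2 ^ m" using False Suc.prems(3) by (auto simp: n'_def)
    let ?c = "\<lambda>l. c (2 ^ m + l)"
    \<comment> \<open>The block of frequencies between \<open>2 ^ m\<close> and \<open>2 ^ Suc m\<close> is, up to the sign of
      \<open>rademacher m\<close>, half the difference of the two values on sibling cells.\<close>
    have "\<bar>dyadic_sum ?c m x\<bar> \<le> Q m x" if "x \<in> {0..<1}" for x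
    proof -
      have "\<bar>dyadic_sum ?c m x\<bar> = \<bar>rademacher m x * dyadic_sum ?c m x\<bar>"
        by (simp add: abs_mult)
      also have "rademacher m x * dyadic_sum ?c m x =
          (dyadic_sum c (Suc m) x - dyadic_sum c (Suc m) (flip m x)) / 2"
        by (simp add: dyadic_sum_Suc dyadic_sum_flip_ge rademacher_flip)
      also have "\<bar>\<dots>\<bar> \<le> Q m x"
        using Suc.prems(2)[OF that] Suc.prems(2)[OF flip_unit[OF that], of m]
        unfolding avgm[of x] abs_le_iff by (simp add: field_simps)
      finally show ?thesis .
    qed
    then have "\<bar>fejer_sum ?c n' x\<bar> \<le> (\<Sum>i<m. ?B i x)"
      using Suc.IH[of ?c n' x] Suc.prems(1,4) n' less_SucI by blast
    then have "\<bar>rademacher m x * fejer_sum ?c n' x\<bar> \<le> (\<Sum>i<m. ?B i x)"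
      by (simp add: abs_mult)
    moreover have "\<bar>real n * dyadic_sum c m x\<bar> \<le> 2 ^ Suc m * Q m x"
    proof -
      have "real n \<le> 2 ^ Suc m" using Suc.prems(3)
        by (metis less_imp_le numeral_power_eq_of_nat_cancel_iff of_nat_le_iff)
      then show ?thesis unfolding abs_mult by (intro mult_mono topm Suc.prems(4)) auto
    qed
    moreover have "\<bar>\<Sum>j<m. 2 ^ j / 2 * (dyadic_sum c m x - dyadic_sum c m (flip j x))\<bar> \<le>
        (\<Sum>j<m. 2 ^ j / 2 * (Q m x + Q m (flip j x)))"
    proof (rule order_trans[OF sum_abs], rule sum_mono)
      fix j
      have "\<bar>dyadic_sum c m x - dyadic_sum c m (flip j x)\<bar> \<le> Q m x + Q m (flip j x)"
        using topm[OF Suc.prems(4)] topm[OF flip_unit[OF Suc.prems(4)], of j] by linarith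
      then show "\<bar>2 ^ j / 2 * (dyadic_sum c m x - dyadic_sum c m (flip j x))\<bar>
         \<le> 2 ^ j / 2 * (Q m x + Q m (flip j x))"
        by (simp add: abs_mult)
    qed
    ultimately show ?thesis
      using fejer_sum_split[of n' m c x] n' unfolding n[symmetric] sum.lessThan_Suc
      by (smt (verit) less_imp_le)
  qed
qed

lemma fejer_mean_eq: "fejer_mean f n x = fejer_sum (walsh_coeff f) n x / real n"
proof -
  have "(\<Sum>k=1..n. walsh_sum f k x) = fejer_sum (walsh_coeff f) n x"
  proof (induction n)
    case 0
    then show ?case by (simp add: fejer_sum_def)
  next
    case (Suc n)
    have "fejer_sum (walsh_coeff f) (Suc n) x = fejer_sum (walsh_coeff f) n x + walsh_sum f (Suc n) x"
      unfolding fejer_sum_def walsh_sum_def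
      by (simp add: sum.distrib[symmetric] algebra_simps)
    then show ?case using Suc by simp
  qed
  then show ?thesis by (simp add: fejer_mean_def)
qed

section \<open>Dyadic cells and averages over them\<close>

lemma space_Omega [simp]: "space Omega = {0..<1}"
  by (simp add: Omega_def)

lemma nn_integral_Omega:
  "(\<integral>\<^sup>+ x. h x \<partial>Omega) = (\<integral>\<^sup>+ x. h x * indicator {0..<1} x \<partial>lborel)"
  unfolding Omega_def by (subst nn_integral_restrict_space) (auto simp: nn_integral_completion)

lemma borel_measurable_Omega:
  "h \<in> borel_measurable borel \<Longrightarrow> h \<in> borel_measurable Omega"
  unfolding Omega_def
  by (intro measurable_restrict_space1) (simp add: measurable_completion)

lemma emeasure_Omega:
  assumes "A \<in> sets borel" "A \<subseteq> {0..<1}"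
  shows "emeasure Omega A = emeasure lborel A"
  unfolding Omega_def using assms by (subst emeasure_restrict_space) auto

lemma sets_Omega: "A \<in> sets borel \<Longrightarrow> A \<inter> {0..<1} \<in> sets Omega"
  unfolding Omega_def sets_restrict_space by (rule image_eqI[of _ _ A]) auto

interpretation Omega: prob_space Omega
  by standard (simp add: emeasure_Omega)

lemma rademacher_measurable [measurable]: "rademacher j \<in> borel_measurable borel"
  unfolding rademacher_def[abs_def] frac_def by measurable

lemma flip_measurable [measurable]: "flip j \<in> borel_measurable borel"
  unfolding flip_def[abs_def] by measurable

text \<open>The flip interchanges, by translations, the set where the digit is \<open>0\<close> and the set where it
  is \<open>1\<close>; Lebesgue measure is translation invariant.\<close>

lemma nn_integral_flip:
  fixes h :: "real \<Rightarrow> ennreal"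
  assumes [measurable]: "h \<in> borel_measurable borel"
  shows "(\<integral>\<^sup>+ x. h (flip j x) \<partial>Omega) = (\<integral>\<^sup>+ x. h x \<partial>Omega)"
proof -
  define t :: real where "t = 1 / 2 ^ Suc j"
  define U where "U = {x \<in> {0..<1}. rademacher j x = 1}"
  define V where "V = {x \<in> {0..<1}. rademacher j x = - 1}"
  have [measurable]: "U \<in> sets borel" "V \<in> sets borel" unfolding U_def V_def by measurable
  have ind: "indicator {0..<1} x = (indicator U x + indicator V x :: ennreal)" for x :: real
    by (auto simp: U_def V_def indicator_def rademacher_def)
  have fU: "flip j x = x + t" if "x \<in> U" for x using that by (simp add: flip_def U_def t_def)
  have fV: "flip j x = x - t" if "x \<in> V" for x using that by (simp add: flip_def V_def t_def)
  have UV: "flip j x \<in> V" if "x \<in> U" for x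
    using that flip_unit[of x j] by (simp add: U_def V_def rademacher_flip)
  have VU: "flip j x \<in> U" if "x \<in> V" for x
    using that flip_unit[of x j] by (simp add: U_def V_def rademacher_flip)
  \<comment> \<open>On each half of the unit interval the flip is a translation onto the other half.\<close>
  have eU: "h (flip j x) * indicator U x = h (x + t) * indicator V (x + t)" for x
  proof (cases "x \<in> U")
    case True
    then show ?thesis using UV[OF True] fU[OF True] by simp
  next
    case False
    then have "x + t \<notin> V" using VU[of "x + t"] fV[of "x + t"] by force
    then show ?thesis using False by simp
  qed
  have eV: "h (flip j x) * indicator V x = h (x - t) * indicator U (x - t)" for x
  proof (cases "x \<in> V")
    case True
    then show ?thesis using VU[OF True] fV[OF True] by simp
  next
    case False
    then have "x - t \<notin> U" using UV[of "x - t"] fU[of "x - t"] by force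
    then show ?thesis using False by simp
  qed
  have "(\<integral>\<^sup>+ x. h (flip j x) \<partial>Omega) =
      (\<integral>\<^sup>+ x. h (flip j x) * indicator U x + h (flip j x) * indicator V x \<partial>lborel)"
    by (simp add: nn_integral_Omega ind distrib_left)
  also have "\<dots> = (\<integral>\<^sup>+ x. h (x + t) * indicator V (x + t) + h (x - t) * indicator U (x - t) \<partial>lborel)"
    by (simp only: eU eV)
  also have "\<dots> = (\<integral>\<^sup>+ x. h (x + t) * indicator V (x + t) \<partial>lborel)
       + (\<integral>\<^sup>+ x. h (x - t) * indicator U (x - t) \<partial>lborel)"
    by (rule nn_integral_add) auto
  also have "(\<integral>\<^sup>+ x. h (x + t) * indicator V (x + t) \<partial>lborel) = (\<integral>\<^sup>+ x. h x * indicator V x \<partial>lborel)"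
    by (subst nn_integral_real_affine[of "\<lambda>x. h x * indicator V x" 1 t]) (auto simp: add.commute)
  also have "(\<integral>\<^sup>+ x. h (x - t) * indicator U (x - t) \<partial>lborel) = (\<integral>\<^sup>+ x. h x * indicator U x \<partial>lborel)"
    by (subst nn_integral_real_affine[of "\<lambda>x. h x * indicator U x" 1 "- t"]) auto
  also have "(\<integral>\<^sup>+ x. h x * indicator V x \<partial>lborel) + (\<integral>\<^sup>+ x. h x * indicator U x \<partial>lborel)
      = (\<integral>\<^sup>+ x. h x \<partial>Omega)"
    by (simp add: nn_integral_Omega ind distrib_left add.commute nn_integral_add)
  finally show ?thesis .
qed

text \<open>For \<open>x\<close> in the unit interval this is the dyadic interval of length \<open>1 / 2 ^ m\<close> containing
  \<open>x\<close>. The description by floors makes cells available on the whole line and decides equality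
  of cells by equality of integers.\<close>

definition cell :: "nat \<Rightarrow> real \<Rightarrow> real set" where
  "cell m x = {y. \<lfloor>2 ^ m * y\<rfloor> = \<lfloor>2 ^ m * x\<rfloor>}"

lemma cell_self [simp]: "x \<in> cell m x"
  by (simp add: cell_def)

lemma cell_eq: "y \<in> cell m x \<Longrightarrow> cell m y = cell m x"
  by (simp add: cell_def)

lemma cell_antimono: "m \<le> n \<Longrightarrow> cell n x \<subseteq> cell m x"
  unfolding cell_def by (intro Collect_mono impI) (rule floor_mono_level)

lemma cell_interval:
  "cell m x = {real_of_int \<lfloor>2 ^ m * x\<rfloor> / 2 ^ m ..< (real_of_int \<lfloor>2 ^ m * x\<rfloor> + 1) / 2 ^ m}"
proof (rule set_eqI)
  fix y
  define a where "a = \<lfloor>2 ^ m * x\<rfloor>"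
  have "y \<in> cell m x \<longleftrightarrow> of_int a \<le> 2 ^ m * y \<and> 2 ^ m * y < of_int a + 1"
    unfolding cell_def mem_Collect_eq a_def[symmetric] by (rule floor_eq_iff)
  also have "\<dots> \<longleftrightarrow> y \<in> {real_of_int a / 2 ^ m ..< (real_of_int a + 1) / 2 ^ m}"
    by (simp add: pos_divide_le_eq pos_less_divide_eq mult.commute)
  finally show "y \<in> cell m x \<longleftrightarrow>
      y \<in> {real_of_int \<lfloor>2 ^ m * x\<rfloor> / 2 ^ m ..< (real_of_int \<lfloor>2 ^ m * x\<rfloor> + 1) / 2 ^ m}"
    unfolding a_def .
qed

lemma cell_0: "x \<in> {0..<1} \<Longrightarrow> cell 0 x = {0..<1}"
proof -
  assume "x \<in> {0..<1}"
  then have "\<lfloor>x\<rfloor> = 0" by (simp add: floor_eq_iff)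
  then show ?thesis by (simp add: cell_interval)
qed

lemma cell_subset: "x \<in> {0..<1} \<Longrightarrow> cell m x \<subseteq> {0..<1}"
  using cell_antimono[of 0 m x] cell_0 by blast

lemma cell_borel [measurable]: "cell m x \<in> sets borel"
  by (simp add: cell_interval)

lemma emeasure_cell:
  assumes "x \<in> {0..<1}"
  shows "emeasure Omega (cell m x) = ennreal (1 / 2 ^ m)"
proof -
  have "emeasure Omega (cell m x) = emeasure lborel (cell m x)"
    by (intro emeasure_Omega cell_subset assms) simp
  then show ?thesis by (simp add: cell_interval diff_divide_distrib[symmetric] divide_right_mono)
qed

lemma measure_cell: "x \<in> {0..<1} \<Longrightarrow> measure Omega (cell m x) = 1 / 2 ^ m"
  by (simp add: measure_def emeasure_cell)

lemma cell_flip: "m \<le> j \<Longrightarrow> cell m (flip j x) = cell m x"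
  using floor_mono_level[OF floor_flip, of m j x] by (simp add: cell_def)

lemma eq_iff_half_parity: "(a::int) = b \<longleftrightarrow> a div 2 = b div 2 \<and> even a = even b"
  by presburger

lemma cell_Suc_iff: "y \<in> cell (Suc m) x \<longleftrightarrow> y \<in> cell m x \<and> rademacher m y = rademacher m x"
proof -
  have "\<lfloor>2 ^ Suc m * y\<rfloor> = \<lfloor>2 ^ Suc m * x\<rfloor> \<longleftrightarrow>
      \<lfloor>2 ^ Suc m * y\<rfloor> div 2 = \<lfloor>2 ^ Suc m * x\<rfloor> div 2 \<and>
      even \<lfloor>2 ^ Suc m * y\<rfloor> = even \<lfloor>2 ^ Suc m * x\<rfloor>"
    by (rule eq_iff_half_parity)
  then show ?thesis
    unfolding cell_def mem_Collect_eq floor_half[of m] rademacher_floor by auto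
qed

lemma cell_Suc_split:
  "cell m x = cell (Suc m) x \<union> cell (Suc m) (flip m x)"
  "cell (Suc m) x \<inter> cell (Suc m) (flip m x) = {}"
proof -
  have A: "y \<in> cell (Suc m) (flip m x) \<longleftrightarrow> y \<in> cell m x \<and> rademacher m y = - rademacher m x" for y
    unfolding cell_Suc_iff rademacher_flip_self by (simp add: cell_flip)
  have B: "rademacher m y = rademacher m x \<or> rademacher m y = - rademacher m x" for y
    by (auto simp: rademacher_def)
  have C: "rademacher m x \<noteq> - rademacher m x"
    by (auto simp: rademacher_def)
  show "cell m x = cell (Suc m) x \<union> cell (Suc m) (flip m x)"
    unfolding set_eq_iff Un_iff A unfolding cell_Suc_iff using B by blast
  show "cell (Suc m) x \<inter> cell (Suc m) (flip m x) = {}"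
    unfolding set_eq_iff Int_iff A unfolding cell_Suc_iff using C by auto
qed

lemma dyadic_intervals_cells: "dyadic_intervals n = cell n ` {0..<1}"
proof (intro equalityI subsetI)
  fix A assume "A \<in> dyadic_intervals n"
  then obtain k :: nat where k: "k < 2 ^ n" "A = {real k / 2 ^ n ..< (real k + 1) / 2 ^ n}"
    by (auto simp: dyadic_intervals_def)
  have "real k < 2 ^ n" using k(1) by (metis of_nat_less_iff of_nat_numeral of_nat_power)
  then have "A = cell n (real k / 2 ^ n)" "real k / 2 ^ n \<in> {0..<1}"
    by (auto simp: cell_interval k)
  then show "A \<in> cell n ` {0..<1}" by blast
next
  fix A assume "A \<in> cell n ` {0..<1}"
  then obtain x where x: "0 \<le> x" "x < 1" "A = cell n x" by auto
  have "0 \<le> \<lfloor>2 ^ n * x\<rfloor>" using x by simp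
  moreover have "\<lfloor>2 ^ n * x\<rfloor> < 2 ^ n" using x by (simp add: floor_less_iff)
  ultimately have "A = {real (nat \<lfloor>2 ^ n * x\<rfloor>) / 2 ^ n ..< (real (nat \<lfloor>2 ^ n * x\<rfloor>) + 1) / 2 ^ n}"
    "nat \<lfloor>2 ^ n * x\<rfloor> < 2 ^ n"
    by (simp_all add: x cell_interval nat_less_iff)
  then show "A \<in> dyadic_intervals n" unfolding dyadic_intervals_def by blast
qed

text \<open>Functions on the unit interval that are constant on the cells of level \<open>m\<close>. For real-valued
  functions this is measurability with respect to \<open>dyadic_sigma m\<close>, see
  \<open>dyadic_sigma_measurable_iff\<close>.\<close>

definition dyadic_step :: "nat \<Rightarrow> (real \<Rightarrow> 'a) \<Rightarrow> bool" where
  "dyadic_step m h \<longleftrightarrow> (\<forall>x\<in>{0..<1}. \<forall>y\<in>cell m x. h y = h x)"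

lemma dyadic_stepD: "dyadic_step m h \<Longrightarrow> x \<in> {0..<1} \<Longrightarrow> y \<in> cell m x \<Longrightarrow> h y = h x"
  unfolding dyadic_step_def by blast

lemma dyadic_step_mono: "dyadic_step m h \<Longrightarrow> m \<le> n \<Longrightarrow> dyadic_step n h"
  using cell_antimono unfolding dyadic_step_def by blast

lemma dyadic_step_floor:
  assumes "dyadic_step m h" "x \<in> {0..<1}"
  shows "h x = h (real_of_int \<lfloor>2 ^ m * x\<rfloor> / 2 ^ m)"
  by (rule dyadic_stepD[OF assms, symmetric]) (simp add: cell_def)

lemma dyadic_sigma_space [simp]: "space (dyadic_sigma n) = {0..<1}"
  unfolding dyadic_sigma_def by (rule space_measure_of) (auto simp: dyadic_intervals_cells dest: cell_subset)

lemma sets_dyadic_sigma: "sets (dyadic_sigma n) = sigma_sets {0..<1} (dyadic_intervals n)"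
  unfolding dyadic_sigma_def by (rule sets_measure_of) (auto simp: dyadic_intervals_cells dest: cell_subset)

text \<open>The cells of level \<open>m\<close> partition the unit interval, so every set of the generated
  \<open>\<sigma>\<close>-algebra is a union of cells and a measurable function separates no two points of a
  cell. Conversely a step function factors through \<open>x \<mapsto> \<lfloor>2 ^ m * x\<rfloor>\<close>.\<close>

lemma dyadic_sigma_measurable_iff:
  fixes h :: "real \<Rightarrow> real"
  shows "h \<in> borel_measurable (dyadic_sigma m) \<longleftrightarrow> dyadic_step m h"
proof
  assume h: "h \<in> borel_measurable (dyadic_sigma m)"
  have inv: "y \<in> A \<longleftrightarrow> x \<in> A"
    if "A \<in> sigma_sets {0..<1} (dyadic_intervals m)" "x \<in> {0..<1}" "y \<in> cell m x" for A x y
    using that(1)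
  proof (induction)
    case (Basic A)
    then obtain z where "A = cell m z" unfolding dyadic_intervals_cells by blast
    then show ?case using that(3) by (simp add: cell_def)
  next
    case (Compl A)
    have "y \<in> {0..<1}" using cell_subset[OF that(2)] that(3) by blast
    then show ?case using Compl that(2) by blast
  next
    case (Union A)
    then show ?case by blast
  qed simp
  show "dyadic_step m h" unfolding dyadic_step_def
  proof (intro ballI)
    fix x y :: real assume "x \<in> {0..<1}" "y \<in> cell m x"
    moreover have "h -` {h x} \<inter> {0..<1} \<in> sigma_sets {0..<1} (dyadic_intervals m)"
      using measurable_sets[OF h, of "{h x}"] by (simp add: sets_dyadic_sigma)
    ultimately show "h y = h x" using inv by blast
  qed
next
  assume h: "dyadic_step m h"
  have "(\<lambda>x. \<lfloor>2 ^ m * x\<rfloor>) \<in> measurable (dyadic_sigma m) (count_space UNIV)"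
    unfolding measurable_count_space_eq2_countable
  proof (intro conjI ballI)
    fix a :: int
    show "(\<lambda>x. \<lfloor>2 ^ m * x\<rfloor>) -` {a} \<inter> space (dyadic_sigma m) \<in> sets (dyadic_sigma m)"
    proof (cases "\<exists>x\<in>{0..<1::real}. \<lfloor>2 ^ m * x\<rfloor> = a")
      case True
      then obtain x :: real where x: "x \<in> {0..<1}" "\<lfloor>2 ^ m * x\<rfloor> = a" by blast
      then have "(\<lambda>x. \<lfloor>2 ^ m * x\<rfloor>) -` {a} \<inter> {0..<1} = cell m x"
      proof (intro set_eqI iffI)
        fix y assume "y \<in> cell m x"
        then show "y \<in> (\<lambda>x. \<lfloor>2 ^ m * x\<rfloor>) -` {a} \<inter> {0..<1}"
          using subsetD[OF cell_subset[OF x(1)] \<open>y \<in> cell m x\<close>] x(2) by (simp add: cell_def)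
      qed (simp add: cell_def x(2))
      then show ?thesis
        unfolding dyadic_sigma_space sets_dyadic_sigma dyadic_intervals_cells
        using x(1) by (auto intro!: sigma_sets.Basic)
    next
      case False
      then have "(\<lambda>x::real. \<lfloor>2 ^ m * x\<rfloor>) -` {a} \<inter> {0..<1} = {}" by blast
      then show ?thesis by simp
    qed
  qed simp
  then have "(\<lambda>x. h (real_of_int \<lfloor>2 ^ m * x\<rfloor> / 2 ^ m)) \<in> borel_measurable (dyadic_sigma m)"
    by (rule measurable_compose) simp
  then show "h \<in> borel_measurable (dyadic_sigma m)"
    by (rule measurable_cong[THEN iffD1, rotated]) (rule dyadic_step_floor[OF h, symmetric], simp)
qed

lemma subalgebra_dyadic_sigma: "subalgebra Omega (dyadic_sigma n)"
  unfolding subalgebra_def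
proof
  show "sets (dyadic_sigma n) \<subseteq> sets Omega"
    unfolding sets_dyadic_sigma space_Omega[symmetric]
  proof (rule sets.sigma_sets_subset, rule subsetI)
    fix A assume "A \<in> dyadic_intervals n"
    then show "A \<in> sets Omega"
      using sets_Omega[of A] cell_subset by (fastforce simp: dyadic_intervals_cells Int_absorb2)
  qed
qed simp

lemma sigma_finite_dyadic_sigma: "sigma_finite_subalgebra Omega (dyadic_sigma n)"
  by (intro finite_measure_subalgebra_is_sigma_finite finite_measure_subalgebra.intro
      finite_measure_subalgebra_axioms.intro subalgebra_dyadic_sigma Omega.finite_measure_axioms)

lemma dyadic_step_measurable:
  fixes h :: "real \<Rightarrow> real"
  shows "dyadic_step m h \<Longrightarrow> h \<in> borel_measurable Omega"
  using measurable_from_subalg[OF subalgebra_dyadic_sigma] dyadic_sigma_measurable_iff by blast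

lemma dyadic_step_bounded:
  fixes h :: "real \<Rightarrow> real"
  assumes "dyadic_step m h"
  obtains B where "0 \<le> B" "\<And>x. x \<in> {0..<1} \<Longrightarrow> \<bar>h x\<bar> \<le> B"
proof -
  have "h ` {0..<1} \<subseteq> (\<lambda>a. h (real_of_int a / 2 ^ m)) ` {0..<2 ^ m}"
  proof
    fix y assume "y \<in> h ` {0..<1}"
    then obtain x where x: "x \<in> {0..<1}" "y = h x" by blast
    then have "\<lfloor>2 ^ m * x\<rfloor> \<in> {0..<2 ^ m}" by (auto simp: floor_less_iff)
    then show "y \<in> (\<lambda>a. h (real_of_int a / 2 ^ m)) ` {0..<2 ^ m}"
      using dyadic_step_floor[OF assms x(1)] x(2) by blast
  qed
  then have "finite (h ` {0..<1})" by (rule finite_subset) simp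
  then have "bounded (h ` {0..<1})" by (rule finite_imp_bounded)
  then obtain B where "0 < B" "\<forall>y\<in>h ` {0..<1}. norm y \<le> B" by (auto simp: bounded_pos)
  then show ?thesis using that[of B] by auto
qed

lemma dyadic_step_integrable:
  fixes h :: "real \<Rightarrow> real"
  assumes "dyadic_step m h"
  shows "integrable Omega h"
proof -
  obtain B where "\<And>x. x \<in> {0..<1} \<Longrightarrow> \<bar>h x\<bar> \<le> B" using dyadic_step_bounded[OF assms] by blast
  then show ?thesis
    by (intro Omega.integrable_const_bound[of _ B] dyadic_step_measurable[OF assms]) auto
qed

text \<open>A pointwise defined version of the conditional expectation at level \<open>m\<close>.\<close>

definition cell_avg :: "nat \<Rightarrow> (real \<Rightarrow> real) \<Rightarrow> real \<Rightarrow> real" where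
  "cell_avg m h x = 2 ^ m * (LINT y|Omega. indicator (cell m x) y * h y)"

lemma integrable_cell:
  fixes h :: "real \<Rightarrow> real"
  assumes "integrable Omega h" "A \<in> sets borel"
  shows "integrable Omega (\<lambda>y. indicator A y * h y)"
proof -
  have m: "indicator A \<in> borel_measurable Omega"
    by (rule borel_measurable_Omega) (use assms in simp)
  show ?thesis
  proof (rule Bochner_Integration.integrable_bound[OF assms(1)])
    show "(\<lambda>y. indicator A y * h y) \<in> borel_measurable Omega"
      by (intro borel_measurable_times m borel_measurable_integrable assms)
  qed (auto simp: indicator_def)
qed

lemma cell_avg_average:
  assumes "integrable Omega h"
  shows "cell_avg m h x = (cell_avg (Suc m) h x + cell_avg (Suc m) h (flip m x)) / 2"
proof -
  have "(LINT y|Omega. indicator (cell m x) y * h y) =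
     (LINT y|Omega. indicator (cell (Suc m) x) y * h y + indicator (cell (Suc m) (flip m x)) y * h y)"
    using cell_Suc_split[of m x]
    by (intro Bochner_Integration.integral_cong) (auto simp: indicator_def)
  also have "\<dots> = (LINT y|Omega. indicator (cell (Suc m) x) y * h y)
      + (LINT y|Omega. indicator (cell (Suc m) (flip m x)) y * h y)"
    by (intro Bochner_Integration.integral_add integrable_cell assms) auto
  finally show ?thesis by (simp add: cell_avg_def algebra_simps)
qed

lemma cell_avg_step:
  assumes "dyadic_step m h" "x \<in> {0..<1}"
  shows "cell_avg m h x = h x"
proof -
  have "(LINT y|Omega. indicator (cell m x) y * h y) = (LINT y|Omega. indicator (cell m x) y * h x)"
  proof (intro Bochner_Integration.integral_cong refl)
    show "indicator (cell m x) y * h y = indicator (cell m x) y * h x" for y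
      using dyadic_stepD[OF assms, of y] by (cases "y \<in> cell m x") auto
  qed
  also have "\<dots> = measure Omega (cell m x) * h x"
    using cell_subset[OF assms(2), of m] sets_Omega[OF cell_borel, of m x] by (simp add: Int_absorb2)
  finally show ?thesis using assms(2) by (simp add: cell_avg_def measure_cell)
qed

lemma cell_avg_nonneg: "(\<And>x. 0 \<le> h x) \<Longrightarrow> 0 \<le> cell_avg m h x"
  unfolding cell_avg_def by (intro mult_nonneg_nonneg Bochner_Integration.integral_nonneg) auto

lemma cell_avg_cell: "y \<in> cell m x \<Longrightarrow> cell_avg m h y = cell_avg m h x"
  by (simp add: cell_avg_def cell_eq)

lemma cell_avg_measurable [measurable]: "cell_avg m h \<in> borel_measurable borel"
proof -
  have "cell_avg m h = (\<lambda>a. cell_avg m h (real_of_int a / 2 ^ m)) \<circ> (\<lambda>x. \<lfloor>2 ^ m * x\<rfloor>)"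
  proof (rule ext)
    fix x
    have "x \<in> cell m (real_of_int \<lfloor>2 ^ m * x\<rfloor> / 2 ^ m)" by (simp add: cell_def)
    then show "cell_avg m h x = ((\<lambda>a. cell_avg m h (real_of_int a / 2 ^ m)) \<circ> (\<lambda>x. \<lfloor>2 ^ m * x\<rfloor>)) x"
      unfolding comp_def by (rule cell_avg_cell)
  qed
  moreover have "\<dots> \<in> borel_measurable borel"
    by (rule measurable_comp[of _ _ "count_space UNIV"]) auto
  ultimately show ?thesis by simp
qed

lemma cell_avg_mono_AE:
  assumes "integrable Omega h" "integrable Omega h'"
    and le: "AE y in Omega. y \<in> cell m x \<longrightarrow> h y \<le> h' y"
  shows "cell_avg m h x \<le> cell_avg m h' x"
  unfolding cell_avg_def
proof (rule mult_left_mono)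
  show "(LINT y|Omega. indicator (cell m x) y * h y) \<le> (LINT y|Omega. indicator (cell m x) y * h' y)"
  proof (rule integral_mono_AE)
    show "AE y in Omega. indicator (cell m x) y * h y \<le> indicator (cell m x) y * h' y"
      using le by eventually_elim (simp add: indicator_def)
  qed (auto intro!: integrable_cell assms(1,2))
qed simp

lemma cell_avg_cong:
  assumes "\<And>y. y \<in> cell m x \<Longrightarrow> h y = h' y"
  shows "cell_avg m h x = cell_avg m h' x"
proof -
  have "indicator (cell m x) y * h y = indicator (cell m x) y * h' y" for y
    using assms[of y] by (cases "y \<in> cell m x") auto
  then show ?thesis unfolding cell_avg_def by presburger
qed

lemma cell_avg_0: "x \<in> {0..<1} \<Longrightarrow> cell_avg 0 h x = (LINT y|Omega. h y)"
  unfolding cell_avg_def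
  by (auto simp: cell_0 intro!: Bochner_Integration.integral_cong)

text \<open>Averaging preserves integrals, and so do flips. The first fact is itself a consequence of the
  second, by \<open>cell_avg_average\<close> and induction on the level.\<close>

lemma nn_integral_cell_avg_flip:
  assumes "integrable Omega h" "\<And>x. 0 \<le> h x"
  shows "(\<integral>\<^sup>+ x. ennreal (cell_avg i h (flip j x)) \<partial>Omega) = ennreal (LINT y|Omega. h y)"
proof -
  have "(\<integral>\<^sup>+ x. ennreal (cell_avg i h x) \<partial>Omega) = ennreal (LINT y|Omega. h y)"
  proof (induction i)
    case 0
    have "(\<integral>\<^sup>+ x. ennreal (cell_avg 0 h x) \<partial>Omega) = (\<integral>\<^sup>+ x. ennreal (LINT y|Omega. h y) \<partial>Omega)"
      by (intro nn_integral_cong) (simp add: cell_avg_0)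
    then show ?case by (simp add: Omega.emeasure_space_1[simplified])
  next
    case (Suc i)
    let ?J = "\<integral>\<^sup>+ x. ennreal (cell_avg (Suc i) h x) \<partial>Omega"
    have half: "ennreal ((a + b) / 2) = ennreal (1 / 2) * (ennreal a + ennreal b)"
      if ab: "0 \<le> a" "0 \<le> b" for a b
      unfolding ennreal_plus[OF ab, symmetric]
      by (subst ennreal_mult[symmetric]) (use ab in auto)
    have m1: "(\<lambda>x. ennreal (cell_avg (Suc i) h x)) \<in> borel_measurable Omega"
      and m2: "(\<lambda>x. ennreal (cell_avg (Suc i) h (flip i x))) \<in> borel_measurable Omega"
      by (rule borel_measurable_Omega, measurable)+
    have "(\<integral>\<^sup>+ x. ennreal (cell_avg i h x) \<partial>Omega) =
       ennreal (1 / 2) * (?J + (\<integral>\<^sup>+ x. ennreal (cell_avg (Suc i) h (flip i x)) \<partial>Omega))"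
      unfolding cell_avg_average[OF assms(1), of i]
        half[OF cell_avg_nonneg[OF assms(2)] cell_avg_nonneg[OF assms(2)]]
      by (simp only: nn_integral_cmult[OF borel_measurable_add[OF m1 m2]] nn_integral_add[OF m1 m2])
    also have "(\<integral>\<^sup>+ x. ennreal (cell_avg (Suc i) h (flip i x)) \<partial>Omega) = ?J"
      by (rule nn_integral_flip) measurable
    also have "ennreal (1 / 2) * (?J + ?J) = ?J"
    proof -
      have "ennreal (1 / 2) * (?J + ?J) = (ennreal (1 / 2) + ennreal (1 / 2)) * ?J"
        by (simp only: distrib_left distrib_right)
      also have "ennreal (1 / 2) + ennreal (1 / 2) = 1"
        by (subst ennreal_plus[symmetric]) auto
      finally show ?thesis by simp
    qed
    finally show ?case using Suc by simp
  qed
  moreover have "(\<integral>\<^sup>+ x. ennreal (cell_avg i h (flip j x)) \<partial>Omega) = (\<integral>\<^sup>+ x. ennreal (cell_avg i h x) \<partial>Omega)"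
    by (rule nn_integral_flip) measurable
  ultimately show ?thesis by simp
qed

section \<open>Shifted averages in a variable exponent space\<close>

text \<open>The modular of the variable Lebesgue space. For bounded exponents it tends to \<open>0\<close> along a
  sequence exactly when the quasi-norm does; unlike the quasi-norm it is a single integral.\<close>

definition modular :: "(real \<Rightarrow> real) \<Rightarrow> (real \<Rightarrow> real) \<Rightarrow> ennreal" where
  "modular p h = (\<integral>\<^sup>+ x. ennreal (\<bar>h x\<bar> powr p x) \<partial>Omega)"

lemma powr_add_ge:
  fixes a b q :: real
  assumes "0 < a" "0 < b" "1 \<le> q"
  shows "a powr q + b powr q \<le> (a + b) powr q"
proof -
  have e: "c powr q = c * c powr (q - 1)" if "0 < c" for c :: real
    using that by (simp add: powr_mult_base)
  have "a powr (q - 1) \<le> (a + b) powr (q - 1)" "b powr (q - 1) \<le> (a + b) powr (q - 1)"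
    using assms by (auto intro!: powr_mono2)
  then have "a * a powr (q - 1) + b * b powr (q - 1) \<le> a * (a + b) powr (q - 1) + b * (a + b) powr (q - 1)"
    using assms by (intro add_mono mult_left_mono) auto
  then show ?thesis using assms by (simp add: e distrib_right)
qed

text \<open>Comparison of the mean with the power mean of order \<open>r\<close>. For \<open>r \<ge> 1\<close> this is convexity
  and costs nothing; for \<open>r < 1\<close> the worst case is that one of the two values vanishes, which
  costs the factor \<open>2 powr (1 / r - 1)\<close>.\<close>

lemma two_point_power_mean:
  fixes a b r :: real
  assumes "0 < a" "0 < b" "0 < r"
  shows "(a powr (1 / r) + b powr (1 / r)) / 2 \<le> 2 powr (max (1 / r - 1) 0) * ((a + b) / 2) powr (1 / r)"
proof (cases "r \<le> 1")
  case True
  then have q: "1 \<le> 1 / r" using assms by simp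
  have "2 powr (max (1 / r - 1) 0) * ((a + b) / 2) powr (1 / r) = (a + b) powr (1 / r) / 2"
    using assms q by (simp add: powr_divide powr_diff max_def)
  then show ?thesis using powr_add_ge[OF assms(1,2) q] by simp
next
  case False
  let ?u = "a powr (1 / r)" and ?v = "b powr (1 / r)"
  have pos: "0 < ?u" "0 < ?v" using assms by auto
  have "((1 - 1/2) *\<^sub>R ?u + (1/2) *\<^sub>R ?v) powr r \<le> (1 - 1/2) * ?u powr r + (1/2) * ?v powr r"
    by (rule convex_onD[OF powr_convex]) (use False pos in auto)
  then have "((?u + ?v) / 2) powr r \<le> (a + b) / 2"
    using assms by (simp add: powr_powr add_divide_distrib)
  then have "(((?u + ?v) / 2) powr r) powr (1 / r) \<le> ((a + b) / 2) powr (1 / r)"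
    using assms by (intro powr_mono2) auto
  moreover have "(((?u + ?v) / 2) powr r) powr (1 / r) = (?u + ?v) / 2"
    using assms pos by (simp add: powr_powr)
  moreover have "max (1 / r - 1) 0 = 0" using False assms by (simp add: max_def divide_simps)
  ultimately show ?thesis by simp
qed

text \<open>Weighted sums with bounded total weight are handled by the largest term, which works for
  exponents on both sides of \<open>1\<close>.\<close>

lemma powr_sum_le:
  fixes w b :: "'k \<Rightarrow> real" and S q :: real
  assumes F: "finite F" and w: "\<And>k. k \<in> F \<Longrightarrow> 0 \<le> w k" and b: "\<And>k. k \<in> F \<Longrightarrow> 0 \<le> b k"
    and S: "sum w F \<le> S" and q: "0 < q"
  shows "(\<Sum>k\<in>F. w k * b k) powr q \<le> S powr q * (\<Sum>k\<in>F. b k powr q)"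
proof (cases "F = {}")
  case True
  then show ?thesis by simp
next
  case False
  define B where "B = Max (b ` F)"
  have "B \<in> b ` F" unfolding B_def using False F by (intro Max_in) auto
  then obtain k0 where k0: "k0 \<in> F" "B = b k0" by auto
  have le: "b k \<le> B" if "k \<in> F" for k unfolding B_def using F that by (intro Max_ge) auto
  have B0: "0 \<le> B" using k0 b by auto
  have S0: "0 \<le> S" using S sum_nonneg[of F w] w by fastforce
  have "(\<Sum>k\<in>F. w k * b k) \<le> (\<Sum>k\<in>F. w k * B)"
    by (intro sum_mono mult_left_mono le w)
  also have "\<dots> \<le> S * B" unfolding sum_distrib_right[symmetric] using S B0 by (rule mult_right_mono)
  finally have "(\<Sum>k\<in>F. w k * b k) powr q \<le> (S * B) powr q"
    using q by (intro powr_mono2) (auto intro!: sum_nonneg mult_nonneg_nonneg w b)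
  also have "\<dots> = S powr q * B powr q" using S0 B0 by (simp add: powr_mult)
  also have "B powr q \<le> (\<Sum>k\<in>F. b k powr q)"
    unfolding k0(2) using F k0(1) by (intro member_le_sum) auto
  finally show ?thesis by (simp add: mult_left_mono)
qed

lemma powr_le_one_plus:
  fixes t r q :: real
  assumes "0 \<le> t" "0 < r" "r \<le> q"
  shows "t powr r \<le> 1 + t powr q"
proof (cases "t \<le> 1")
  case True
  then have "t powr r \<le> 1 powr r" using assms by (intro powr_mono2) auto
  then show ?thesis by (simp add: add_increasing2)
next
  case False
  then have "t powr r \<le> t powr q" using assms by (intro powr_mono) auto
  then show ?thesis by simp
qed

text \<open>The positive operator that dominates the Fejer means. The index \<open>j\<close> is restricted to \<open>J\<close>
  because small \<open>j\<close> (distant flips) and large \<open>j\<close> (flips inside a given interval) are treated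
  differently in the end.\<close>

definition shift_op :: "nat \<Rightarrow> nat set \<Rightarrow> (real \<Rightarrow> real) \<Rightarrow> real \<Rightarrow> real" where
  "shift_op m J h x = (\<Sum>j\<in>J. \<Sum>i=j..m. 2 ^ j / 2 ^ m * cell_avg i h (flip j x))"

text \<open>The exponent enters only through real bounds \<open>lo\<close> and \<open>hi\<close> for its values on the cells. The
  condition \<open>hoelder\<close> is the logarithm of the assumption that \<open>\<bar>A\<bar>\<close> to the power
  \<open>p\<^sub>-(A) - p\<^sub>+(A)\<close> is bounded for dyadic \<open>A\<close>.\<close>

locale dyadic_exponent =
  fixes p :: "real \<Rightarrow> real" and lo hi :: "nat \<Rightarrow> real \<Rightarrow> real" and pm pp K :: real
  assumes p_measurable: "p \<in> borel_measurable Omega"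
    and p_bounds: "\<And>j. AE x in Omega. lo j x \<le> p x \<and> p x \<le> hi j x"
    and lo_cell: "\<And>j x y. y \<in> cell j x \<Longrightarrow> lo j y = lo j x"
    and lo_hi: "\<And>j x. x \<in> {0..<1} \<Longrightarrow> pm \<le> lo j x \<and> lo j x \<le> hi j x \<and> hi j x \<le> pp"
    and hoelder: "\<And>j x. x \<in> {0..<1} \<Longrightarrow> real j * (hi j x - lo j x) \<le> K"
    and pm: "1 / 2 < pm" and gap: "1 / pm - 1 / pp < 1"
begin

text \<open>Half of what is left of the weight of \<open>shift_op\<close> after the losses from exponents below
  \<open>1\<close> (the first entry) and from the oscillation of the exponent (the second entry). It is positive
  exactly because \<open>1 / 2 < pm\<close> and \<open>1 / pm - 1 / pp < 1\<close>.\<close>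

definition decay_rate :: real where
  "decay_rate = min (min 1 (2 - 1 / pm)) (1 - (1 / pm - 1 / pp)) / 2"

lemma decay_rate_pos: "0 < decay_rate" and decay_rate_le: "2 * decay_rate \<le> 1" "2 * decay_rate \<le> 2 - 1 / pm"
    "2 * decay_rate \<le> 1 - (1 / pm - 1 / pp)"
proof -
  have "1 / pm < 2" using pm by (simp add: field_simps)
  then show "0 < decay_rate" using gap by (simp add: decay_rate_def)
qed (auto simp: decay_rate_def)

lemma AE_p_bounds: "AE x in Omega. pm \<le> p x \<and> p x \<le> pp"
  using p_bounds[of 0] AE_space
proof eventually_elim
  case (elim x)
  then show ?case using lo_hi[of x 0] by simp
qed

lemma modular_integrable:
  assumes h: "h \<in> borel_measurable Omega" and fin: "modular p h \<le> 1" and pos: "\<And>x. 0 \<le> h x"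
  shows "integrable Omega (\<lambda>x. h x powr p x)" "(LINT x|Omega. h x powr p x) \<le> 1"
proof -
  have m: "(\<lambda>x. h x powr p x) \<in> borel_measurable Omega" using h p_measurable by measurable
  have e: "(\<integral>\<^sup>+ x. ennreal (h x powr p x) \<partial>Omega) \<le> 1"
    using fin pos by (simp add: modular_def)
  show 1: "integrable Omega (\<lambda>x. h x powr p x)"
    by (rule integrableI_nonneg[OF m]) (auto intro: le_less_trans[OF e])
  have "ennreal (LINT x|Omega. h x powr p x) \<le> 1"
    using e nn_integral_eq_integral[OF 1] by simp
  then show "(LINT x|Omega. h x powr p x) \<le> 1" by simp
qed

text \<open>The two-point inequality is iterated from level \<open>m\<close>, where \<open>h\<close> is constant on cells, down to
  level \<open>i\<close>; each level costs the two-point constant. All the cells met stay inside one cell of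
  level \<open>j\<close>, on which \<open>lo j x\<close> bounds the exponent from below almost everywhere. The summand
  \<open>1\<close> pays for replacing the exponent by this lower bound.\<close>

lemma cell_avg_power_mean:
  assumes h: "dyadic_step m h" and pos: "\<And>x. 0 \<le> h x"
    and int: "integrable Omega (\<lambda>y. h y powr p y)"
    and "x \<in> {0..<1}" "j \<le> i" "i \<le> m"
  defines "R \<equiv> \<lambda>i. cell_avg i (\<lambda>y. h y powr p y)"
  shows "cell_avg i h x \<le> 2 powr ((real m - real i) * max (1 / lo j x - 1) 0) * (1 + R i x) powr (1 / lo j x)"
  using assms(6,5,4)
proof (induction i arbitrary: x rule: inc_induct)
  case base
  define r where "r = lo j x"
  have r: "0 < r" using lo_hi[OF base(2), of j] pm by (simp add: r_def)
  have "cell_avg m (\<lambda>y. h x powr r) x \<le> cell_avg m (\<lambda>y. 1 + h y powr p y) x"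
  proof (rule cell_avg_mono_AE)
    show "AE y in Omega. y \<in> cell m x \<longrightarrow> h x powr r \<le> 1 + h y powr p y"
      using p_bounds[of j]
    proof eventually_elim
      case (elim y)
      show ?case
      proof
        assume y: "y \<in> cell m x"
        then have "y \<in> cell j x" using cell_antimono[OF base(1)] by blast
        then have "r \<le> p y" using elim lo_cell[of y j x] by (simp add: r_def)
        then have "h y powr r \<le> 1 + h y powr p y" using pos r by (intro powr_le_one_plus) auto
        then show "h x powr r \<le> 1 + h y powr p y" using dyadic_stepD[OF h base(2) y] by simp
      qed
    qed
  qed (use int in auto)
  moreover have "cell_avg m (\<lambda>y. h x powr r) x = h x powr r"
    by (rule cell_avg_step[OF _ base(2)]) (simp add: dyadic_step_def)
  moreover have "cell_avg m (\<lambda>y. 1 + h y powr p y) x = 1 + R m x"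
  proof -
    have "cell_avg m (\<lambda>y. 1 + h y powr p y) x = cell_avg m (\<lambda>y. 1) x + R m x"
      unfolding cell_avg_def R_def
      using Bochner_Integration.integral_add[OF integrable_cell[of "\<lambda>y. 1" "cell m x"] integrable_cell[OF int, of "cell m x"]]
      by (simp add: distrib_left)
    then show ?thesis using cell_avg_step[OF _ base(2), of m "\<lambda>y. 1"] by (simp add: dyadic_step_def)
  qed
  ultimately have "(h x powr r) powr (1 / r) \<le> (1 + R m x) powr (1 / r)"
    using r by (intro powr_mono2) auto
  moreover have "(h x powr r) powr (1 / r) = h x"
    using r pos[of x] by (cases "h x = 0") (simp_all add: powr_powr)
  ultimately show ?case using cell_avg_step[OF h base(2)] by (simp add: r_def)
next
  case (step i)
  define r where "r = lo j x"
  have r: "0 < r" using lo_hi[OF step(5), of j] pm by (simp add: r_def)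
  define k where "k = max (1 / r - 1) 0"
  let ?y = "flip i x"
  have y: "?y \<in> {0..<1}" using flip_unit step(5) by blast
  have lo: "lo j ?y = r"
    using lo_cell[of ?y j x] cell_flip[OF step(4), of x] cell_self[of ?y j] by (simp add: r_def)
  have R0: "0 \<le> R l z" for l z unfolding R_def by (rule cell_avg_nonneg) simp
  let ?c = "2 powr ((real m - real (Suc i)) * k)"
  have "cell_avg (Suc i) h x \<le> ?c * (1 + R (Suc i) x) powr (1 / r)"
    using step(3)[of x] step(4,5) by (simp add: r_def k_def)
  moreover have "cell_avg (Suc i) h ?y \<le> ?c * (1 + R (Suc i) ?y) powr (1 / r)"
    using step(3)[of ?y] step(4) y by (simp add: lo k_def)
  ultimately have "cell_avg i h x \<le>
      (?c * (1 + R (Suc i) x) powr (1 / r) + ?c * (1 + R (Suc i) ?y) powr (1 / r)) / 2"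
    unfolding cell_avg_average[OF dyadic_step_integrable[OF h], of i] by simp
  also have "\<dots> = ?c * (((1 + R (Suc i) x) powr (1 / r) + (1 + R (Suc i) ?y) powr (1 / r)) / 2)"
    by (simp add: distrib_left)
  also have "\<dots> \<le> ?c * (2 powr k * (((1 + R (Suc i) x) + (1 + R (Suc i) ?y)) / 2) powr (1 / r))"
    unfolding k_def
    by (intro mult_left_mono two_point_power_mean r add_pos_nonneg R0) auto
  also have "((1 + R (Suc i) x) + (1 + R (Suc i) ?y)) / 2 = 1 + R i x"
    unfolding R_def cell_avg_average[OF int, of i] by (simp add: field_simps)
  also have "?c * (2 powr k * (1 + R i x) powr (1 / r)) =
      2 powr ((real m - real i) * k) * (1 + R i x) powr (1 / r)"
  proof -
    have "(real m - real i) * k = (real m - real (Suc i)) * k + k"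
      by (simp add: left_diff_distrib distrib_right)
    then show ?thesis by (simp only: powr_add mult.assoc)
  qed
  finally show ?case unfolding k_def r_def .
qed

text \<open>Let \<open>r\<close> be the lower bound of the exponent on the cell of level \<open>j\<close> around \<open>x\<close>, a cell which
  also contains \<open>flip j x\<close>. Up to the loss in the power mean, the average is at most
  \<open>E powr (1 / r)\<close> with \<open>1 \<le> E \<le> 2 ^ Suc i\<close>, so that raising it to the power \<open>p x\<close> gives
  \<open>E\<close> times at most \<open>2 powr ((i + 1) * (p x - r) / r)\<close>. Of this loss, the part with factor
  \<open>j\<close> is bounded by \<open>hoelder\<close>, and the part with factor \<open>i - j\<close> is
  \<open>2 powr ((i - j) * p x * (1 / r - 1 / p x))\<close>, which the weight absorbs because
  \<open>1 / r - 1 / p x < 1\<close>. The loss in the power mean is \<open>2 powr ((m - i) * (1 / r - 1))\<close> if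
  \<open>r < 1\<close>, and the weight absorbs it because \<open>r > 1 / 2\<close>.\<close>

lemma shifted_average_pointwise:
  assumes h: "dyadic_step m h" and pos: "\<And>x. 0 \<le> h x"
    and int: "integrable Omega (\<lambda>y. h y powr p y)" and int1: "(LINT y|Omega. h y powr p y) \<le> 1"
    and x: "x \<in> {0..<1}" and ji: "j \<le> i" and im: "i \<le> m"
    and px: "lo j x \<le> p x" "p x \<le> hi j x"
  shows "(2 powr (- (1 - decay_rate) * (real m - real j)) * cell_avg i h (flip j x)) powr p x
    \<le> 2 powr (2 * K + 2 * pp) * 2 powr (- (decay_rate / 2) * (real m - real j)) *
       (1 + cell_avg i (\<lambda>y. h y powr p y) (flip j x))"
proof -
  define r q where "r = lo j x" and "q = p x"
  define E where "E = 1 + cell_avg i (\<lambda>y. h y powr p y) (flip j x)"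
  define k where "k = max (1 / r - 1) 0"
  define M I J where "M = real m" and "I = real i" and "J = real j"
  have JIM: "0 \<le> J" "J \<le> I" "I \<le> M" using ji im by (auto simp: M_def I_def J_def)
  have r: "pm \<le> r" "0 < r" "r \<le> q" "q \<le> pp" "0 < q"
    using lo_hi[OF x, of j] pm px by (auto simp: r_def q_def)
  have y: "flip j x \<in> {0..<1}" by (rule flip_unit[OF x])
  have lo: "lo j (flip j x) = r"
    using lo_cell[of "flip j x" j x] cell_flip[of j j x] cell_self[of "flip j x" j] by (simp add: r_def)
  have E1: "1 \<le> E" unfolding E_def using cell_avg_nonneg[of "\<lambda>y. h y powr p y"] by simp
  have E2: "E \<le> 2 powr (I + 1)"
  proof -
    have "(LINT z|Omega. indicator (cell i (flip j x)) z * (h z powr p z)) \<le> (LINT y|Omega. h y powr p y)"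
      by (intro integral_mono integrable_cell int) (auto simp: indicator_def)
    then have "E \<le> 1 + 2 ^ i * 1"
      unfolding E_def cell_avg_def using int1 by (intro add_left_mono mult_left_mono) auto
    also have "\<dots> \<le> 2 ^ i + 2 ^ i" by simp
    also have "\<dots> = 2 powr (I + 1)" by (simp add: I_def powr_add powr_realpow)
    finally show ?thesis .
  qed
  have avg: "cell_avg i h (flip j x) \<le> 2 powr ((M - I) * k) * E powr (1 / r)"
    using cell_avg_power_mean[OF h pos int y ji im] by (simp add: lo M_def I_def k_def E_def)
  have avg0: "0 \<le> cell_avg i h (flip j x)" by (rule cell_avg_nonneg[OF pos])
  have "(2 powr (- (1 - decay_rate) * (M - J)) * cell_avg i h (flip j x)) powr q
    \<le> (2 powr (- (1 - decay_rate) * (M - J)) * (2 powr ((M - I) * k) * E powr (1 / r))) powr q"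
    using r avg avg0 by (intro powr_mono2 mult_left_mono) auto
  also have "\<dots> = 2 powr (q * (- (1 - decay_rate) * (M - J) + (M - I) * k)) * E powr (q / r)"
  proof -
    have "(2 powr a * (2 powr b * E powr (1 / r))) powr q = 2 powr (q * (a + b)) * E powr (q / r)" for a b
      using E1 by (simp add: powr_mult powr_powr powr_add distrib_left mult.commute)
    then show ?thesis .
  qed
  also have "E powr (q / r) = E powr ((q - r) / r) * E"
  proof -
    have "q / r = (q - r) / r + 1" using r by (simp add: field_simps)
    then show ?thesis using E1 by (simp add: powr_add)
  qed
  also have "E powr ((q - r) / r) \<le> (2 powr (I + 1)) powr ((q - r) / r)"
    using E1 E2 r by (intro powr_mono2) auto
  also have "(2 powr (I + 1)) powr ((q - r) / r) = 2 powr ((I + 1) * ((q - r) / r))"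
    by (simp add: powr_powr)
  finally have "(2 powr (- (1 - decay_rate) * (M - J)) * cell_avg i h (flip j x)) powr q \<le>
     2 powr (q * (- (1 - decay_rate) * (M - J) + (M - I) * k) + (I + 1) * ((q - r) / r)) * E"
    using E1 by (simp add: powr_add mult_left_mono mult_right_mono mult.assoc[symmetric])
  also have "\<dots> \<le> 2 powr (2 * K + 2 * pp + - (decay_rate / 2) * (M - J)) * E"
  proof (intro mult_right_mono powr_mono)
    have rr: "1 / r \<le> 1 / pm" using r pm by (intro divide_left_mono) auto
    have pm2: "1 / pm < 2" using pm by (simp add: field_simps)
    have qq: "1 / pp \<le> 1 / q" using r pm by (intro divide_left_mono) auto
    have 1: "(M - I) * k \<le> (M - I) * (1 - 2 * decay_rate)"
      using rr decay_rate_le JIM by (intro mult_left_mono) (auto simp: k_def)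
    have 2: "(I - J) * (1 / r - 1 / q) \<le> (I - J) * (1 - 2 * decay_rate)"
      using rr qq decay_rate_le JIM by (intro mult_left_mono) auto
    have hol: "J * (q - r) \<le> K"
    proof -
      have "J * (q - r) \<le> J * (hi j x - lo j x)"
        using px JIM by (intro mult_left_mono) (auto simp: r_def q_def)
      also have "\<dots> \<le> K" using hoelder[OF x] by (simp add: J_def)
      finally show ?thesis .
    qed
    have K0: "0 \<le> J * (q - r)" using r JIM by simp
    have 3: "J * ((q - r) / r) \<le> 2 * K"
    proof -
      have "J * ((q - r) / r) = (J * (q - r)) * (1 / r)" by simp
      also have "\<dots> \<le> K * 2" using hol K0 rr pm2 r by (intro mult_mono) auto
      finally show ?thesis by simp
    qed
    have 4: "(q - r) / r \<le> 2 * pp"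
    proof -
      have "(q - r) / r = (q - r) * (1 / r)" by simp
      also have "\<dots> \<le> pp * 2" using rr pm2 r by (intro mult_mono) auto
      finally show ?thesis by simp
    qed
    have 5: "(I + 1) * ((q - r) / r) = q * ((I - J) * (1 / r - 1 / q)) + J * ((q - r) / r) + (q - r) / r"
      using r by (simp add: field_simps)
    have 6: "q * ((I - J) * (1 / r - 1 / q)) \<le> q * ((I - J) * (1 - 2 * decay_rate))"
      by (rule mult_left_mono[OF 2]) (use r in simp)
    have 7: "q * (- (1 - decay_rate) * (M - J) + (M - I) * k) \<le>
        q * (- (1 - decay_rate) * (M - J) + (M - I) * (1 - 2 * decay_rate))"
      by (rule mult_left_mono[OF add_left_mono[OF 1]]) (use r in simp)
    have 8: "q * (- (1 - decay_rate) * (M - J) + (M - I) * (1 - 2 * decay_rate)) + q * ((I - J) * (1 - 2 * decay_rate))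
        = - (q * (decay_rate * (M - J)))"
      by (simp add: algebra_simps)
    have 9: "(1 / 2) * (decay_rate * (M - J)) \<le> q * (decay_rate * (M - J))"
      by (rule mult_right_mono) (use r pm decay_rate_pos JIM in auto)
    have 10: "2 * K + 2 * pp + - (decay_rate / 2) * (M - J) = 2 * K + 2 * pp - (1 / 2) * (decay_rate * (M - J))"
      by simp
    \<comment> \<open>The exponents are products of reals; naming them keeps the final comparison linear.\<close>
    have combine: "X + Y \<le> Z"
      if "Y = A + B + C" "A \<le> A'" "X \<le> X'" "X' + A' = - W" "V \<le> W" "B \<le> 2 * K"
        "C \<le> 2 * pp" "Z = 2 * K + 2 * pp - V" for X Y Z A A' B C X' V W :: real
      using that by linarith
    show "q * (- (1 - decay_rate) * (M - J) + (M - I) * k) + (I + 1) * ((q - r) / r)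
        \<le> 2 * K + 2 * pp + - (decay_rate / 2) * (M - J)"
      by (rule combine[OF 5 6 7 8 9 3 4 10])
  qed (use E1 in auto)
  also have "2 powr (2 * K + 2 * pp + - (decay_rate / 2) * (M - J)) =
      2 powr (2 * K + 2 * pp) * 2 powr (- (decay_rate / 2) * (M - J))"
    by (rule powr_add)
  finally show ?thesis by (simp add: E_def q_def M_def J_def)
qed

lemma modular_shifted_average:
  assumes h: "dyadic_step m h" and pos: "\<And>x. 0 \<le> h x" and fin: "modular p h \<le> 1"
    and ji: "j \<le> i" and im: "i \<le> m"
  shows "modular p (\<lambda>x. 2 powr (- (1 - decay_rate) * (real m - real j)) * cell_avg i h (flip j x))
    \<le> ennreal (2 * 2 powr (2 * K + 2 * pp) * 2 powr (- (decay_rate / 2) * (real m - real j)))"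
proof -
  define c where "c = 2 powr (2 * K + 2 * pp) * 2 powr (- (decay_rate / 2) * (real m - real j))"
  let ?H = "\<lambda>y. h y powr p y"
  note int = modular_integrable[OF dyadic_step_measurable[OF h] fin pos]
  have c0: "0 \<le> c" by (simp add: c_def)
  have "modular p (\<lambda>x. 2 powr (- (1 - decay_rate) * (real m - real j)) * cell_avg i h (flip j x))
     \<le> (\<integral>\<^sup>+ x. ennreal c * (1 + ennreal (cell_avg i ?H (flip j x))) \<partial>Omega)"
    unfolding modular_def
  proof (rule nn_integral_mono_AE)
    show "AE x in Omega. ennreal (\<bar>2 powr (- (1 - decay_rate) * (real m - real j)) * cell_avg i h (flip j x)\<bar> powr p x)
       \<le> ennreal c * (1 + ennreal (cell_avg i ?H (flip j x)))"
      using p_bounds[of j] AE_space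
    proof eventually_elim
      case (elim x)
      have "ennreal c * (1 + ennreal (cell_avg i ?H (flip j x))) = ennreal (c * (1 + cell_avg i ?H (flip j x)))"
        using c0 cell_avg_nonneg[of ?H i "flip j x"]
        by (simp add: ennreal_mult)
      moreover have "\<bar>2 powr (- (1 - decay_rate) * (real m - real j)) * cell_avg i h (flip j x)\<bar> powr p x
          \<le> c * (1 + cell_avg i ?H (flip j x))"
        using shifted_average_pointwise[OF h pos int _ ji im, of x] elim cell_avg_nonneg[of h i "flip j x", OF pos]
        by (simp add: c_def abs_mult)
      ultimately show ?case by (simp add: ennreal_leI)
    qed
  qed
  also have "\<dots> = ennreal c * (1 + ennreal (LINT y|Omega. ?H y))"
  proof -
    have m: "(\<lambda>x. ennreal (cell_avg i ?H (flip j x))) \<in> borel_measurable Omega"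
      by (rule borel_measurable_Omega) measurable
    show ?thesis
      using nn_integral_cell_avg_flip[OF int(1), of i j] m
      by (simp add: nn_integral_cmult nn_integral_add Omega.emeasure_space_1[simplified])
  qed
  also have "\<dots> \<le> ennreal c * (1 + 1)"
    using int(2) by (intro mult_left_mono add_left_mono) auto
  also have "\<dots> = ennreal (2 * c)"
    using c0 by (simp add: ennreal_mult mult.commute one_add_one)
  finally show ?thesis by (simp add: c_def mult.assoc)
qed

text \<open>The factor \<open>Suc l\<close> counts the averages that occur with the same flip in \<open>shift_op\<close>.\<close>

definition decay :: "nat \<Rightarrow> real" where
  "decay l = real (Suc l) * 2 powr (- (decay_rate / 2) * real l)"

lemma decay_nonneg: "0 \<le> decay l"
  by (simp add: decay_def)

lemma summable_decay: "summable decay"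
proof -
  have "\<bar>2 powr (- (decay_rate / 2))\<bar> < (1::real)"
    using decay_rate_pos powr_less_mono[of "- (decay_rate / 2)" 0 "2::real"] by simp
  then have "summable (\<lambda>l. of_nat (Suc l) * (2 powr (- (decay_rate / 2))) ^ l :: real)"
    using geometric_deriv_sums[of "2 powr (- (decay_rate / 2)) :: real"] by (auto simp: sums_iff)
  moreover have "2 powr (- (decay_rate / 2) * real l) = (2 powr (- (decay_rate / 2))) ^ l" for l
    by (subst powr_realpow[symmetric]) (simp_all only: powr_powr, simp)
  ultimately show ?thesis
    unfolding decay_def[abs_def] by simp
qed

lemma sum_decay_le:
  assumes "J \<subseteq> {..m}"
  shows "(\<Sum>j\<in>J. decay (m - j)) \<le> suminf decay"
proof -
  have "(\<Sum>j\<in>J. decay (m - j)) = sum decay ((\<lambda>j. m - j) ` J)"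
    using assms by (subst sum.reindex) (auto simp: inj_on_def o_def, metis diff_diff_cancel subsetD atMost_iff)
  also have "\<dots> \<le> suminf decay"
    by (rule sum_le_suminf[OF summable_decay])
      (use finite_subset[OF assms] decay_nonneg in auto)
  finally show ?thesis .
qed

definition op_const :: real where
  "op_const = max 1 (suminf decay) powr pp * (2 * 2 powr (2 * K + 2 * pp))"

lemma op_const_nonneg: "0 \<le> op_const"
  by (simp add: op_const_def)

text \<open>Half of the available geometric decay makes the weights summable, the other half remains on the
  modulars of the single terms. For \<open>J = {..m}\<close> the right-hand side is bounded uniformly in
  \<open>m\<close>; for a fixed finite \<open>J\<close> it tends to \<open>0\<close> as \<open>m\<close> grows.\<close>

lemma modular_shift_op:
  assumes h: "dyadic_step m h" and pos: "\<And>x. 0 \<le> h x" and fin: "modular p h \<le> 1"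
    and J: "J \<subseteq> {..m}"
  shows "modular p (shift_op m J h) \<le> ennreal (op_const * (\<Sum>j\<in>J. decay (m - j)))"
proof -
  define F where "F = Sigma J (\<lambda>j. {j..m})"
  define w where "w = (\<lambda>(j, i::nat). 2 powr (- decay_rate * (real m - real j)))"
  define b where "b = (\<lambda>x (j, i). 2 powr (- (1 - decay_rate) * (real m - real j)) * cell_avg i h (flip j x))"
  define S where "S = max 1 (suminf decay)"
  define A where "A = 2 * 2 powr (2 * K + 2 * pp)"
  have fJ: "finite J" using J finite_subset by blast
  have fF: "finite F" unfolding F_def using fJ by auto
  have sumF: "(\<Sum>k\<in>F. v (fst k)) = (\<Sum>j\<in>J. real (Suc (m - j)) * v j)" for v :: "nat \<Rightarrow> real"
  proof -
    have "(\<Sum>k\<in>F. v (fst k)) = (\<Sum>j\<in>J. \<Sum>i=j..m. v j)"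
      unfolding F_def by (subst sum.Sigma) (use fJ in \<open>auto simp: split_def\<close>)
    also have "\<dots> = (\<Sum>j\<in>J. real (Suc (m - j)) * v j)"
      by (rule sum.cong) (use J in \<open>auto simp: Suc_diff_le\<close>)
    finally show ?thesis .
  qed
  have op: "shift_op m J h x = (\<Sum>k\<in>F. w k * b x k)" for x
  proof -
    have "2 ^ j / 2 ^ m = 2 powr (- decay_rate * (real m - real j)) * 2 powr (- (1 - decay_rate) * (real m - real j))" for j
    proof -
      have "- decay_rate * (real m - real j) + - (1 - decay_rate) * (real m - real j) = real j - real m"
        by (simp add: algebra_simps)
      then show ?thesis
        by (simp only: powr_add[symmetric]) (simp add: powr_diff powr_realpow)
    qed
    then have "shift_op m J h x = (\<Sum>j\<in>J. \<Sum>i=j..m. w (j, i) * b x (j, i))"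
      by (simp add: shift_op_def w_def b_def mult.assoc)
    also have "\<dots> = (\<Sum>k\<in>F. w k * b x k)"
      unfolding F_def by (subst sum.Sigma) (use fJ in \<open>auto simp: split_def\<close>)
    finally show ?thesis .
  qed
  have w: "0 \<le> w k" for k by (auto simp: w_def split_def)
  have b: "0 \<le> b x k" for x k
    using cell_avg_nonneg[of h, OF pos] by (auto simp: b_def split_def)
  have decay_eq: "real (Suc (m - j)) * 2 powr (- (decay_rate / 2) * (real m - real j)) = decay (m - j)"
    if "j \<in> J" for j
    using J that by (auto simp: decay_def of_nat_diff subset_eq)
  have wS: "sum w F \<le> S"
  proof -
    have "sum w F = (\<Sum>j\<in>J. real (Suc (m - j)) * 2 powr (- decay_rate * (real m - real j)))"
      using sumF[of "\<lambda>j. 2 powr (- decay_rate * (real m - real j))"] by (simp add: w_def split_def)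
    also have "\<dots> \<le> (\<Sum>j\<in>J. decay (m - j))"
    proof (rule sum_mono)
      fix j assume j: "j \<in> J"
      have "- decay_rate * (real m - real j) \<le> - (decay_rate / 2) * (real m - real j)"
        using decay_rate_pos J j by (intro mult_right_mono) auto
      then show "real (Suc (m - j)) * 2 powr (- decay_rate * (real m - real j)) \<le> decay (m - j)"
        unfolding decay_eq[OF j, symmetric] by (intro mult_left_mono powr_mono) auto
    qed
    also have "\<dots> \<le> suminf decay" by (rule sum_decay_le[OF J])
    finally show ?thesis by (simp add: S_def)
  qed
  have mb: "(\<lambda>x. ennreal (\<bar>b x k\<bar> powr p x)) \<in> borel_measurable Omega" for k
  proof -
    have "(\<lambda>x. cell_avg (snd k) h (flip (fst k) x)) \<in> borel_measurable Omega"
      by (rule borel_measurable_Omega) measurable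
    then show ?thesis using p_measurable by (simp add: b_def split_def)
  qed
  have "modular p (shift_op m J h) \<le> (\<integral>\<^sup>+ x. ennreal (S powr pp) * (\<Sum>k\<in>F. ennreal (\<bar>b x k\<bar> powr p x)) \<partial>Omega)"
    unfolding modular_def
  proof (rule nn_integral_mono_AE)
    show "AE x in Omega. ennreal (\<bar>shift_op m J h x\<bar> powr p x) \<le>
       ennreal (S powr pp) * (\<Sum>k\<in>F. ennreal (\<bar>b x k\<bar> powr p x))"
      using AE_p_bounds
    proof eventually_elim
      case (elim x)
      have q: "0 < p x" using elim pm by linarith
      have "\<bar>shift_op m J h x\<bar> powr p x = (\<Sum>k\<in>F. w k * b x k) powr p x"
        unfolding op by (subst abs_of_nonneg) (auto intro!: sum_nonneg mult_nonneg_nonneg w b)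
      also have "\<dots> \<le> S powr p x * (\<Sum>k\<in>F. b x k powr p x)"
        by (rule powr_sum_le[OF fF w b wS q])
      also have "\<dots> \<le> S powr pp * (\<Sum>k\<in>F. b x k powr p x)"
        using elim by (intro mult_right_mono powr_mono sum_nonneg) (auto simp: S_def)
      finally have "ennreal (\<bar>shift_op m J h x\<bar> powr p x) \<le> ennreal (S powr pp * (\<Sum>k\<in>F. b x k powr p x))"
        by (rule ennreal_leI)
      also have "\<dots> = ennreal (S powr pp) * (\<Sum>k\<in>F. ennreal (\<bar>b x k\<bar> powr p x))"
        using b by (subst ennreal_mult) (auto intro!: sum_nonneg simp: sum_ennreal)
      finally show ?case .
    qed
  qed
  also have "\<dots> = ennreal (S powr pp) * (\<Sum>k\<in>F. modular p (\<lambda>x. b x k))"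
    unfolding modular_def
    by (simp only: nn_integral_cmult[OF borel_measurable_sum[OF mb]] nn_integral_sum[OF mb])
  also have "\<dots> \<le> ennreal (S powr pp) * (\<Sum>k\<in>F. ennreal (A * 2 powr (- (decay_rate / 2) * (real m - real (fst k)))))"
  proof (intro mult_left_mono sum_mono)
    fix k assume "k \<in> F"
    then obtain j i where k: "k = (j, i)" "j \<in> J" "j \<le> i" "i \<le> m" by (auto simp: F_def)
    show "modular p (\<lambda>x. b x k) \<le> ennreal (A * 2 powr (- (decay_rate / 2) * (real m - real (fst k))))"
      using modular_shifted_average[OF h pos fin k(3,4)] by (simp add: k(1) b_def A_def)
  qed simp
  also have "\<dots> = ennreal (S powr pp * (\<Sum>k\<in>F. A * 2 powr (- (decay_rate / 2) * (real m - real (fst k)))))"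
    by (subst ennreal_mult) (auto intro!: sum_nonneg simp: sum_ennreal A_def)
  also have "(\<Sum>k\<in>F. A * 2 powr (- (decay_rate / 2) * (real m - real (fst k)))) = A * (\<Sum>j\<in>J. decay (m - j))"
    using sumF[of "\<lambda>j. 2 powr (- (decay_rate / 2) * (real m - real j))"] decay_eq
    by (simp add: sum_distrib_left[symmetric] cong: sum.cong)
  also have "S powr pp * (A * (\<Sum>j\<in>J. decay (m - j))) = op_const * (\<Sum>j\<in>J. decay (m - j))"
    by (simp add: op_const_def S_def A_def mult.assoc)
  finally show ?thesis .
qed

end

section \<open>Fejer means of dyadic martingales\<close>

lemma rademacher_cell: "j < m \<Longrightarrow> y \<in> cell m x \<Longrightarrow> rademacher j y = rademacher j x"
  using cell_Suc_iff[of y j x] cell_antimono[of "Suc j" m x] by auto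

lemma walsh_cell:
  assumes "l < 2 ^ m" "y \<in> cell m x"
  shows "walsh l y = walsh l x"
  unfolding walsh_def
proof (rule prod.cong)
  fix k assume "k \<in> {k. bit l k}"
  then have "k < m" using bit_less_two_power assms(1) by blast
  then show "rademacher k y = rademacher k x" by (rule rademacher_cell[OF _ assms(2)])
qed simp

text \<open>The Dirichlet kernel of order \<open>2 ^ m\<close> is the product of the factors
  \<open>1 + rademacher j x * rademacher j y\<close> for \<open>j < m\<close>, each of which is \<open>2\<close> or \<open>0\<close> according to
  whether a binary digit of \<open>x\<close> and \<open>y\<close> agrees.\<close>

lemma walsh_kernel:
  assumes "x \<in> {0..<1}" "y \<in> {0..<1}"
  shows "(\<Sum>l<2 ^ m. walsh l x * walsh l y) = 2 ^ m * indicator (cell m x) y"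
proof (induction m)
  case 0
  have "y \<in> cell 0 x" using cell_0[OF assms(1)] assms(2) by blast
  then show ?case by (simp add: walsh_def)
next
  case (Suc m)
  have "(\<Sum>l<2 ^ Suc m. walsh l x * walsh l y) =
     (\<Sum>l<2 ^ m. walsh l x * walsh l y) + (\<Sum>l<2 ^ m. walsh (2 ^ m + l) x * walsh (2 ^ m + l) y)"
    using sum_lessThan_add[of _ "2 ^ m" "2 ^ m"] by (simp add: mult_2)
  also have "(\<Sum>l<2 ^ m. walsh (2 ^ m + l) x * walsh (2 ^ m + l) y) =
      rademacher m x * rademacher m y * (\<Sum>l<2 ^ m. walsh l x * walsh l y)"
    unfolding sum_distrib_left by (rule sum.cong) (auto simp: walsh_add_two_power)
  finally have "(\<Sum>l<2 ^ Suc m. walsh l x * walsh l y) =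
     (1 + rademacher m x * rademacher m y) * (2 ^ m * indicator (cell m x) y)"
    unfolding Suc by (simp add: distrib_right)
  moreover have "rademacher m x * rademacher m y = (if rademacher m y = rademacher m x then 1 else - 1)"
    by (auto simp: rademacher_def)
  ultimately show ?case by (simp add: indicator_def cell_Suc_iff)
qed

lemma martingale_step: "dyadic_martingale f \<Longrightarrow> dyadic_step m (f m)"
  by (simp add: dyadic_martingale_def dyadic_sigma_measurable_iff)

lemma dyadic_step_combine:
  assumes "dyadic_step m u" "dyadic_step m v"
  shows "dyadic_step m (\<lambda>x. F (u x) (v x))"
  unfolding dyadic_step_def
proof (intro ballI)
  fix x y :: real assume "x \<in> {0..<1}" "y \<in> cell m x"
  then have "u y = u x" "v y = v x" using assms dyadic_stepD by blast+
  then show "F (u y) (v y) = F (u x) (v x)" by simp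
qed

lemma dyadic_step_walsh: "l < 2 ^ m \<Longrightarrow> dyadic_step m (walsh l)"
  using walsh_cell unfolding dyadic_step_def by blast

text \<open>By the martingale property the integrals that define the coefficient do not depend on the level,
  once \<open>walsh l\<close> is constant on the cells of that level.\<close>

lemma walsh_coeff_martingale:
  assumes f: "dyadic_martingale f" and l: "l < 2 ^ m"
  shows "walsh_coeff f l = (LINT x|Omega. f m x * walsh l x)"
proof -
  have w: "dyadic_step m (walsh l)" by (rule dyadic_step_walsh[OF l])
  have "(LINT x|Omega. f k x * walsh l x) = (LINT x|Omega. f m x * walsh l x)" if "m \<le> k" for k
  proof -
    interpret sigma_finite_subalgebra Omega "dyadic_sigma m" by (rule sigma_finite_dyadic_sigma)
    have "dyadic_step k (\<lambda>x. walsh l x * f k x)"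
      by (rule dyadic_step_combine[OF dyadic_step_mono[OF w that] martingale_step[OF f]])
    then have int: "integrable Omega (\<lambda>x. walsh l x * f k x)" by (rule dyadic_step_integrable)
    have wm: "walsh l \<in> borel_measurable (dyadic_sigma m)"
      using w by (simp add: dyadic_sigma_measurable_iff)
    have fm: "f k \<in> borel_measurable Omega" using martingale_step[OF f] by (rule dyadic_step_measurable)
    have "(LINT x|Omega. walsh l x * f k x) = (LINT x|Omega. walsh l x * real_cond_exp Omega (dyadic_sigma m) (f k) x)"
      by (rule real_cond_exp_intg(2)[OF int wm fm, symmetric])
    also have "\<dots> = (LINT x|Omega. walsh l x * f m x)"
    proof (rule integral_cong_AE)
      have "AE x in Omega. real_cond_exp Omega (dyadic_sigma m) (f k) x = f m x"
        using f that by (simp add: dyadic_martingale_def)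
      then show "AE x in Omega. walsh l x * real_cond_exp Omega (dyadic_sigma m) (f k) x = walsh l x * f m x"
        by eventually_elim simp
    next
      show "(\<lambda>x. walsh l x * f m x) \<in> borel_measurable Omega"
        by (intro borel_measurable_times dyadic_step_measurable[OF w]
            dyadic_step_measurable[OF martingale_step[OF f]])
    qed (use real_cond_exp_intg(1)[OF int wm fm] in auto)
    finally show ?thesis by (simp add: mult.commute)
  qed
  then have "eventually (\<lambda>k. (LINT x|Omega. f k x * walsh l x) = (LINT x|Omega. f m x * walsh l x)) sequentially"
    unfolding eventually_sequentially by blast
  then show ?thesis unfolding walsh_coeff_def by (intro limI tendsto_eventually)
qed

lemma dyadic_sum_martingale:
  assumes f: "dyadic_martingale f" and x: "x \<in> {0..<1}"
  shows "dyadic_sum (walsh_coeff f) m x = f m x"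
proof -
  have int: "integrable Omega (\<lambda>y. f m y * walsh l y * walsh l x)" if "l < 2 ^ m" for l
  proof -
    have "dyadic_step m (\<lambda>y. f m y * walsh l y * walsh l x)"
      by (rule dyadic_step_combine[OF martingale_step[OF f] dyadic_step_walsh[OF that]])
    then show ?thesis by (rule dyadic_step_integrable)
  qed
  have "dyadic_sum (walsh_coeff f) m x = (\<Sum>l<2 ^ m. (LINT y|Omega. f m y * walsh l y) * walsh l x)"
    unfolding dyadic_sum_def by (rule sum.cong) (auto simp: walsh_coeff_martingale[OF f])
  also have "\<dots> = (\<Sum>l<2 ^ m. (LINT y|Omega. f m y * walsh l y * walsh l x))"
    by simp
  also have "\<dots> = (LINT y|Omega. (\<Sum>l<2 ^ m. f m y * walsh l y * walsh l x))"
    by (rule Bochner_Integration.integral_sum[symmetric]) (use int in auto)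
  also have "\<dots> = (LINT y|Omega. 2 ^ m * (indicator (cell m x) y * f m y))"
  proof (rule Bochner_Integration.integral_cong)
    fix y assume "y \<in> space Omega"
    then have "(\<Sum>l<2 ^ m. walsh l x * walsh l y) = 2 ^ m * indicator (cell m x) y"
      using walsh_kernel[OF x] by simp
    then have "f m y * (\<Sum>l<2 ^ m. walsh l x * walsh l y) = f m y * (2 ^ m * indicator (cell m x) y)"
      by simp
    then show "(\<Sum>l<2 ^ m. f m y * walsh l y * walsh l x) = 2 ^ m * (indicator (cell m x) y * f m y)"
      by (simp add: sum_distrib_left mult_ac)
  qed simp
  also have "\<dots> = cell_avg m (f m) x" by (simp add: cell_avg_def)
  also have "\<dots> = f m x" by (rule cell_avg_step[OF martingale_step[OF f] x])
  finally show ?thesis .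
qed

lemma martingale_increment:
  assumes f: "dyadic_martingale f" and x: "x \<in> {0..<1}"
  shows "rademacher m x * dyadic_sum (\<lambda>l. walsh_coeff f (2 ^ m + l)) m x = f (Suc m) x - f m x"
  using dyadic_sum_Suc[of "walsh_coeff f" m x] dyadic_sum_martingale[OF f x] by simp

lemma martingale_increment_abs:
  assumes f: "dyadic_martingale f" and x: "x \<in> {0..<1}"
  shows "\<bar>dyadic_sum (\<lambda>l. walsh_coeff f (2 ^ m + l)) m x\<bar> = \<bar>f (Suc m) x - f m x\<bar>"
  unfolding martingale_increment[OF f x, symmetric] by (simp add: abs_mult)

text \<open>On a cell of level \<open>m\<close> the increment takes two opposite values, so its absolute value is
  constant there. This makes the dominating function in \<open>fejer_mean_bound\<close> one of level \<open>m\<close>,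
  not \<open>Suc m\<close>, although the Fejer mean involves frequencies up to \<open>2 ^ Suc m\<close>.\<close>

lemma martingale_increment_step:
  assumes f: "dyadic_martingale f"
  shows "dyadic_step m (\<lambda>x. \<bar>f (Suc m) x - f m x\<bar>)"
  unfolding dyadic_step_def
proof (intro ballI)
  fix y z :: real assume y: "y \<in> {0..<1}" and z: "z \<in> cell m y"
  have z1: "z \<in> {0..<1}" using cell_subset[OF y] z by blast
  have "dyadic_sum (\<lambda>l. walsh_coeff f (2 ^ m + l)) m z = dyadic_sum (\<lambda>l. walsh_coeff f (2 ^ m + l)) m y"
    unfolding dyadic_sum_def by (rule sum.cong) (auto simp: walsh_cell[OF _ z])
  then show "\<bar>f (Suc m) z - f m z\<bar> = \<bar>f (Suc m) y - f m y\<bar>"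
    using martingale_increment_abs[OF f y, of m] martingale_increment_abs[OF f z1, of m] by simp
qed

lemma martingale_difference_step:
  assumes f: "dyadic_martingale f" and N: "N \<le> m"
  shows "dyadic_step m (\<lambda>x. \<bar>f m x - f N x\<bar> + \<bar>f (Suc m) x - f m x\<bar>)"
proof -
  have "dyadic_step m (\<lambda>x. \<bar>f m x - f N x\<bar>)"
    by (rule dyadic_step_combine[OF martingale_step[OF f] dyadic_step_mono[OF martingale_step[OF f] N]])
  then show ?thesis by (rule dyadic_step_combine[OF _ martingale_increment_step[OF f]])
qed

lemma sum_pow2_le: "(\<Sum>j<n. 2 ^ j :: real) \<le> 2 ^ n"
  by (induction n) auto

lemma sum_triangle_swap:
  fixes a :: "nat \<Rightarrow> nat \<Rightarrow> real"
  shows "(\<Sum>i\<le>m. \<Sum>j\<le>i. a i j) = (\<Sum>j\<le>m. \<Sum>i=j..m. a i j)"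
proof -
  have "(\<Sum>i\<le>m. \<Sum>j\<le>i. a i j) = (\<Sum>i\<in>{..m}. \<Sum>j | j \<in> {..m} \<and> j \<le> i. a i j)"
    by (intro sum.cong) auto
  also have "\<dots> = (\<Sum>j\<in>{..m}. \<Sum>i | i \<in> {..m} \<and> j \<le> i. a i j)"
    by (rule sum.swap_restrict) auto
  also have "\<dots> = (\<Sum>j\<le>m. \<Sum>i=j..m. a i j)"
    by (intro sum.cong) auto
  finally show ?thesis .
qed

text \<open>By the dyadic derivative, \<open>f m\<close> enters the left-hand side only through its differences under
  digit flips, and \<open>f N\<close> is invariant under flips of the digits from \<open>N\<close> on. Hence \<open>f m\<close> may be
  replaced by \<open>f m - f N\<close> up to an error that is \<open>O(2 ^ N)\<close> before division by \<open>n\<close>. The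
  remaining frequencies contribute a Fejer sum of the increment \<open>f (Suc m) - f m\<close>.\<close>

lemma fejer_mean_bound:
  assumes f: "dyadic_martingale f" and x: "x \<in> {0..<1}"
    and n: "2 ^ m \<le> n" "n < 2 ^ Suc m" and N: "N \<le> m"
    and B: "\<And>x. x \<in> {0..<1} \<Longrightarrow> \<bar>f N x\<bar> \<le> B"
  defines "h \<equiv> \<lambda>x. \<bar>f m x - f N x\<bar> + \<bar>f (Suc m) x - f m x\<bar>"
  shows "\<bar>fejer_mean f n x - f m x\<bar> \<le> 2 ^ N * B / 2 ^ m + 4 * shift_op m {..m} h x"
proof -
  let ?c = "walsh_coeff f"
  define c' where "c' = (\<lambda>l. ?c (2 ^ m + l))"
  define n' where "n' = n - 2 ^ m"
  have nn: "n = 2 ^ m + n'" and n': "n' < 2 ^ m" using n by (auto simp: n'_def)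
  define Q where "Q = (\<lambda>i. cell_avg i h)"
  have B0: "0 \<le> B" using B[OF x] by linarith
  have h: "dyadic_step m h" unfolding h_def by (rule martingale_difference_step[OF f N])
  have h0: "0 \<le> h y" for y by (simp add: h_def)
  have Q0: "0 \<le> Q i y" for i y unfolding Q_def by (rule cell_avg_nonneg[OF h0])
  have Qm: "Q m y = h y" if "y \<in> {0..<1}" for y unfolding Q_def by (rule cell_avg_step[OF h that])
  let ?Bd = "\<lambda>i. 2 ^ Suc i * Q i x + (\<Sum>j<i. 2 ^ j / 2 * (Q i x + Q i (flip j x)))"
  have 1: "\<bar>fejer_sum c' n' x\<bar> \<le> (\<Sum>i<m. ?Bd i)"
  proof (rule fejer_sum_bound[OF _ _ n' x])
    show "Q i y = (Q (Suc i) y + Q (Suc i) (flip i y)) / 2" for i y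
      unfolding Q_def by (rule cell_avg_average[OF dyadic_step_integrable[OF h]])
    show "\<bar>dyadic_sum c' m y\<bar> \<le> Q m y" if "y \<in> {0..<1}" for y
      using martingale_increment_abs[OF f that] Qm[OF that] by (simp add: h_def c'_def)
  qed
  have 2: "\<bar>\<Sum>j<m. 2 ^ j / 2 * (f m x - f m (flip j x))\<bar> \<le> 2 ^ N * B + ?Bd m"
  proof -
    have t: "\<bar>2 ^ j / 2 * (f m x - f m (flip j x))\<bar> \<le>
        (if j < N then 2 ^ j * B else 0) + 2 ^ j / 2 * (Q m x + Q m (flip j x))" for j
    proof -
      have y: "flip j x \<in> {0..<1}" by (rule flip_unit[OF x])
      have a: "\<bar>f m x - f N x\<bar> \<le> Q m x" "\<bar>f m (flip j x) - f N (flip j x)\<bar> \<le> Q m (flip j x)"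
        using Qm[OF x] Qm[OF y] by (simp_all add: h_def)
      have "\<bar>f N x - f N (flip j x)\<bar> \<le> (if j < N then 2 * B else 0)"
      proof (cases "j < N")
        case True
        then show ?thesis using B[OF x] B[OF y] by simp
      next
        case False
        then have "flip j x \<in> cell N x" using cell_flip[of N j x] cell_self[of "flip j x" N] by simp
        from dyadic_stepD[OF martingale_step[OF f] x this] show ?thesis using False by simp
      qed
      then have "\<bar>f m x - f m (flip j x)\<bar> \<le> (if j < N then 2 * B else 0) + (Q m x + Q m (flip j x))"
        using a by linarith
      then have "2 ^ j / 2 * \<bar>f m x - f m (flip j x)\<bar> \<le>
          2 ^ j / 2 * ((if j < N then 2 * B else 0) + (Q m x + Q m (flip j x)))"
        by (rule mult_left_mono) simp
      then show ?thesis by (cases "j < N") (simp_all add: abs_mult distrib_left)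
    qed
    have "\<bar>\<Sum>j<m. 2 ^ j / 2 * (f m x - f m (flip j x))\<bar> \<le>
       (\<Sum>j<m. (if j < N then 2 ^ j * B else 0) + 2 ^ j / 2 * (Q m x + Q m (flip j x)))"
      by (rule order_trans[OF sum_abs sum_mono]) (rule t)
    also have "\<dots> = (\<Sum>j<m. if j < N then 2 ^ j * B else 0) + (\<Sum>j<m. 2 ^ j / 2 * (Q m x + Q m (flip j x)))"
      by (rule sum.distrib)
    also have "(\<Sum>j<m. if j < N then 2 ^ j * B else 0) = (\<Sum>j<N. 2 ^ j * B)"
      using N by (intro sum.mono_neutral_cong_right) auto
    also have "(\<Sum>j<N. 2 ^ j * B) \<le> 2 ^ N * B"
      unfolding sum_distrib_right[symmetric] using sum_pow2_le B0 by (intro mult_right_mono) auto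
    finally have "\<bar>\<Sum>j<m. 2 ^ j / 2 * (f m x - f m (flip j x))\<bar> \<le>
        2 ^ N * B + (\<Sum>j<m. 2 ^ j / 2 * (Q m x + Q m (flip j x)))" by simp
    moreover have "0 \<le> 2 ^ Suc m * Q m x" by (intro mult_nonneg_nonneg Q0) simp
    ultimately show ?thesis by linarith
  qed
  \<comment> \<open>The term with \<open>j = i\<close> collects the unshifted averages, because \<open>flip i\<close> preserves cells of level \<open>i\<close>.\<close>
  have 3: "?Bd i \<le> 4 * (\<Sum>j\<le>i. 2 ^ j * Q i (flip j x))" for i
  proof -
    have "Q i (flip i x) = Q i x" by (simp add: Q_def cell_avg_def cell_flip)
    then have "(\<Sum>j\<le>i. 2 ^ j * Q i (flip j x)) = (\<Sum>j<i. 2 ^ j * Q i (flip j x)) + 2 ^ i * Q i x"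
      by (simp add: lessThan_Suc_atMost[symmetric])
    moreover have "(\<Sum>j<i. 2 ^ j / 2 * (Q i x + Q i (flip j x))) =
        (\<Sum>j<i. 2 ^ j) / 2 * Q i x + (\<Sum>j<i. 2 ^ j * Q i (flip j x)) / 2"
      by (simp add: sum_distrib_right sum_divide_distrib sum.distrib[symmetric] distrib_left)
    moreover have "(\<Sum>j<i. 2 ^ j) / 2 * Q i x \<le> (2 ^ i * Q i x) / 2"
      using mult_right_mono[OF sum_pow2_le[of i] Q0[of i x]] by simp
    moreover have "0 \<le> (\<Sum>j<i. 2 ^ j * Q i (flip j x))" by (intro sum_nonneg mult_nonneg_nonneg Q0) auto
    moreover have "0 \<le> 2 ^ i * Q i x" using Q0 by simp
    moreover have "2 ^ Suc i * Q i x = 2 * (2 ^ i * Q i x)" by simp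
    ultimately show ?thesis by linarith
  qed
  have "real n * (fejer_mean f n x - f m x) =
     rademacher m x * fejer_sum c' n' x - (\<Sum>j<m. 2 ^ j / 2 * (f m x - f m (flip j x)))"
  proof -
    have "real n * fejer_mean f n x = fejer_sum ?c n x"
      using n by (simp add: fejer_mean_eq)
    then show ?thesis
      using fejer_sum_split[OF less_imp_le[OF n'], of ?c x] dyadic_sum_martingale[OF f x]
        dyadic_sum_martingale[OF f flip_unit[OF x]]
      by (simp add: nn c'_def right_diff_distrib)
  qed
  note difference = this
  have "real n * \<bar>fejer_mean f n x - f m x\<bar> = \<bar>real n * (fejer_mean f n x - f m x)\<bar>"
    by (simp add: abs_mult)
  also have "\<dots> \<le> \<bar>rademacher m x * fejer_sum c' n' x\<bar>
      + \<bar>\<Sum>j<m. 2 ^ j / 2 * (f m x - f m (flip j x))\<bar>"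
    unfolding difference by (rule abs_triangle_ineq4)
  also have "\<dots> \<le> 2 ^ N * B + (\<Sum>i\<le>m. ?Bd i)"
    using 1 2 unfolding lessThan_Suc_atMost[symmetric] sum.lessThan_Suc abs_mult abs_rademacher mult_1
    by linarith
  also have "\<dots> \<le> 2 ^ N * B + (\<Sum>i\<le>m. 4 * (\<Sum>j\<le>i. 2 ^ j * Q i (flip j x)))"
    by (intro add_left_mono sum_mono 3)
  also have "(\<Sum>i\<le>m. 4 * (\<Sum>j\<le>i. 2 ^ j * Q i (flip j x))) = 2 ^ m * (4 * shift_op m {..m} h x)"
    unfolding shift_op_def sum_distrib_left[symmetric] sum_triangle_swap
    by (simp add: sum_distrib_left Q_def)
  finally have "real n * \<bar>fejer_mean f n x - f m x\<bar> \<le> 2 ^ N * B + 2 ^ m * (4 * shift_op m {..m} h x)" .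
  moreover have "2 ^ m * \<bar>fejer_mean f n x - f m x\<bar> \<le> real n * \<bar>fejer_mean f n x - f m x\<bar>"
    using n(1) by (intro mult_right_mono) (metis of_nat_le_iff of_nat_numeral of_nat_power, simp)
  ultimately have "2 ^ m * \<bar>fejer_mean f n x - f m x\<bar> \<le> 2 ^ N * B + 2 ^ m * (4 * shift_op m {..m} h x)"
    by linarith
  then show ?thesis by (simp add: field_simps)
qed

section \<open>Convergence in the mean of conditional expectations\<close>

lemma eventually_L1_small:
  fixes s :: "nat \<Rightarrow> real \<Rightarrow> real"
  assumes s: "\<And>n. s n \<in> borel_measurable Omega" and w: "integrable Omega w"
    and bound: "\<And>n x. \<bar>s n x\<bar> \<le> w x" and lim: "AE x in Omega. (\<lambda>n. s n x) \<longlonglongrightarrow> 0"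
    and e: "0 < e"
  shows "\<exists>n0. \<forall>n\<ge>n0. (LINT x|Omega. \<bar>s n x\<bar>) < e"
proof -
  have "(\<lambda>n. LINT x|Omega. \<bar>s n x\<bar>) \<longlonglongrightarrow> (LINT x|Omega. (0::real))"
  proof (rule integral_dominated_convergence[OF _ _ w])
    show "AE x in Omega. (\<lambda>n. \<bar>s n x\<bar>) \<longlonglongrightarrow> 0"
      using lim by eventually_elim (rule tendsto_rabs_zero)
    show "AE x in Omega. norm \<bar>s n x\<bar> \<le> w x" for n using bound by simp
  qed (use s in auto)
  then have "eventually (\<lambda>n. (LINT x|Omega. \<bar>s n x\<bar>) < e) sequentially"
    using e by (intro order_tendstoD) auto
  then show ?thesis by (simp add: eventually_sequentially)
qed

lemma L1_triangle:
  fixes u v w :: "real \<Rightarrow> real"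
  assumes "integrable Omega u" "integrable Omega v" "integrable Omega w"
  shows "(LINT x|Omega. \<bar>u x - w x\<bar>) \<le> (LINT x|Omega. \<bar>u x - v x\<bar>) + (LINT x|Omega. \<bar>v x - w x\<bar>)"
proof -
  have "(LINT x|Omega. \<bar>u x - w x\<bar>) \<le> (LINT x|Omega. \<bar>u x - v x\<bar> + \<bar>v x - w x\<bar>)"
    using assms by (intro integral_mono) auto
  also have "\<dots> = (LINT x|Omega. \<bar>u x - v x\<bar>) + (LINT x|Omega. \<bar>v x - w x\<bar>)"
    using assms by (intro Bochner_Integration.integral_add) auto
  finally show ?thesis .
qed

lemma dyadic_left_endpoint_tendsto: "(\<lambda>j. real_of_int \<lfloor>2 ^ j * x\<rfloor> / 2 ^ j) \<longlonglongrightarrow> x"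
proof (rule tendsto_sandwich)
  show "eventually (\<lambda>j. x - (1 / 2) ^ j \<le> real_of_int \<lfloor>2 ^ j * x\<rfloor> / 2 ^ j) sequentially"
  proof (rule always_eventually, rule allI)
    fix j
    have "2 ^ j * x - 1 \<le> real_of_int \<lfloor>2 ^ j * x\<rfloor>" by linarith
    then have "(2 ^ j * x - 1) / 2 ^ j \<le> real_of_int \<lfloor>2 ^ j * x\<rfloor> / 2 ^ j"
      by (rule divide_right_mono) simp
    then show "x - (1 / 2) ^ j \<le> real_of_int \<lfloor>2 ^ j * x\<rfloor> / 2 ^ j"
      by (simp add: diff_divide_distrib power_one_over)
  qed
  show "eventually (\<lambda>j. real_of_int \<lfloor>2 ^ j * x\<rfloor> / 2 ^ j \<le> x) sequentially"
    by (rule always_eventually) (simp add: pos_divide_le_eq mult.commute)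
  have "(\<lambda>j. x - (1 / 2) ^ j) \<longlonglongrightarrow> x - 0" by (intro tendsto_intros LIMSEQ_power_zero) simp
  then show "(\<lambda>j. x - (1 / 2) ^ j) \<longlonglongrightarrow> x" by simp
qed simp

text \<open>Truncate, approximate the bounded function almost everywhere by continuous ones, and sample the
  continuous function at the left endpoints of the cells; each step converges by dominated
  convergence.\<close>

lemma dyadic_step_dense:
  fixes G :: "real \<Rightarrow> real"
  assumes G: "integrable Omega G" and e: "0 < e"
  shows "\<exists>n0. \<forall>n\<ge>n0. \<exists>\<phi>. dyadic_step n \<phi> \<and> (LINT x|Omega. \<bar>G x - \<phi> x\<bar>) < e"
proof -
  define cl where "cl = (\<lambda>B t :: real. max (- B) (min B t))"
  have cl_m [measurable]: "cl B \<in> borel_measurable borel" for B unfolding cl_def by measurable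
  have cl_bound: "\<bar>cl B t\<bar> \<le> B" if "0 \<le> B" for B t using that by (auto simp: cl_def)
  have cl_cont: "isCont (cl B) t" for B t unfolding cl_def by (intro continuous_intros)
  have Gm: "G \<in> borel_measurable Omega" using G by simp
  have clm: "(\<lambda>x. cl B (u x)) \<in> borel_measurable Omega" if "u \<in> borel_measurable Omega" for B u
    by (rule measurable_compose[OF that cl_m])
  have cli: "integrable Omega (\<lambda>x. cl B (u x))" if "u \<in> borel_measurable Omega" "0 \<le> B" for B u
    by (rule Omega.integrable_const_bound[of _ B]) (use that cl_bound clm in auto)
  have "\<exists>n0. \<forall>n\<ge>n0. (LINT x|Omega. \<bar>G x - cl (real n) (G x)\<bar>) < e / 3"
  proof (rule eventually_L1_small[of _ "\<lambda>x. \<bar>G x\<bar>"])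
    show "AE x in Omega. (\<lambda>n. G x - cl (real n) (G x)) \<longlonglongrightarrow> 0"
    proof (rule AE_I2, rule tendsto_eventually)
      fix x
      obtain n0 :: nat where "\<bar>G x\<bar> \<le> real n0" using real_arch_simple by blast
      then show "eventually (\<lambda>n. G x - cl (real n) (G x) = 0) sequentially"
        unfolding eventually_sequentially by (intro exI[of _ n0]) (auto simp: cl_def)
    qed
  qed (use G e clm[OF Gm] in \<open>auto simp: cl_def\<close>)
  then obtain n1 where n1: "(LINT x|Omega. \<bar>G x - cl (real n1) (G x)\<bar>) < e / 3" by blast
  define B where "B = real n1"
  have B: "0 \<le> B" by (simp add: B_def)
  have "G measurable_on {0..<1}"
    using Gm unfolding Omega_def by (subst measurable_on_iff_borel_measurable) auto
  then obtain N :: "real set" and c where N: "negligible N" and c: "\<And>n. continuous_on UNIV (c n)"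
    and lim: "\<And>x. x \<notin> N \<Longrightarrow> (\<lambda>n. c n x) \<longlonglongrightarrow> (if x \<in> {0..<1} then G x else 0)"
    unfolding measurable_on_def by blast
  have cm: "c n \<in> borel_measurable borel" for n
    by (rule borel_measurable_continuous_onI) (rule c)
  have AEN: "AE x in Omega. x \<notin> N"
  proof -
    have "AE x in lebesgue. x \<notin> N" using N by (intro AE_not_in) (simp add: negligible_iff_null_sets)
    then show ?thesis unfolding Omega_def by (subst AE_restrict_space_iff) (auto elim: eventually_mono)
  qed
  have "\<exists>n0. \<forall>n\<ge>n0. (LINT x|Omega. \<bar>cl B (G x) - cl B (c n x)\<bar>) < e / 3"
  proof (rule eventually_L1_small[of _ "\<lambda>x. 2 * B"])
    show "AE x in Omega. (\<lambda>n. cl B (G x) - cl B (c n x)) \<longlonglongrightarrow> 0"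
      using AEN AE_space
    proof eventually_elim
      case (elim x)
      then have "(\<lambda>n. c n x) \<longlonglongrightarrow> G x" using lim[of x] by simp
      then have "(\<lambda>n. cl B (c n x)) \<longlonglongrightarrow> cl B (G x)" by (rule isCont_tendsto_compose[OF cl_cont])
      then have "(\<lambda>n. cl B (G x) - cl B (c n x)) \<longlonglongrightarrow> cl B (G x) - cl B (G x)"
        by (intro tendsto_diff tendsto_const)
      then show ?case by simp
    qed
    show "\<bar>cl B (G x) - cl B (c n x)\<bar> \<le> 2 * B" for n x
      using cl_bound[OF B, of "G x"] cl_bound[OF B, of "c n x"] by linarith
    show "(\<lambda>x. cl B (G x) - cl B (c n x)) \<in> borel_measurable Omega" for n
      by (intro borel_measurable_diff clm Gm borel_measurable_Omega cm)
  qed (use e in auto)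
  then obtain n2 where n2: "(LINT x|Omega. \<bar>cl B (G x) - cl B (c n2 x)\<bar>) < e / 3" by blast
  define v where "v = (\<lambda>x. cl B (c n2 x))"
  define \<phi> where "\<phi> = (\<lambda>j (x::real). v (real_of_int \<lfloor>2 ^ j * x\<rfloor> / 2 ^ j))"
  have vcont: "isCont v x" for x
    unfolding v_def using c[of n2]
    by (intro isCont_o2[OF _ cl_cont]) (simp add: continuous_on_eq_continuous_at)
  have step: "dyadic_step j (\<phi> j)" for j unfolding dyadic_step_def \<phi>_def cell_def by simp
  have vm: "v \<in> borel_measurable Omega"
    unfolding v_def by (intro clm borel_measurable_Omega cm)
  have vb: "\<bar>v x\<bar> \<le> B" for x unfolding v_def by (rule cl_bound[OF B])
  have "\<exists>n0. \<forall>n\<ge>n0. (LINT x|Omega. \<bar>v x - \<phi> n x\<bar>) < e / 3"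
  proof (rule eventually_L1_small[of _ "\<lambda>x. 2 * B"])
    show "AE x in Omega. (\<lambda>n. v x - \<phi> n x) \<longlonglongrightarrow> 0"
    proof (rule AE_I2)
      fix x
      have "(\<lambda>n. \<phi> n x) \<longlonglongrightarrow> v x"
        unfolding \<phi>_def by (rule isCont_tendsto_compose[OF vcont dyadic_left_endpoint_tendsto])
      then have "(\<lambda>n. v x - \<phi> n x) \<longlonglongrightarrow> v x - v x" by (intro tendsto_diff tendsto_const)
      then show "(\<lambda>n. v x - \<phi> n x) \<longlonglongrightarrow> 0" by simp
    qed
    show "\<bar>v x - \<phi> n x\<bar> \<le> 2 * B" for n x
      using vb[of x] vb[of "real_of_int \<lfloor>2 ^ n * x\<rfloor> / 2 ^ n"] unfolding \<phi>_def by linarith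
    show "(\<lambda>x. v x - \<phi> n x) \<in> borel_measurable Omega" for n
      by (intro borel_measurable_diff vm dyadic_step_measurable[OF step])
  qed (use e in auto)
  then obtain n3 where n3: "\<And>n. n3 \<le> n \<Longrightarrow> (LINT x|Omega. \<bar>v x - \<phi> n x\<bar>) < e / 3" by blast
  show ?thesis
  proof (intro exI[of _ n3] allI impI exI conjI)
    fix n assume n: "n3 \<le> n"
    show "dyadic_step n (\<phi> n)" by (rule step)
    have i: "integrable Omega (\<lambda>x. cl B (G x))" "integrable Omega v" "integrable Omega (\<phi> n)"
      using cli[OF Gm B] cli[OF borel_measurable_Omega[OF cm] B] dyadic_step_integrable[OF step]
      by (auto simp: v_def)
    have "(LINT x|Omega. \<bar>G x - \<phi> n x\<bar>) \<le> (LINT x|Omega. \<bar>G x - cl B (G x)\<bar>)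
        + ((LINT x|Omega. \<bar>cl B (G x) - v x\<bar>) + (LINT x|Omega. \<bar>v x - \<phi> n x\<bar>))"
      by (rule order_trans[OF L1_triangle[OF G i(1) i(3)] add_left_mono[OF L1_triangle[OF i]]])
    also have "\<dots> < e"
      using n1 n2 n3[OF n] unfolding B_def[symmetric] v_def by linarith
    finally show "(LINT x|Omega. \<bar>G x - \<phi> n x\<bar>) < e" .
  qed
qed

lemma real_cond_exp_L1_contraction:
  assumes u: "integrable Omega u"
  shows "(LINT x|Omega. \<bar>real_cond_exp Omega (dyadic_sigma n) u x\<bar>) \<le> (LINT x|Omega. \<bar>u x\<bar>)"
proof -
  interpret sigma_finite_subalgebra Omega "dyadic_sigma n" by (rule sigma_finite_dyadic_sigma)
  have um: "u \<in> borel_measurable Omega" using u by simp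
  then have uam: "(\<lambda>x. ennreal \<bar>u x\<bar>) \<in> borel_measurable Omega" by simp
  have "ennreal (LINT x|Omega. \<bar>real_cond_exp Omega (dyadic_sigma n) u x\<bar>) =
     (\<integral>\<^sup>+ x. ennreal \<bar>real_cond_exp Omega (dyadic_sigma n) u x\<bar> \<partial>Omega)"
    using real_cond_exp_int(1)[OF u] by (subst nn_integral_eq_integral) auto
  also have "\<dots> \<le> (\<integral>\<^sup>+ x. nn_cond_exp Omega (dyadic_sigma n) (\<lambda>x. ennreal \<bar>u x\<bar>) x \<partial>Omega)"
    by (rule nn_integral_mono_AE) (rule real_cond_exp_abs[OF um])
  also have "\<dots> = (\<integral>\<^sup>+ x. ennreal \<bar>u x\<bar> \<partial>Omega)"
    using nn_cond_exp_intg[of "\<lambda>x. 1", OF _ uam] by simp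
  also have "\<dots> = ennreal (LINT x|Omega. \<bar>u x\<bar>)"
    using u by (subst nn_integral_eq_integral) auto
  finally show ?thesis by (simp add: ennreal_le_iff Bochner_Integration.integral_nonneg)
qed

text \<open>Conditional expectation contracts the \<open>L\<^sub>1\<close>-norm and fixes step functions, which are dense.\<close>

lemma cond_exp_tendsto_L1:
  assumes G: "integrable Omega G"
  shows "(\<lambda>n. LINT x|Omega. \<bar>real_cond_exp Omega (dyadic_sigma n) G x - G x\<bar>) \<longlonglongrightarrow> 0"
proof (rule LIMSEQ_I)
  fix e :: real assume "0 < e"
  then obtain n0 where n0: "\<And>n. n0 \<le> n \<Longrightarrow> \<exists>\<phi>. dyadic_step n \<phi> \<and> (LINT x|Omega. \<bar>G x - \<phi> x\<bar>) < e / 2"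
    using dyadic_step_dense[OF G, of "e / 2"] by auto
  show "\<exists>n0. \<forall>n\<ge>n0. norm ((LINT x|Omega. \<bar>real_cond_exp Omega (dyadic_sigma n) G x - G x\<bar>) - 0) < e"
  proof (intro exI[of _ n0] allI impI)
    fix n assume "n0 \<le> n"
    then obtain \<phi> where \<phi>: "dyadic_step n \<phi>" and close: "(LINT x|Omega. \<bar>G x - \<phi> x\<bar>) < e / 2"
      using n0 by blast
    interpret sigma_finite_subalgebra Omega "dyadic_sigma n" by (rule sigma_finite_dyadic_sigma)
    let ?E = "real_cond_exp Omega (dyadic_sigma n)"
    have i\<phi>: "integrable Omega \<phi>" by (rule dyadic_step_integrable[OF \<phi>])
    have E\<phi>: "AE x in Omega. ?E \<phi> x = \<phi> x"
      by (rule real_cond_exp_F_meas[OF i\<phi>]) (simp add: dyadic_sigma_measurable_iff \<phi>)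
    have "(LINT x|Omega. \<bar>?E G x - \<phi> x\<bar>) = (LINT x|Omega. \<bar>?E (\<lambda>x. G x - \<phi> x) x\<bar>)"
    proof (rule integral_cong_AE)
      show "AE x in Omega. \<bar>?E G x - \<phi> x\<bar> = \<bar>?E (\<lambda>x. G x - \<phi> x) x\<bar>"
        using E\<phi> real_cond_exp_diff[OF G i\<phi>] by eventually_elim simp
    qed (use real_cond_exp_int(1)[OF G] i\<phi> in auto)
    also have "\<dots> \<le> (LINT x|Omega. \<bar>G x - \<phi> x\<bar>)"
      by (rule real_cond_exp_L1_contraction) (use G i\<phi> in auto)
    finally have 1: "(LINT x|Omega. \<bar>?E G x - \<phi> x\<bar>) < e / 2" using close by linarith
    have 2: "(LINT x|Omega. \<bar>\<phi> x - G x\<bar>) < e / 2" using close by (simp add: abs_minus_commute)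
    have "(LINT x|Omega. \<bar>?E G x - G x\<bar>) < e"
      using L1_triangle[OF real_cond_exp_int(1)[OF G] i\<phi> G] 1 2 by linarith
    then show "norm ((LINT x|Omega. \<bar>?E G x - G x\<bar>) - 0) < e"
      by (simp add: Bochner_Integration.integral_nonneg)
  qed
qed

section \<open>Convergence in the modular\<close>

lemma abs_add_powr_le:
  fixes a b q :: real
  assumes "0 < q"
  shows "\<bar>a + b\<bar> powr q \<le> 2 powr q * (\<bar>a\<bar> powr q + \<bar>b\<bar> powr q)"
proof -
  define c where "c = max \<bar>a\<bar> \<bar>b\<bar>"
  have "\<bar>a + b\<bar> powr q \<le> (2 * c) powr q"
    using assms by (intro powr_mono2) (auto simp: c_def)
  also have "\<dots> = 2 powr q * c powr q" by (simp add: powr_mult c_def)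
  also have "c powr q \<le> \<bar>a\<bar> powr q + \<bar>b\<bar> powr q" by (simp add: c_def max_def)
  finally show ?thesis by (simp add: mult_left_mono)
qed

lemma ennreal_real_between:
  assumes "0 < (a::ennreal)"
  obtains e :: real where "0 < e" "ennreal e < a"
proof -
  obtain c where c: "0 < c" "c < a" using dense[OF assms] by blast
  then have "c < top" by (metis less_le_trans top_greatest)
  then obtain e where "c = ennreal e" "0 \<le> e" by (cases c) auto
  then show ?thesis using c that[of e] by simp
qed

text \<open>The estimates for the index \<open>n\<close> are organised by the block \<open>2 ^ m \<le> n < 2 ^ Suc m\<close> that
  contains \<open>n\<close>.\<close>

lemma tendsto_zero_dyadic_blocks:
  fixes X :: "nat \<Rightarrow> ennreal"
  assumes "\<And>e::real. 0 < e \<Longrightarrow> \<exists>m0. \<forall>m\<ge>m0. \<forall>n. 2 ^ m \<le> n \<and> n < 2 ^ Suc m \<longrightarrow> X n \<le> ennreal e"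
  shows "X \<longlonglongrightarrow> 0"
proof (rule order_tendstoI)
  fix a :: ennreal assume "0 < a"
  then obtain e :: real where e: "0 < e" "ennreal e < a" by (rule ennreal_real_between)
  then obtain m0 where m0: "\<And>m n. m0 \<le> m \<Longrightarrow> 2 ^ m \<le> n \<Longrightarrow> n < 2 ^ Suc m \<Longrightarrow> X n \<le> ennreal e"
    using assms[OF e(1)] by blast
  have "X n < a" if n: "2 ^ m0 \<le> n" for n
  proof -
    have "1 \<le> n" using n by (metis le_trans one_le_numeral one_le_power)
    then obtain m where m: "2 ^ m \<le> n" "n < 2 ^ Suc m" using ex_power_ivl1[of 2 n] by auto
    have "(2::nat) ^ m0 < 2 ^ Suc m" using n m(2) by linarith
    then have "m0 < Suc m" by (rule power_less_imp_less_exp[rotated]) simp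
    then have "X n \<le> ennreal e" by (intro m0[OF _ m]) simp
    then show ?thesis using e(2) by (rule le_less_trans)
  qed
  then show "eventually (\<lambda>n. X n < a) sequentially" unfolding eventually_sequentially by blast
qed simp

lemma cell_avg_scale: "cell_avg i (\<lambda>y. c * h y) x = c * cell_avg i h x"
proof -
  have "(LINT y|Omega. indicator (cell i x) y * (c * h y)) = c * (LINT y|Omega. indicator (cell i x) y * h y)"
    by (subst integral_mult_right_zero[symmetric]) (simp add: mult.left_commute)
  then show ?thesis by (simp add: cell_avg_def)
qed

lemma shift_op_scale: "shift_op m J (\<lambda>y. c * h y) x = c * shift_op m J h x"
  unfolding shift_op_def cell_avg_scale by (simp add: sum_distrib_left mult_ac)

lemma shift_op_measurable: "shift_op m J h \<in> borel_measurable Omega"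
proof (rule borel_measurable_Omega)
  show "shift_op m J h \<in> borel_measurable borel" unfolding shift_op_def[abs_def] by measurable
qed

text \<open>A flip of a digit from \<open>k\<close> on stays inside the cell of level \<open>k\<close>, and so do the cells of
  higher level around the flipped point. The corresponding part of the operator therefore sees the
  function on that cell only.\<close>

lemma shift_op_localize:
  assumes "k \<le> m" "x \<in> cell k z"
  shows "shift_op m {..m} h x =
    shift_op m {..<k} h x + shift_op m {k..m} (\<lambda>y. h y * indicator (cell k z) y) x"
proof -
  have "shift_op m {..m} h x = shift_op m {..<k} h x + shift_op m {k..m} h x"
  proof -
    have "{..m} = {..<k} \<union> {k..m}" using assms by auto
    then show ?thesis unfolding shift_op_def by (simp only: ) (rule sum.union_disjoint, auto)
  qed
  also have "shift_op m {k..m} h x = shift_op m {k..m} (\<lambda>y. h y * indicator (cell k z) y) x"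
    unfolding shift_op_def
  proof (intro sum.cong arg_cong[where f="(*) _"] refl cell_avg_cong)
    fix j i y assume ji: "j \<in> {k..m}" "i \<in> {j..m}" and y: "y \<in> cell i (flip j x)"
    have "y \<in> cell k (flip j x)" using cell_antimono[of k i "flip j x"] ji y by auto
    also have "cell k (flip j x) = cell k z" using cell_flip[of k j x] cell_eq[OF assms(2)] ji by simp
    finally show "h y = h y * indicator (cell k z) y" by simp
  qed
  finally show ?thesis .
qed

context dyadic_exponent
begin

lemma modular_integrand_measurable:
  assumes "h \<in> borel_measurable Omega"
  shows "(\<lambda>x. ennreal (\<bar>h x\<bar> powr p x)) \<in> borel_measurable Omega"
  using assms p_measurable by simp

lemma modular_mono:
  assumes "AE x in Omega. \<bar>h x\<bar> \<le> \<bar>h' x\<bar>"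
  shows "modular p h \<le> modular p h'"
  unfolding modular_def
proof (rule nn_integral_mono_AE)
  show "AE x in Omega. ennreal (\<bar>h x\<bar> powr p x) \<le> ennreal (\<bar>h' x\<bar> powr p x)"
    using assms AE_p_bounds
  proof eventually_elim
    case (elim x)
    then show ?case using pm by (intro ennreal_leI powr_mono2) auto
  qed
qed

lemma modular_scale:
  assumes h: "h \<in> borel_measurable Omega" and c: "0 \<le> c"
    and a: "AE x in Omega. c powr p x \<le> a"
  shows "modular p (\<lambda>x. c * h x) \<le> ennreal a * modular p h"
proof -
  have "modular p (\<lambda>x. c * h x) \<le> (\<integral>\<^sup>+ x. ennreal a * ennreal (\<bar>h x\<bar> powr p x) \<partial>Omega)"
    unfolding modular_def
  proof (rule nn_integral_mono_AE)
    show "AE x in Omega. ennreal (\<bar>c * h x\<bar> powr p x) \<le> ennreal a * ennreal (\<bar>h x\<bar> powr p x)"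
      using a
    proof eventually_elim
      case (elim x)
      have "0 \<le> a" using elim powr_ge_zero[of c "p x"] by linarith
      have "\<bar>c * h x\<bar> powr p x = c powr p x * \<bar>h x\<bar> powr p x" using c by (simp add: abs_mult powr_mult)
      also have "\<dots> \<le> a * \<bar>h x\<bar> powr p x" using elim by (intro mult_right_mono) auto
      finally show ?case using \<open>0 \<le> a\<close> by (subst ennreal_mult[symmetric]) (auto intro: ennreal_leI)
    qed
  qed
  also have "\<dots> = ennreal a * modular p h"
    unfolding modular_def by (rule nn_integral_cmult[OF modular_integrand_measurable[OF h]])
  finally show ?thesis .
qed

lemma modular_scale_up:
  assumes "h \<in> borel_measurable Omega" "1 \<le> c"
  shows "modular p (\<lambda>x. c * h x) \<le> ennreal (c powr pp) * modular p h"
proof (rule modular_scale[OF assms(1)])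
  show "AE x in Omega. c powr p x \<le> c powr pp"
    using AE_p_bounds by eventually_elim (use assms in \<open>auto intro!: powr_mono\<close>)
qed (use assms in auto)

lemma modular_scale_down:
  assumes "h \<in> borel_measurable Omega" "0 \<le> c" "c \<le> 1"
  shows "modular p (\<lambda>x. c * h x) \<le> ennreal (c powr pm) * modular p h"
proof (rule modular_scale[OF assms(1)])
  show "AE x in Omega. c powr p x \<le> c powr pm"
    using AE_p_bounds by eventually_elim (use assms in \<open>auto intro!: powr_mono'\<close>)
qed (use assms in auto)

lemma modular_add:
  assumes "a \<in> borel_measurable Omega" "b \<in> borel_measurable Omega"
  shows "modular p (\<lambda>x. a x + b x) \<le> ennreal (2 powr pp) * (modular p a + modular p b)"
proof -
  note m = modular_integrand_measurable[OF assms(1)] modular_integrand_measurable[OF assms(2)]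
  have "modular p (\<lambda>x. a x + b x) \<le>
     (\<integral>\<^sup>+ x. ennreal (2 powr pp) * (ennreal (\<bar>a x\<bar> powr p x) + ennreal (\<bar>b x\<bar> powr p x)) \<partial>Omega)"
    unfolding modular_def
  proof (rule nn_integral_mono_AE)
    show "AE x in Omega. ennreal (\<bar>a x + b x\<bar> powr p x) \<le>
       ennreal (2 powr pp) * (ennreal (\<bar>a x\<bar> powr p x) + ennreal (\<bar>b x\<bar> powr p x))"
      using AE_p_bounds
    proof eventually_elim
      case (elim x)
      have "\<bar>a x + b x\<bar> powr p x \<le> 2 powr p x * (\<bar>a x\<bar> powr p x + \<bar>b x\<bar> powr p x)"
        using elim pm by (intro abs_add_powr_le) auto
      also have "\<dots> \<le> 2 powr pp * (\<bar>a x\<bar> powr p x + \<bar>b x\<bar> powr p x)"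
        using elim by (intro mult_right_mono) auto
      finally have "ennreal (\<bar>a x + b x\<bar> powr p x) \<le> ennreal (2 powr pp * (\<bar>a x\<bar> powr p x + \<bar>b x\<bar> powr p x))"
        by (rule ennreal_leI)
      then show ?case by (simp add: ennreal_mult)
    qed
  qed
  also have "\<dots> = ennreal (2 powr pp) * (modular p a + modular p b)"
    unfolding modular_def
    by (simp only: nn_integral_cmult[OF borel_measurable_add[OF m]] nn_integral_add[OF m])
  finally show ?thesis .
qed

text \<open>The constant in the quasi-triangle inequality for four summands.\<close>

definition quasi_triangle_const :: real where "quasi_triangle_const = 2 powr pp * 2 powr pp"

lemma quasi_triangle_const_pos: "0 < quasi_triangle_const"
  by (simp add: quasi_triangle_const_def)

lemma modular_add4:
  assumes m: "a \<in> borel_measurable Omega" "b \<in> borel_measurable Omega"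
      "c \<in> borel_measurable Omega" "d \<in> borel_measurable Omega"
    and le: "AE x in Omega. \<bar>u x\<bar> \<le> \<bar>a x\<bar> + \<bar>b x\<bar> + \<bar>c x\<bar> + \<bar>d x\<bar>"
    and small: "modular p a \<le> t" "modular p b \<le> t" "modular p c \<le> t" "modular p d \<le> t"
  shows "modular p u \<le> ennreal quasi_triangle_const * (4 * t)"
proof -
  have absm: "modular p (\<lambda>x. \<bar>h x\<bar>) = modular p h" for h by (simp add: modular_def)
  have pair: "modular p (\<lambda>x. \<bar>v x\<bar> + \<bar>w x\<bar>) \<le> ennreal (2 powr pp) * (t + t)"
    if "v \<in> borel_measurable Omega" "w \<in> borel_measurable Omega" "modular p v \<le> t" "modular p w \<le> t"
    for v w
  proof -
    have "modular p (\<lambda>x. \<bar>v x\<bar> + \<bar>w x\<bar>) \<le>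
        ennreal (2 powr pp) * (modular p (\<lambda>x. \<bar>v x\<bar>) + modular p (\<lambda>x. \<bar>w x\<bar>))"
      by (rule modular_add) (use that in auto)
    also have "\<dots> \<le> ennreal (2 powr pp) * (t + t)"
      unfolding absm by (intro mult_left_mono add_mono that) auto
    finally show ?thesis .
  qed
  have "modular p u \<le> modular p (\<lambda>x. (\<bar>a x\<bar> + \<bar>b x\<bar>) + (\<bar>c x\<bar> + \<bar>d x\<bar>))"
    by (rule modular_mono) (use le in \<open>auto elim!: eventually_mono\<close>)
  also have "\<dots> \<le> ennreal (2 powr pp) * (modular p (\<lambda>x. \<bar>a x\<bar> + \<bar>b x\<bar>) + modular p (\<lambda>x. \<bar>c x\<bar> + \<bar>d x\<bar>))"
    by (rule modular_add) (use m in auto)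
  also have "\<dots> \<le> ennreal (2 powr pp) * (ennreal (2 powr pp) * (t + t) + ennreal (2 powr pp) * (t + t))"
    by (intro mult_left_mono add_mono pair m small) auto
  also have "\<dots> = ennreal quasi_triangle_const * (4 * t)"
  proof -
    have "c * (c * (t + t) + c * (t + t)) = (c * c) * (4 * t)" for c :: ennreal
    proof -
      have "(4::ennreal) = (1 + 1) + (1 + 1)" by simp
      then have "4 * t = (t + t) + (t + t)" by (simp only: distrib_right mult_1)
      then show ?thesis by (simp only: distrib_left mult.assoc)
    qed
    then show ?thesis by (simp add: quasi_triangle_const_def ennreal_mult)
  qed
  finally show ?thesis .
qed

text \<open>Convergence in the mean gives almost everywhere convergence along a subsequence of any given
  subsequence, to which dominated convergence applies.\<close>

lemma modular_tendsto_0: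
  fixes u :: "nat \<Rightarrow> real \<Rightarrow> real"
  assumes u: "\<And>n. integrable Omega (u n)" and L1: "(\<lambda>n. LINT x|Omega. \<bar>u n x\<bar>) \<longlonglongrightarrow> 0"
    and W: "W \<in> borel_measurable Omega" "(\<integral>\<^sup>+ x. W x \<partial>Omega) < \<infinity>"
    and bound: "\<And>n. AE x in Omega. ennreal (\<bar>u n x\<bar> powr p x) \<le> W x"
  shows "(\<lambda>n. modular p (u n)) \<longlonglongrightarrow> 0"
proof (rule ccontr)
  assume "\<not> ?thesis"
  then obtain a where a: "0 < a" "\<not> eventually (\<lambda>n. modular p (u n) < a) sequentially"
    using order_tendstoI[of 0 "\<lambda>n. modular p (u n)" sequentially] by (metis not_less_zero)
  have "infinite {n. a \<le> modular p (u n)}"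
  proof
    assume "finite {n. a \<le> modular p (u n)}"
    then obtain b where "\<And>n. a \<le> modular p (u n) \<Longrightarrow> n \<le> b"
      by (auto simp: finite_nat_set_iff_bounded_le)
    then have "\<forall>n\<ge>Suc b. modular p (u n) < a" by (metis not_less not_less_eq_eq)
    then show False using a(2) unfolding eventually_sequentially by blast
  qed
  then have "\<exists>r::nat \<Rightarrow> nat. strict_mono r \<and> (\<forall>n. r n \<in> {n. a \<le> modular p (u n)})"
    by (rule infinite_enumerate)
  then obtain r :: "nat \<Rightarrow> nat" where r: "strict_mono r" "\<And>n. a \<le> modular p (u (r n))"
    by blast
  have "(\<lambda>n. LINT x|Omega. norm (u (r n) x)) \<longlonglongrightarrow> 0"
    using LIMSEQ_subseq_LIMSEQ[OF L1 r(1)] by (simp add: o_def)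
  from tendsto_L1_AE_subseq[OF u this]
  obtain s where s: "strict_mono s" and lim: "AE x in Omega. (\<lambda>n. u (r (s n)) x) \<longlonglongrightarrow> 0"
    by blast
  have "(\<lambda>n. \<integral>\<^sup>+ x. ennreal (\<bar>u (r (s n)) x\<bar> powr p x) \<partial>Omega) \<longlonglongrightarrow> (\<integral>\<^sup>+ x. 0 \<partial>Omega)"
  proof (rule nn_integral_dominated_convergence[OF _ _ W(1) bound W(2)])
    show "AE x in Omega. (\<lambda>n. ennreal (\<bar>u (r (s n)) x\<bar> powr p x)) \<longlonglongrightarrow> 0"
      using lim AE_p_bounds
    proof eventually_elim
      case (elim x)
      have "(\<lambda>n. \<bar>u (r (s n)) x\<bar> powr p x) \<longlonglongrightarrow> 0 powr p x"
        by (rule tendsto_powr') (use elim pm in \<open>auto intro: tendsto_rabs_zero\<close>)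
      then have "(\<lambda>n. ennreal (\<bar>u (r (s n)) x\<bar> powr p x)) \<longlonglongrightarrow> ennreal 0"
        by (intro tendsto_ennrealI) simp
      then show ?case by simp
    qed
    show "(\<lambda>x. ennreal (\<bar>u (r (s n)) x\<bar> powr p x)) \<in> borel_measurable Omega" for n
      using u by (intro modular_integrand_measurable) auto
  qed simp
  then have "eventually (\<lambda>n. modular p (u (r (s n))) < a) sequentially"
    using a(1) unfolding modular_def[symmetric] by (intro order_tendstoD) auto
  then obtain n where "modular p (u (r (s n))) < a" unfolding eventually_sequentially by blast
  then show False using r(2)[of "s n"] by simp
qed

lemma decay_sum_tendsto: "(\<lambda>m. \<Sum>j<k. decay (m - j)) \<longlonglongrightarrow> 0"
proof (rule tendsto_null_sum)
  fix j
  show "(\<lambda>m. decay (m - j)) \<longlonglongrightarrow> 0"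
    by (rule LIMSEQ_offset[where k=j]) (use summable_LIMSEQ_zero[OF summable_decay] in simp)
qed

text \<open>A uniform bound for the modular becomes the bound \<open>1\<close> required by \<open>modular_shift_op\<close> after
  division by a constant that serves all functions at once.\<close>

lemma modular_normalize:
  assumes "D < \<infinity>"
  obtains L where "1 \<le> L"
    "\<And>v. v \<in> borel_measurable Omega \<Longrightarrow> modular p v \<le> D \<Longrightarrow> modular p (\<lambda>x. 1 / L * v x) \<le> 1"
proof -
  obtain d where d: "D = ennreal d" "0 \<le> d" using assms by (cases D) auto
  \<comment> \<open>Dividing by \<open>L \<ge> 1\<close> gains at least \<open>L powr pm\<close>, so \<open>L powr pm \<ge> d\<close> is what is needed.\<close>
  define L where "L = max 1 (d powr (1 / pm))"
  have L: "1 \<le> L" by (simp add: L_def)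
  have "d \<le> L powr pm"
  proof (cases "d = 0")
    case False
    then have "d = (d powr (1 / pm)) powr pm" using d pm by (simp add: powr_powr)
    also have "\<dots> \<le> L powr pm" using pm by (intro powr_mono2) (auto simp: L_def)
    finally show ?thesis .
  qed simp
  then have le: "(1 / L) powr pm * d \<le> 1" using L by (simp add: powr_divide)
  show ?thesis
  proof (rule that[OF L])
    fix v assume v: "v \<in> borel_measurable Omega" "modular p v \<le> D"
    have "modular p (\<lambda>x. 1 / L * v x) \<le> ennreal ((1 / L) powr pm) * modular p v"
      by (rule modular_scale_down[OF v(1)]) (use L in auto)
    also have "\<dots> \<le> ennreal ((1 / L) powr pm) * ennreal d"
      using v(2) d by (intro mult_left_mono) auto
    also have "\<dots> = ennreal ((1 / L) powr pm * d)" using d by (simp add: ennreal_mult)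
    also have "\<dots> \<le> 1" using le by simp
    finally show "modular p (\<lambda>x. 1 / L * v x) \<le> 1" .
  qed
qed

lemma small_powr:
  assumes "0 < t" "0 \<le> c"
  obtains d where "0 < d" "d \<le> 1" "d powr pm * c \<le> t"
proof -
  define d where "d = min 1 ((t / (c + 1)) powr (1 / pm))"
  have "d powr pm \<le> ((t / (c + 1)) powr (1 / pm)) powr pm"
    using pm assms by (intro powr_mono2) (auto simp: d_def)
  also have "\<dots> = t / (c + 1)" using pm assms by (simp add: powr_powr)
  finally have "d powr pm * c \<le> t / (c + 1) * c" using assms by (intro mult_right_mono)
  also have "\<dots> \<le> t" using assms by (simp add: field_simps)
  finally have "d powr pm * c \<le> t" .
  then show ?thesis using assms by (intro that[of d]) (auto simp: d_def)
qed

lemma ennreal_quasi_triangle_const: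
  assumes "0 \<le> t" shows "ennreal quasi_triangle_const * (4 * ennreal t) = ennreal (quasi_triangle_const * (4 * t))"
proof -
  have "ennreal (4 * t) = 4 * ennreal t" using assms by (subst ennreal_mult) auto
  then show ?thesis using assms quasi_triangle_const_pos by (subst ennreal_mult) auto
qed

text \<open>On the cell the martingale consists of conditional expectations of \<open>g\<close>, so it converges to
  \<open>g\<close> in the mean. The dominating function \<open>W\<close> bounds \<open>\<bar>f n\<bar>\<close> and hence, along a subsequence
  converging almost everywhere, also \<open>\<bar>g\<bar>\<close>. This upgrades the convergence to the modular.\<close>

lemma restriction_modular_tendsto:
  assumes f: "dyadic_martingale f"
    and G: "integrable Omega (\<lambda>x. g x * indicator (cell k z) x)"
    and gen: "\<And>n. k \<le> n \<Longrightarrow> AE x in Omega. f n x * indicator (cell k z) x =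
        real_cond_exp Omega (dyadic_sigma n) (\<lambda>y. g y * indicator (cell k z) y) x"
    and W: "W \<in> borel_measurable Omega" "(\<integral>\<^sup>+ x. W x \<partial>Omega) < \<infinity>"
    and bound: "\<And>n. AE x in Omega. ennreal (\<bar>f n x\<bar> powr p x) \<le> W x"
  shows "(\<lambda>n. modular p (\<lambda>x. f n x * indicator (cell k z) x - g x * indicator (cell k z) x)) \<longlonglongrightarrow> 0"
proof -
  define G' where "G' = (\<lambda>x. g x * indicator (cell k z) x)"
  define u where "u = (\<lambda>n x. f n x * indicator (cell k z) x - G' x)"
  have Gi: "integrable Omega G'" using G by (simp add: G'_def)
  have fi: "integrable Omega (\<lambda>x. f n x * indicator (cell k z) x)" for n
    using integrable_cell[OF dyadic_step_integrable[OF martingale_step[OF f, of n]] cell_borel[of k z]]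
    by (simp add: mult.commute)
  have ui: "integrable Omega (u n)" for n
    unfolding u_def by (rule Bochner_Integration.integrable_diff[OF fi Gi])
  have L1: "(\<lambda>n. LINT x|Omega. \<bar>u n x\<bar>) \<longlonglongrightarrow> 0"
  proof (rule Lim_transform_eventually[OF cond_exp_tendsto_L1[OF Gi]])
    have "(LINT x|Omega. \<bar>real_cond_exp Omega (dyadic_sigma n) G' x - G' x\<bar>) = (LINT x|Omega. \<bar>u n x\<bar>)"
      if n: "k \<le> n" for n
    proof (rule integral_cong_AE)
      interpret sigma_finite_subalgebra Omega "dyadic_sigma n" by (rule sigma_finite_dyadic_sigma)
      show "AE x in Omega. \<bar>real_cond_exp Omega (dyadic_sigma n) G' x - G' x\<bar> = \<bar>u n x\<bar>"
        using gen[OF n] unfolding G'_def[symmetric] by eventually_elim (simp add: u_def)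
      show "(\<lambda>x. \<bar>real_cond_exp Omega (dyadic_sigma n) G' x - G' x\<bar>) \<in> borel_measurable Omega"
        using real_cond_exp_int(1)[OF Gi] Gi by simp
    qed (use ui in simp)
    then show "eventually (\<lambda>n. (LINT x|Omega. \<bar>real_cond_exp Omega (dyadic_sigma n) G' x - G' x\<bar>) =
        (LINT x|Omega. \<bar>u n x\<bar>)) sequentially"
      unfolding eventually_sequentially by blast
  qed
  have ind: "\<bar>f n x * indicator (cell k z) x\<bar> \<le> \<bar>f n x\<bar>" for n x by (simp add: indicator_def)
  have Gb: "AE x in Omega. ennreal (\<bar>G' x\<bar> powr p x) \<le> W x"
  proof -
    have "(\<lambda>n. LINT x|Omega. norm (u n x)) \<longlonglongrightarrow> 0" using L1 by simp
    from tendsto_L1_AE_subseq[OF ui this] obtain r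
      where lim: "AE x in Omega. (\<lambda>n. u (r n) x) \<longlonglongrightarrow> 0" by blast
    have "AE x in Omega. \<forall>n. ennreal (\<bar>f n x\<bar> powr p x) \<le> W x"
      using bound by (simp add: AE_all_countable)
    with lim AE_p_bounds show ?thesis
    proof eventually_elim
      case (elim x)
      have "(\<lambda>n. u (r n) x + G' x) \<longlonglongrightarrow> 0 + G' x" by (intro tendsto_add elim(1) tendsto_const)
      then have "(\<lambda>n. f (r n) x * indicator (cell k z) x) \<longlonglongrightarrow> G' x" by (simp add: u_def)
      then have "(\<lambda>n. \<bar>f (r n) x * indicator (cell k z) x\<bar>) \<longlonglongrightarrow> \<bar>G' x\<bar>" by (rule tendsto_rabs)
      then have "(\<lambda>n. \<bar>f (r n) x * indicator (cell k z) x\<bar> powr p x) \<longlonglongrightarrow> \<bar>G' x\<bar> powr p x"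
        by (rule tendsto_powr') (use elim pm in auto)
      then have "(\<lambda>n. ennreal (\<bar>f (r n) x * indicator (cell k z) x\<bar> powr p x)) \<longlonglongrightarrow> ennreal (\<bar>G' x\<bar> powr p x)"
        by (rule tendsto_ennrealI)
      moreover have "ennreal (\<bar>f (r n) x * indicator (cell k z) x\<bar> powr p x) \<le> W x" for n
      proof -
        have "ennreal (\<bar>f (r n) x * indicator (cell k z) x\<bar> powr p x) \<le> ennreal (\<bar>f (r n) x\<bar> powr p x)"
          using elim pm ind by (intro ennreal_leI powr_mono2) auto
        also have "\<dots> \<le> W x" using elim by blast
        finally show ?thesis .
      qed
      ultimately show ?case
        using LIMSEQ_le_const2[of _ "ennreal (\<bar>G' x\<bar> powr p x)" "W x"] by blast
    qed
  qed
  have "(\<lambda>n. modular p (u n)) \<longlonglongrightarrow> 0"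
  proof (rule modular_tendsto_0[OF ui L1])
    show "(\<lambda>x. ennreal (2 powr pp) * (W x + W x)) \<in> borel_measurable Omega" using W(1) by simp
    show "(\<integral>\<^sup>+ x. ennreal (2 powr pp) * (W x + W x) \<partial>Omega) < \<infinity>"
      using W by (simp add: nn_integral_cmult nn_integral_add ennreal_mult_less_top)
    show "AE x in Omega. ennreal (\<bar>u n x\<bar> powr p x) \<le> ennreal (2 powr pp) * (W x + W x)" for n
      using Gb bound[of n] AE_p_bounds
    proof eventually_elim
      case (elim x)
      let ?a = "f n x * indicator (cell k z) x"
      have "\<bar>u n x\<bar> powr p x \<le> 2 powr p x * (\<bar>?a\<bar> powr p x + \<bar>G' x\<bar> powr p x)"
        using abs_add_powr_le[of "p x" ?a "- G' x"] elim pm by (simp add: u_def)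
      also have "\<dots> \<le> 2 powr pp * (\<bar>f n x\<bar> powr p x + \<bar>G' x\<bar> powr p x)"
        using elim pm ind by (intro mult_mono add_mono powr_mono powr_mono2 add_nonneg_nonneg) auto
      finally have "ennreal (\<bar>u n x\<bar> powr p x) \<le> ennreal (2 powr pp * (\<bar>f n x\<bar> powr p x + \<bar>G' x\<bar> powr p x))"
        by (rule ennreal_leI)
      also have "\<dots> = ennreal (2 powr pp) * (ennreal (\<bar>f n x\<bar> powr p x) + ennreal (\<bar>G' x\<bar> powr p x))"
        by (simp add: ennreal_mult)
      also have "\<dots> \<le> ennreal (2 powr pp) * (W x + W x)"
        by (intro mult_left_mono add_mono elim) auto
      finally show ?case .
    qed
  qed
  then show ?thesis unfolding u_def G'_def .
qed

text \<open>Almost everywhere on the cell,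
  \<open>\<bar>fejer_mean f n - g\<bar> \<le> \<bar>f m - g\<bar> + 2 ^ N * B / 2 ^ m + far + inner\<close>, where \<open>inner\<close> and \<open>far\<close>
  belong to flips that stay in the cell and flips that leave it. A suitable \<open>N\<close> makes \<open>h N m\<close>
  small on the cell for all \<open>m \<ge> N\<close>, and thereby \<open>inner\<close>. With \<open>N\<close> fixed the other three
  terms tend to \<open>0\<close> as \<open>m\<close> grows; for \<open>far\<close> this follows from the bound of \<open>h N m\<close> by
  \<open>W\<close>, because \<open>modular_shift_op\<close> gives decay in \<open>m - j\<close> and here \<open>j < k\<close>.\<close>

lemma fejer_modular_tendsto:
  assumes f: "dyadic_martingale f"
    and G: "integrable Omega (\<lambda>x. g x * indicator (cell k z) x)"
    and gen: "\<And>n. k \<le> n \<Longrightarrow> AE x in Omega. f n x * indicator (cell k z) x =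
        real_cond_exp Omega (dyadic_sigma n) (\<lambda>y. g y * indicator (cell k z) y) x"
    and W: "W \<in> borel_measurable Omega" "(\<integral>\<^sup>+ x. W x \<partial>Omega) < \<infinity>"
    and bound: "\<And>n. AE x in Omega. ennreal (\<bar>f n x\<bar> powr p x) \<le> W x"
  shows "(\<lambda>n. modular p (\<lambda>x. (fejer_mean f n x - g x) * indicator (cell k z) x)) \<longlonglongrightarrow> 0"
proof (rule tendsto_zero_dyadic_blocks)
  fix e :: real assume e: "0 < e"
  let ?I = "cell k z"
  define t where "t = e / (4 * quasi_triangle_const)"
  have t: "0 < t" using e quasi_triangle_const_pos by (simp add: t_def)
  define u where "u = (\<lambda>n x. f n x * indicator ?I x - g x * indicator ?I x)"
  define h where "h = (\<lambda>N m x. \<bar>f m x - f N x\<bar> + \<bar>f (Suc m) x - f m x\<bar>)"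
  have u0: "(\<lambda>n. modular p (u n)) \<longlonglongrightarrow> 0"
    unfolding u_def by (rule restriction_modular_tendsto[OF f G gen W bound])
  have fm: "f n \<in> borel_measurable Omega" for n
    by (rule dyadic_step_measurable[OF martingale_step[OF f]])
  have Im: "(indicator ?I :: real \<Rightarrow> real) \<in> borel_measurable Omega"
    by (rule borel_measurable_Omega) simp
  have um: "u n \<in> borel_measurable Omega" for n
    unfolding u_def
    by (rule borel_measurable_diff[OF borel_measurable_times[OF fm Im] borel_measurable_integrable[OF G]])
  have hm: "h N m \<in> borel_measurable Omega" for N m unfolding h_def using fm by simp
  have hIm: "(\<lambda>x. h N m x * indicator ?I x) \<in> borel_measurable Omega" for N m
    by (intro borel_measurable_times hm Im)
  have h0: "0 \<le> h N m x" for N m x by (simp add: h_def)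
  have hstep: "dyadic_step m (h N m)" if "N \<le> m" for N m
    unfolding h_def by (rule martingale_difference_step[OF f that])
  have Istep: "dyadic_step k (indicator ?I :: real \<Rightarrow> real)"
    unfolding dyadic_step_def by (auto simp: indicator_def cell_def)
  have hIstep: "dyadic_step m (\<lambda>x. h N m x * indicator ?I x)" if "N \<le> m" "k \<le> m" for N m
    by (rule dyadic_step_combine[OF hstep[OF that(1)] dyadic_step_mono[OF Istep that(2)]])

  define D where "D = ennreal quasi_triangle_const * (4 * (\<integral>\<^sup>+ x. W x \<partial>Omega))"
  have D: "D < \<infinity>" unfolding D_def using W(2) by (simp add: ennreal_mult_less_top)
  have fW: "modular p (f n) \<le> (\<integral>\<^sup>+ x. W x \<partial>Omega)" for n
    unfolding modular_def by (rule nn_integral_mono_AE[OF bound])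
  have hD: "modular p (h N m) \<le> D" for N m
    unfolding D_def by (rule modular_add4[OF fm fm fm fm _ fW fW fW fW, of _ m N "Suc m" m]) (auto simp: h_def)
  obtain L where L: "1 \<le> L"
    and norm: "\<And>v. v \<in> borel_measurable Omega \<Longrightarrow> modular p v \<le> D \<Longrightarrow> modular p (\<lambda>x. 1 / L * v x) \<le> 1"
    using modular_normalize[OF D] by blast

  define c where "c = op_const * suminf decay"
  have c: "0 \<le> c" unfolding c_def
    using op_const_nonneg suminf_nonneg[OF summable_decay decay_nonneg] by simp
  obtain d where d: "0 < d" "d \<le> 1" "d powr pm * c \<le> t" using small_powr[OF t c] by blast
  \<comment> \<open>With this choice \<open>inner\<close>, which carries a factor \<open>4\<close>, is \<open>d\<close> times the operator applied to \<open>l * h N m\<close>.\<close>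
  define l where "l = 4 / d"
  have l: "1 \<le> l" using d by (simp add: l_def field_simps)
  \<comment> \<open>The threshold that makes the modular of \<open>l * h N m\<close> on the cell at most \<open>1\<close>.\<close>
  define s where "s = 1 / (l powr pp * quasi_triangle_const * 4)"
  have s: "0 < s" using l quasi_triangle_const_pos by (simp add: s_def)
  have "eventually (\<lambda>n. modular p (u n) < ennreal s) sequentially"
    using s by (intro order_tendstoD[OF u0]) simp
  then obtain N0 where N0: "\<And>n. N0 \<le> n \<Longrightarrow> modular p (u n) < ennreal s"
    unfolding eventually_sequentially by blast
  define N where "N = max N0 k"
  have small_on_I: "modular p (\<lambda>x. l * (h N m x * indicator ?I x)) \<le> 1" if m: "N \<le> m" for m
  proof -
    have us: "modular p (u n) \<le> ennreal s" if "N \<le> n" for n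
      using N0[of n] that by (simp add: N_def less_imp_le)
    have tri: "\<bar>a - b\<bar> \<le> \<bar>a - c\<bar> + \<bar>b - c\<bar>" for a b c :: real by arith
    have le: "\<bar>h N m x * indicator ?I x\<bar> \<le> \<bar>u m x\<bar> + \<bar>u N x\<bar> + \<bar>u (Suc m) x\<bar> + \<bar>u m x\<bar>" for x
    proof (cases "x \<in> ?I")
      case True
      then have heq: "\<bar>h N m x * indicator ?I x\<bar> = \<bar>f m x - f N x\<bar> + \<bar>f (Suc m) x - f m x\<bar>"
        using h0[of N m x] by (simp add: h_def)
      have ueq: "u n x = f n x - g x" for n using True by (simp add: u_def)
      show ?thesis
        unfolding heq ueq
        using add_mono[OF tri[of "f m x" "f N x" "g x"] tri[of "f (Suc m) x" "f m x" "g x"]]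
        by (simp only: add.assoc)
    qed simp
    have "modular p (\<lambda>x. h N m x * indicator ?I x) \<le> ennreal quasi_triangle_const * (4 * ennreal s)"
      by (rule modular_add4[OF um um um um AE_I2[OF le]]) (use m us in auto)
    then have "ennreal (l powr pp) * modular p (\<lambda>x. h N m x * indicator ?I x) \<le>
        ennreal (l powr pp) * (ennreal quasi_triangle_const * (4 * ennreal s))"
      by (rule mult_left_mono) simp
    also have "\<dots> = ennreal (l powr pp * (quasi_triangle_const * (4 * s)))"
      unfolding ennreal_quasi_triangle_const[OF less_imp_le[OF s]]
      by (rule ennreal_mult[symmetric]) (use s quasi_triangle_const_pos in auto)
    also have "l powr pp * (quasi_triangle_const * (4 * s)) = 1"
      using l quasi_triangle_const_pos by (simp add: s_def)
    finally show ?thesis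
      using order_trans[OF modular_scale_up[OF hIm l]] by simp
  qed
  obtain B where B: "0 \<le> B" "\<And>x. x \<in> {0..<1} \<Longrightarrow> \<bar>f N x\<bar> \<le> B"
    using dyadic_step_bounded[OF martingale_step[OF f]] by blast

  have "eventually (\<lambda>m. modular p (u m) < ennreal t) sequentially"
    using t by (intro order_tendstoD[OF u0]) simp
  moreover obtain b where b: "0 < b" "b \<le> 1" "b powr pm * 1 \<le> t"
    using small_powr[OF t, of 1] by auto
  have "eventually (\<lambda>m. 2 ^ N * B / 2 ^ m < b) sequentially"
  proof -
    have "(\<lambda>m. 2 ^ N * B * (1 / 2) ^ m) \<longlonglongrightarrow> 2 ^ N * B * 0"
      by (intro tendsto_mult tendsto_const LIMSEQ_power_zero) simp
    then have "(\<lambda>m. 2 ^ N * B / 2 ^ m) \<longlonglongrightarrow> 0" by (simp add: power_one_over)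
    then show ?thesis using b(1) by (rule order_tendstoD)
  qed
  moreover have "eventually (\<lambda>m. (4 * L) powr pp * (op_const * (\<Sum>j<k. decay (m - j))) < t) sequentially"
  proof -
    have "(\<lambda>m. (4 * L) powr pp * (op_const * (\<Sum>j<k. decay (m - j)))) \<longlonglongrightarrow> (4 * L) powr pp * (op_const * 0)"
      by (intro tendsto_mult tendsto_const decay_sum_tendsto)
    then show ?thesis using t by (intro order_tendstoD) auto
  qed
  ultimately have "eventually (\<lambda>m. modular p (u m) < ennreal t \<and> 2 ^ N * B / 2 ^ m < b \<and>
      (4 * L) powr pp * (op_const * (\<Sum>j<k. decay (m - j))) < t \<and> N \<le> m) sequentially"
    using eventually_ge_at_top[of N] by eventually_elim auto
  then obtain m0 where m0: "\<And>m. m0 \<le> m \<Longrightarrow> modular p (u m) < ennreal t"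
      "\<And>m. m0 \<le> m \<Longrightarrow> 2 ^ N * B / 2 ^ m < b"
      "\<And>m. m0 \<le> m \<Longrightarrow> (4 * L) powr pp * (op_const * (\<Sum>j<k. decay (m - j))) < t"
      "\<And>m. m0 \<le> m \<Longrightarrow> N \<le> m"
    unfolding eventually_sequentially by blast
  show "\<exists>m0. \<forall>m\<ge>m0. \<forall>n. 2 ^ m \<le> n \<and> n < 2 ^ Suc m \<longrightarrow>
      modular p (\<lambda>x. (fejer_mean f n x - g x) * indicator ?I x) \<le> ennreal e"
  proof (intro exI[of _ m0] allI impI, elim conjE)
    fix m n :: nat assume m: "m0 \<le> m" and n: "2 ^ m \<le> n" "n < 2 ^ Suc m"
    have Nm: "N \<le> m" by (rule m0(4)[OF m])
    have km: "k \<le> m" using Nm by (simp add: N_def)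
    define q where "q = 2 ^ N * B / 2 ^ m"
    have q: "0 \<le> q" "q \<le> b" using m0(2)[OF m] B(1) by (auto simp: q_def)
    define far where "far = (\<lambda>x. 4 * shift_op m {..<k} (h N m) x)"
    define inner where "inner = (\<lambda>x. 4 * shift_op m {k..m} (\<lambda>y. h N m y * indicator ?I y) x)"
    have meas: "far \<in> borel_measurable Omega" "inner \<in> borel_measurable Omega"
      unfolding far_def inner_def by (intro borel_measurable_times borel_measurable_const shift_op_measurable)+
    have "modular p (\<lambda>x. (fejer_mean f n x - g x) * indicator ?I x) \<le> ennreal quasi_triangle_const * (4 * ennreal t)"
    proof (rule modular_add4[OF um _ meas, of "\<lambda>_. q"])
      show "AE x in Omega. \<bar>(fejer_mean f n x - g x) * indicator ?I x\<bar> \<le> \<bar>u m x\<bar> + \<bar>q\<bar> + \<bar>far x\<bar> + \<bar>inner x\<bar>"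
        using AE_space
      proof eventually_elim
        case (elim x)
        then have x: "x \<in> {0..<1}" by simp
        show ?case
        proof (cases "x \<in> ?I")
          case True
          have "\<bar>fejer_mean f n x - f m x\<bar> \<le> q + 4 * shift_op m {..m} (h N m) x"
            unfolding q_def h_def by (rule fejer_mean_bound[OF f x n Nm B(2)])
          also have "4 * shift_op m {..m} (h N m) x = far x + inner x"
            unfolding shift_op_localize[OF km True] far_def inner_def by simp
          finally have "\<bar>fejer_mean f n x - g x\<bar> \<le> \<bar>f m x - g x\<bar> + \<bar>q\<bar> + \<bar>far x\<bar> + \<bar>inner x\<bar>"
            by linarith
          then show ?thesis using True by (simp add: u_def)
        qed simp
      qed
      show "modular p (u m) \<le> ennreal t" using m0(1)[OF m] by (rule less_imp_le)
      show "modular p (\<lambda>_. q) \<le> ennreal t"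
      proof -
        have "modular p (\<lambda>_. q * 1) \<le> ennreal (q powr pm) * modular p (\<lambda>_. 1)"
          by (rule modular_scale_down) (use q b in auto)
        also have "modular p (\<lambda>_. 1) = 1" by (simp add: modular_def Omega.emeasure_space_1[simplified])
        also have "ennreal (q powr pm) * 1 \<le> ennreal t"
        proof -
          have "q powr pm \<le> b powr pm" using q pm by (intro powr_mono2) auto
          then show ?thesis using b by (simp add: ennreal_leI)
        qed
        finally show ?thesis by simp
      qed
      show "modular p far \<le> ennreal t"
      proof -
        have "far = (\<lambda>x. (4 * L) * shift_op m {..<k} (\<lambda>y. 1 / L * h N m y) x)"
          unfolding far_def shift_op_scale using L by auto
        then have "modular p far \<le> ennreal ((4 * L) powr pp) * modular p (shift_op m {..<k} (\<lambda>y. 1 / L * h N m y))"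
          using modular_scale_up[OF shift_op_measurable, of "4 * L"] L by simp
        also have "\<dots> \<le> ennreal ((4 * L) powr pp) * ennreal (op_const * (\<Sum>j<k. decay (m - j)))"
        proof (intro mult_left_mono modular_shift_op)
          show "dyadic_step m (\<lambda>y. 1 / L * h N m y)"
            by (rule dyadic_step_combine[OF _ hstep[OF Nm], of "\<lambda>_. 1 / L"]) (simp add: dyadic_step_def)
          show "modular p (\<lambda>y. 1 / L * h N m y) \<le> 1" by (rule norm[OF hm hD])
        qed (use h0 L km in auto)
        also have "\<dots> = ennreal ((4 * L) powr pp * (op_const * (\<Sum>j<k. decay (m - j))))"
          using op_const_nonneg decay_nonneg by (intro ennreal_mult[symmetric]) (auto intro!: mult_nonneg_nonneg sum_nonneg)
        also have "\<dots> \<le> ennreal t" using m0(3)[OF m] by (intro ennreal_leI) simp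
        finally show ?thesis .
      qed
      show "modular p inner \<le> ennreal t"
      proof -
        let ?v = "\<lambda>y. l * (h N m y * indicator ?I y)"
        have "inner = (\<lambda>x. d * shift_op m {k..m} ?v x)"
          unfolding inner_def shift_op_scale using d by (auto simp: l_def)
        then have "modular p inner \<le> ennreal (d powr pm) * modular p (shift_op m {k..m} ?v)"
          using modular_scale_down[OF shift_op_measurable, of d] d by simp
        also have "\<dots> \<le> ennreal (d powr pm) * ennreal c"
        proof (rule mult_left_mono)
          have "modular p (shift_op m {k..m} ?v) \<le> ennreal (op_const * (\<Sum>j\<in>{k..m}. decay (m - j)))"
          proof (rule modular_shift_op)
            show "dyadic_step m ?v"
              by (rule dyadic_step_combine[OF _ hIstep[OF Nm km], of "\<lambda>_. l"]) (simp add: dyadic_step_def)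
            show "modular p ?v \<le> 1" by (rule small_on_I[OF Nm])
          qed (use h0 l in auto)
          also have "\<dots> \<le> ennreal c"
            unfolding c_def by (intro ennreal_leI mult_left_mono sum_decay_le op_const_nonneg) auto
          finally show "modular p (shift_op m {k..m} ?v) \<le> ennreal c" .
        qed simp
        also have "\<dots> = ennreal (d powr pm * c)" using c by (simp add: ennreal_mult)
        also have "\<dots> \<le> ennreal t" by (rule ennreal_leI[OF d(3)])
        finally show ?thesis .
      qed
    qed simp
    also have "\<dots> = ennreal (quasi_triangle_const * (4 * t))" by (rule ennreal_quasi_triangle_const[OF less_imp_le[OF t]])
    also have "quasi_triangle_const * (4 * t) = e" using quasi_triangle_const_pos by (simp add: t_def)
    finally show "modular p (\<lambda>x. (fejer_mean f n x - g x) * indicator ?I x) \<le> ennreal e" .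
  qed
qed

end

section \<open>From the modular to the quasi-norm\<close>

lemma ennreal_powr_divide:
  assumes "0 < l"
  shows "ennreal_powr (ennreal \<bar>y\<bar> / ennreal l) q = ennreal ((\<bar>y\<bar> / l) powr q)"
proof -
  have "ennreal \<bar>y\<bar> / ennreal l = ennreal (\<bar>y\<bar> / l)" using assms by (simp add: divide_ennreal)
  then show ?thesis using assms by (simp add: ennreal_powr_def)
qed

lemma ennreal_powr_mono:
  assumes "a \<le> b" "0 \<le> q"
  shows "ennreal_powr a q \<le> ennreal_powr b q"
proof (cases "b = \<infinity>")
  case False
  then have "b < top" by (simp add: top.not_eq_extremum)
  then have "enn2real a \<le> enn2real b" using assms(1) by (rule enn2real_mono[rotated])
  moreover have "a \<noteq> \<infinity>" using assms(1) \<open>b < top\<close> by auto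
  ultimately show ?thesis using False assms(2)
    by (auto simp: ennreal_powr_def intro!: ennreal_leI powr_mono2)
qed (simp add: ennreal_powr_def)

lemma fejer_mean_measurable: "fejer_mean f n \<in> borel_measurable Omega"
proof (rule borel_measurable_Omega)
  have "walsh l \<in> borel_measurable borel" for l unfolding walsh_def[abs_def] by measurable
  then show "fejer_mean f n \<in> borel_measurable borel"
    unfolding fejer_mean_def[abs_def] walsh_sum_def[abs_def] by measurable
qed

context dyadic_exponent
begin

text \<open>Since the exponent is bounded, dividing by a small \<open>l\<close> multiplies the modular by at most
  \<open>(1 / l) powr pp\<close>.\<close>

lemma Lp_norm_tendsto_0:
  assumes u: "\<And>n. u n \<in> borel_measurable Omega" and lim: "(\<lambda>n. modular p (u n)) \<longlonglongrightarrow> 0"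
  shows "(\<lambda>n. Lp_norm p (\<lambda>x. ennreal \<bar>u n x\<bar>)) \<longlonglongrightarrow> 0"
proof (rule order_tendstoI)
  fix a :: ennreal assume "0 < a"
  then obtain e :: real where e: "0 < e" "ennreal e < a" by (rule ennreal_real_between)
  define l where "l = min 1 e"
  have l: "0 < l" "l \<le> 1" "l \<le> e" using e(1) by (auto simp: l_def)
  have l1: "1 \<le> 1 / l" using l by simp
  have "(\<lambda>n. ennreal ((1 / l) powr pp) * modular p (u n)) \<longlonglongrightarrow> ennreal ((1 / l) powr pp) * 0"
    by (rule ennreal_tendsto_cmult[OF _ lim]) simp
  then have "eventually (\<lambda>n. ennreal ((1 / l) powr pp) * modular p (u n) < 1) sequentially"
    by (intro order_tendstoD) auto
  then show "eventually (\<lambda>n. Lp_norm p (\<lambda>x. ennreal \<bar>u n x\<bar>) < a) sequentially"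
  proof eventually_elim
    case (elim n)
    have "(\<integral>\<^sup>+ x. ennreal_powr (ennreal \<bar>u n x\<bar> / ennreal l) (p x) \<partial>Omega) = modular p (\<lambda>x. 1 / l * u n x)"
      using l by (simp add: ennreal_powr_divide modular_def abs_mult)
    also have "\<dots> \<le> ennreal ((1 / l) powr pp) * modular p (u n)" by (rule modular_scale_up[OF u l1])
    also have "\<dots> \<le> 1" using elim by (rule less_imp_le)
    finally have "Lp_norm p (\<lambda>x. ennreal \<bar>u n x\<bar>) \<le> ennreal l"
      unfolding Lp_norm_def using l by (intro Inf_lower) auto
    also have "\<dots> \<le> ennreal e" using l by (intro ennreal_leI)
    finally show ?case using e(2) by (rule le_less_trans)
  qed
qed simp

text \<open>The scaled maximal function, raised to the variable power, where the scaling parameter \<open>l\<close> is any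
  one admissible in the definition of the quasi-norm.\<close>

lemma Hardy_dominant:
  assumes f: "\<And>n. f n \<in> borel_measurable Omega" and fin: "Hardy_norm p f < \<infinity>"
  obtains W where "W \<in> borel_measurable Omega" "(\<integral>\<^sup>+ x. W x \<partial>Omega) < \<infinity>"
    "\<And>n. AE x in Omega. ennreal (\<bar>f n x\<bar> powr p x) \<le> W x"
proof -
  obtain l where l: "0 < l" "(\<integral>\<^sup>+ x. ennreal_powr (maximal_function f x / ennreal l) (p x) \<partial>Omega) \<le> 1"
    using fin unfolding Hardy_norm_def Lp_norm_def Inf_less_iff by auto
  define V where "V = (\<lambda>x. ennreal_powr (maximal_function f x / ennreal l) (p x))"
  have Mm: "maximal_function f \<in> borel_measurable Omega"
    unfolding maximal_function_def[abs_def] using f by measurable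
  have Vm: "V \<in> borel_measurable Omega"
    unfolding V_def ennreal_powr_def using Mm p_measurable by measurable
  define c where "c = max 1 l powr pp"
  show ?thesis
  proof (rule that[of "\<lambda>x. ennreal c * V x"])
    show "(\<lambda>x. ennreal c * V x) \<in> borel_measurable Omega" using Vm by simp
    have "(\<integral>\<^sup>+ x. ennreal c * V x \<partial>Omega) = ennreal c * (\<integral>\<^sup>+ x. V x \<partial>Omega)"
      by (rule nn_integral_cmult[OF Vm])
    also have "\<dots> \<le> ennreal c * 1" using l(2) unfolding V_def by (intro mult_left_mono) auto
    finally show "(\<integral>\<^sup>+ x. ennreal c * V x \<partial>Omega) < \<infinity>" by (simp add: le_less_trans)
    show "AE x in Omega. ennreal (\<bar>f n x\<bar> powr p x) \<le> ennreal c * V x" for n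
      using AE_p_bounds
    proof eventually_elim
      case (elim x)
      have q: "0 \<le> p x" using elim pm by linarith
      have "\<bar>f n x\<bar> powr p x = l powr p x * (\<bar>f n x\<bar> / l) powr p x"
        using l by (simp add: powr_divide)
      also have "\<dots> \<le> c * (\<bar>f n x\<bar> / l) powr p x"
      proof (rule mult_right_mono)
        have "l powr p x \<le> max 1 l powr p x" using l q by (intro powr_mono2) auto
        also have "\<dots> \<le> c" unfolding c_def using elim by (intro powr_mono) auto
        finally show "l powr p x \<le> c" .
      qed simp
      finally have "ennreal (\<bar>f n x\<bar> powr p x) \<le> ennreal (c * (\<bar>f n x\<bar> / l) powr p x)"
        by (rule ennreal_leI)
      also have "\<dots> = ennreal c * ennreal_powr (ennreal \<bar>f n x\<bar> / ennreal l) (p x)"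
        using l by (simp add: ennreal_powr_divide ennreal_mult c_def)
      also have "\<dots> \<le> ennreal c * V x"
        unfolding V_def maximal_function_def
        by (intro mult_left_mono ennreal_powr_mono divide_right_mono_ennreal SUP_upper q) auto
      finally show ?case .
    qed
  qed
qed

end

text \<open>The essential bounds over an interval of positive measure lie between the global ones, so they
  are finite and correctly ordered.\<close>

lemma dyadic_interval_bounds:
  assumes p: "p \<in> borel_measurable Omega" and A: "A \<in> dyadic_intervals n"
    and bounds: "AE x in Omega. a \<le> p x \<and> p x \<le> b"
  obtains r s where "p_minus p A = ereal r" "p_plus p A = ereal s" "a \<le> r" "r \<le> s" "s \<le> b"
    "AE x in Omega. x \<in> A \<longrightarrow> r \<le> p x \<and> p x \<le> s"
proof -
  obtain z where z: "z \<in> {0..<1}" "A = cell n z" using A by (auto simp: dyadic_intervals_cells)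
  have sub: "A \<subseteq> {0..<1}" using cell_subset z by simp
  have Al: "A \<in> sets lebesgue" using z(2) by simp
  have pm: "p \<in> borel_measurable (lebesgue_on A)"
    using p unfolding Omega_def by (rule measurable_restrict_mono[OF _ sub])
  have AE_A: "(AE x in lebesgue_on A. P x) \<longleftrightarrow> (AE x in Omega. x \<in> A \<longrightarrow> P x)" for P
  proof -
    have "(AE x in lebesgue_on A. P x) \<longleftrightarrow> (AE x in lebesgue. x \<in> A \<longrightarrow> P x)"
      using Al by (subst AE_restrict_space_iff) auto
    also have "\<dots> \<longleftrightarrow> (AE x in lebesgue. x \<in> {0..<1} \<longrightarrow> x \<in> A \<longrightarrow> P x)"
      using sub by (intro AE_cong) auto
    also have "\<dots> \<longleftrightarrow> (AE x in Omega. x \<in> A \<longrightarrow> P x)"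
      unfolding Omega_def by (subst AE_restrict_space_iff) auto
    finally show ?thesis .
  qed
  have up: "AE x in lebesgue_on A. ereal (p x) \<le> p_plus p A"
    unfolding p_plus_def by (rule esssup_AE)
  have lo: "AE x in lebesgue_on A. p_minus p A \<le> ereal (p x)"
    using esssup_AE[of "\<lambda>x. - ereal (p x)" "lebesgue_on A"]
    unfolding p_minus_def by (simp add: ereal_uminus_le_reorder)
  have bA: "AE x in lebesgue_on A. a \<le> p x \<and> p x \<le> b"
    unfolding AE_A using bounds by eventually_elim simp
  have plus: "p_plus p A \<le> ereal b"
    unfolding p_plus_def using pm bA by (intro esssup_I) (auto elim: eventually_mono)
  have "esssup (lebesgue_on A) (\<lambda>x. - ereal (p x)) \<le> - ereal a"
    using pm bA by (intro esssup_I) (auto elim: eventually_mono)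
  then have minus: "ereal a \<le> p_minus p A"
    unfolding p_minus_def by (metis ereal_minus_le_minus ereal_uminus_uminus)
  have mid: "p_minus p A \<le> p_plus p A"
  proof (rule ccontr)
    assume "\<not> ?thesis"
    then have "AE x in lebesgue_on A. False"
      using up lo by (auto elim!: eventually_elim2)
    then have "AE x in Omega. x \<notin> A" unfolding AE_A by simp
    then have "emeasure Omega A = 0"
      using sets_Omega[of A] z sub by (subst (asm) AE_iff_measurable[of A]) (auto simp: Int_absorb2)
    then show False using emeasure_cell[OF z(1), of n] z(2) by simp
  qed
  obtain r where r: "p_minus p A = ereal r"
    using minus mid plus by (cases "p_minus p A") auto
  obtain s where s: "p_plus p A = ereal s"
    using minus mid plus by (cases "p_plus p A") auto
  show ?thesis
  proof (rule that[OF r s])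
    show "AE x in Omega. x \<in> A \<longrightarrow> r \<le> p x \<and> p x \<le> s"
      using up lo unfolding r s AE_A by eventually_elim simp
  qed (use minus mid plus r s in auto)
qed

theorem corollary5p25:
  fixes p :: "real \<Rightarrow> real" and f :: "nat \<Rightarrow> real \<Rightarrow> real"
    and I :: "real set" and k :: nat and g :: "real \<Rightarrow> real"
  assumes "p \<in> borel_measurable Omega"
    and "\<And>x. x \<in> {0..<1} \<Longrightarrow> 0 < p x"
    and "0 < p_minus p {0..<1}"
    and "p_minus p {0..<1} \<le> p_plus p {0..<1}"
    and "p_plus p {0..<1} < \<infinity>"
    and "\<exists>K::real. 1 \<le> K \<and> (\<forall>n. \<forall>A\<in>dyadic_intervals n.
           measure Omega A powr real_of_ereal (p_minus p A - p_plus p A) \<le> K)"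
    and "1 / p_minus p {0..<1} - 1 / p_plus p {0..<1} < 1"
    and "1 / 2 < p_minus p {0..<1}" and "p_minus p {0..<1} < \<infinity>"
    and "f \<in> Hardy_space p"
    and "I \<in> dyadic_intervals k"
    and "restriction_generated_by f k I g"
  shows "(\<lambda>n. Lp_norm p (\<lambda>x. ennreal \<bar>(fejer_mean f n x - g x) * indicator I x\<bar>)) \<longlonglongrightarrow> 0"
proof -
  obtain pm where pm: "p_minus p {0..<1} = ereal pm"
    using assms(3,9) by (cases "p_minus p {0..<1}") auto
  obtain pp where pp: "p_plus p {0..<1} = ereal pp"
    using assms(3-5) pm by (cases "p_plus p {0..<1}") auto
  have pm2: "1 / 2 < pm"
  proof -
    have "ereal (1 / 2) < ereal pm" using assms(8) unfolding pm by (simp add: divide_ereal_def)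
    then show ?thesis by simp
  qed
  have pmpp: "pm \<le> pp" using assms(4) by (simp add: pm pp)
  have gap: "1 / pm - 1 / pp < 1"
    using assms(7) pm2 pmpp unfolding pm pp by (simp add: one_ereal_def)
  obtain K where K: "1 \<le> K" "\<And>n A. A \<in> dyadic_intervals n \<Longrightarrow>
      measure Omega A powr real_of_ereal (p_minus p A - p_plus p A) \<le> K"
    using assms(6) by blast
  have p_bounds: "AE x in Omega. pm \<le> p x \<and> p x \<le> pp"
  proof -
    have "AE x in Omega. - ereal (p x) \<le> - ereal pm"
      using esssup_AE[of "\<lambda>x. - ereal (p x)" Omega] pm
      unfolding p_minus_def Omega_def[symmetric] by (simp only: ereal_uminus_eq_reorder)
    moreover have "AE x in Omega. ereal (p x) \<le> ereal pp"
      using esssup_AE[of "\<lambda>x. ereal (p x)" Omega] pp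
      unfolding p_plus_def Omega_def[symmetric] by simp
    ultimately show ?thesis by eventually_elim simp
  qed
  define lo where "lo = (\<lambda>j x. real_of_ereal (p_minus p (cell j x)))"
  define hi where "hi = (\<lambda>j x. real_of_ereal (p_plus p (cell j x)))"
  have in_dyadic: "cell j x \<in> dyadic_intervals j" if "x \<in> {0..<1}" for j x
    using that by (auto simp: dyadic_intervals_cells)
  interpret dyadic_exponent p lo hi pm pp "log 2 K"
  proof
    show "AE x in Omega. lo j x \<le> p x \<and> p x \<le> hi j x" for j
    proof -
      have fin: "countable (dyadic_intervals j)"
        unfolding dyadic_intervals_def by (intro countable_finite) simp
      have "AE x in Omega. \<forall>A\<in>dyadic_intervals j. x \<in> A \<longrightarrow>
          real_of_ereal (p_minus p A) \<le> p x \<and> p x \<le> real_of_ereal (p_plus p A)"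
        unfolding AE_ball_countable[OF fin]
      proof
        fix A assume "A \<in> dyadic_intervals j"
        then obtain r s where "p_minus p A = ereal r" "p_plus p A = ereal s"
          "AE x in Omega. x \<in> A \<longrightarrow> r \<le> p x \<and> p x \<le> s"
          using dyadic_interval_bounds[OF assms(1) _ p_bounds] by blast
        then show "AE x in Omega. x \<in> A \<longrightarrow>
            real_of_ereal (p_minus p A) \<le> p x \<and> p x \<le> real_of_ereal (p_plus p A)" by simp
      qed
      then show ?thesis using AE_space
      proof eventually_elim
        case (elim x)
        then show ?case using in_dyadic[of x j] by (auto simp: lo_def hi_def)
      qed
    qed
    show "lo j y = lo j x" if "y \<in> cell j x" for j x y
      using cell_eq[OF that] by (simp add: lo_def)
    fix j and x :: real assume x: "x \<in> {0..<1}"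
    from dyadic_interval_bounds[OF assms(1) in_dyadic[OF x] p_bounds, of j]
    obtain r s where rs: "p_minus p (cell j x) = ereal r" "p_plus p (cell j x) = ereal s"
      "pm \<le> r" "r \<le> s" "s \<le> pp" by blast
    then show "pm \<le> lo j x \<and> lo j x \<le> hi j x \<and> hi j x \<le> pp"
      by (simp add: lo_def hi_def)
    have "(1 / 2 ^ j) powr (r - s) \<le> K"
      using K(2)[OF in_dyadic[OF x], of j] rs by (simp add: measure_cell[OF x])
    moreover have "(1 / 2 ^ j) powr (r - s) = 2 powr (real j * (s - r))"
    proof -
      have "(1 / 2 ^ j :: real) = 2 powr (- real j)" by (simp add: powr_minus_divide powr_realpow)
      then show ?thesis by (simp add: powr_powr algebra_simps)
    qed
    ultimately have "real j * (s - r) \<le> log 2 K" using K(1) by (simp add: le_log_iff)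
    then show "real j * (hi j x - lo j x) \<le> log 2 K" by (simp add: lo_def hi_def rs)
  qed (use assms(1) pm2 gap in auto)

  have f: "dyadic_martingale f" and Hf: "Hardy_norm p f < \<infinity>"
    using assms(10) by (auto simp: Hardy_space_def)
  obtain z where z: "z \<in> {0..<1}" "I = cell k z"
    using assms(11) by (auto simp: dyadic_intervals_cells)
  have sub: "I \<subseteq> {0..<1}" using cell_subset z by simp
  have G: "integrable Omega (\<lambda>x. g x * indicator I x)"
  proof -
    have "integrable lebesgue (\<lambda>x. indicator I x *\<^sub>R g x)"
      using assms(12) z(2) unfolding restriction_generated_by_def
      by (subst (asm) integrable_restrict_space) auto
    moreover have "(\<lambda>x. indicator I x *\<^sub>R g x) = (\<lambda>x. indicator {0..<1} x *\<^sub>R (g x * indicator I x))"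
      using sub by (auto simp: indicator_def fun_eq_iff)
    ultimately show ?thesis unfolding Omega_def by (subst integrable_restrict_space) auto
  qed
  have gen: "AE x in Omega. f n x * indicator I x =
      real_cond_exp Omega (dyadic_sigma n) (\<lambda>y. g y * indicator I y) x" if "k \<le> n" for n
    using assms(12) that by (simp add: restriction_generated_by_def)
  obtain W where W: "W \<in> borel_measurable Omega" "(\<integral>\<^sup>+ x. W x \<partial>Omega) < \<infinity>"
    "\<And>n. AE x in Omega. ennreal (\<bar>f n x\<bar> powr p x) \<le> W x"
    using Hardy_dominant[OF dyadic_step_measurable[OF martingale_step[OF f]] Hf] by blast
  show ?thesis
  proof (rule Lp_norm_tendsto_0)
    show "(\<lambda>n. modular p (\<lambda>x. (fejer_mean f n x - g x) * indicator I x)) \<longlonglongrightarrow> 0"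
      using fejer_modular_tendsto[OF f G[unfolded z(2)] gen[unfolded z(2)] W] unfolding z(2) .
    have Im: "(indicator I :: real \<Rightarrow> real) \<in> borel_measurable Omega"
      unfolding z(2) by (rule borel_measurable_Omega) simp
    show "(\<lambda>x. (fejer_mean f n x - g x) * indicator I x) \<in> borel_measurable Omega" for n
      unfolding left_diff_distrib
      by (rule borel_measurable_diff[OF borel_measurable_times[OF fejer_mean_measurable Im]
            borel_measurable_integrable[OF G]])
  qed
qed

end
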